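(* For $s=1,\dots,5$ let $\mathfrak{g}^s=\mathfrak{h}^s\oplus\mathfrak{m}^s$ be the reductive decomposition related to the 3-Sasakian homogeneous manifold $G_2/\mathrm{Sp}(1)$, $F_4/\mathrm{Sp}(3)$, $E_6/\mathrm{SU}(6)$, $E_7/\mathrm{Spin}(12)$, $E_8/E_7$, respectively. Then $$\dim_{\mathbb{R}}\mathrm{Hom}_{\mathfrak{h}^s}(\mathfrak{m}^s\otimes\mathfrak{m}^s,\mathfrak{m}^s)=63,\qquad\dim_{\mathbb{R}}\mathrm{Hom}_{\mathfrak{h}^s}(\mathfrak{m}^s,\Lambda^2\mathfrak{m}^s)=30,\qquad\dim_{\mathbb{R}}\mathrm{Hom}_{\mathfrak{h}^s}(\Lambda^3\mathfrak{m}^s,\mathbb{R})=10.$$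
   Context: $\mathfrak{g}^s$ is the compact real simple Lie algebra of type $\mathfrak{g}_2,\mathfrak{f}_4,\mathfrak{e}_6,\mathfrak{e}_7,\mathfrak{e}_8$, and $\mathfrak{h}^s$ is a subalgebra isomorphic to $\mathfrak{sp}(1),\mathfrak{sp}(3),\mathfrak{su}(6),\mathfrak{so}(12),\mathfrak{e}_7$ (compact forms), respectively. There is a $\mathbb{Z}_2$-grading $\mathfrak{g}^s=(\mathfrak{g}^s)_0\oplus(\mathfrak{g}^s)_1$ with $(\mathfrak{g}^s)_0=\mathfrak{sp}(1)\oplus\mathfrak{h}^s$ (sum of two ideals), such that $(\mathfrak{g}^s)_1^{\mathbb{C}}\cong\mathbb{C}^2\otimes W_s$ as module over $(\mathfrak{g}^s)_0^{\mathbb{C}}\cong\mathfrak{sl}(2,\mathbb{C})\oplus(\mathfrak{h}^s)^{\mathbb{C}}$, with $\mathbb{C}^2$ the natural module of the ideal $\mathfrak{sp}(1)^{\mathbb{C}}\cong\mathfrak{sl}(2,\mathbb{C})$ and $W_s$ the irreducible $(\mathfrak{h}^s)^{\mathbb{C}}$-module $V(3)$ (the 4-dimensional irreducible $\mathfrak{sl}(2,\mathbb{C})$-module), $V(\lambda_3)$ of $C_3$ (dimension 14), $V(\lambda_3)$ of $A_5$ (dimension 20), $V(\lambda_5)$ of $D_6$ (a half-spin module, dimension 32), $V(\lambda_7)$ of $E_7$ (dimension 56), respectively. The reductive complement is $\mathfrak{m}^s=\mathfrak{sp}(1)\oplus(\mathfrak{g}^s)_1$, which is the orthogonal complement of $\mathfrak{h}^s$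 for the Killing form. $\mathfrak{m}^s$ is an $\mathfrak{h}^s$-module by the bracket; $\mathfrak{m}^s\otimes\mathfrak{m}^s$ and $\Lambda^k\mathfrak{m}^s$ have the induced actions, $\mathbb{R}$ is the trivial module, and $\mathrm{Hom}_{\mathfrak{h}^s}$ denotes real linear $\mathfrak{h}^s$-module homomorphisms. *)

theory Defs
  imports "HOL-Analysis.Analysis" "HOL-Library.Function_Algebras"
begin

text \<open>
  Vector spaces are given by a scalar multiplication \<open>sc\<close> on an ambient type (the locale
  \<open>vector_space\<close>) together with a carrier \<open>V\<close>, a subspace for \<open>sc\<close>.  This allows real and complex
  spaces, subalgebras, and complexifications to be treated by the same definitions.
\<close>

section \<open>Linear algebra on carriers\<close>

definition vspace :: "('k::field \<Rightarrow> 'v::ab_group_add \<Rightarrow> 'v) \<Rightarrow> 'v set \<Rightarrow> bool" where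
  "vspace sc V \<longleftrightarrow> vector_space sc \<and> module.subspace sc V"

definition findim :: "('k::field \<Rightarrow> 'v::ab_group_add \<Rightarrow> 'v) \<Rightarrow> 'v set \<Rightarrow> bool" where
  "findim sc V \<longleftrightarrow> (\<exists>B. finite B \<and> V = module.span sc B)"

definition linear_map :: "('k::field \<Rightarrow> 'v::ab_group_add \<Rightarrow> 'v) \<Rightarrow> 'v set \<Rightarrow>
    ('k \<Rightarrow> 'w::ab_group_add \<Rightarrow> 'w) \<Rightarrow> 'w set \<Rightarrow> ('v \<Rightarrow> 'w) \<Rightarrow> bool" where
  "linear_map scV V scW W f \<longleftrightarrow>
     (\<forall>x\<in>V. f x \<in> W) \<and>
     (\<forall>x\<in>V. \<forall>y\<in>V. f (x + y) = f x + f y) \<and>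
     (\<forall>c. \<forall>x\<in>V. f (scV c x) = scW c (f x))"

definition bilinear_map :: "('k::field \<Rightarrow> 'v::ab_group_add \<Rightarrow> 'v) \<Rightarrow> 'v set \<Rightarrow>
    ('k \<Rightarrow> 'w::ab_group_add \<Rightarrow> 'w) \<Rightarrow> 'w set \<Rightarrow>
    ('k \<Rightarrow> 'u::ab_group_add \<Rightarrow> 'u) \<Rightarrow> 'u set \<Rightarrow> ('v \<Rightarrow> 'w \<Rightarrow> 'u) \<Rightarrow> bool" where
  "bilinear_map scV V scW W scU U f \<longleftrightarrow>
     (\<forall>x\<in>V. linear_map scW W scU U (f x)) \<and>
     (\<forall>y\<in>W. linear_map scV V scU U (\<lambda>x. f x y))"

text \<open>The trace of an endomorphism of a finite-dimensional \<open>V\<close>, computed in an arbitrary basis.\<close>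

definition endo_trace ::
    "('k::field \<Rightarrow> 'v::ab_group_add \<Rightarrow> 'v) \<Rightarrow> 'v set \<Rightarrow> ('v \<Rightarrow> 'v) \<Rightarrow> 'k" where
  "endo_trace sc V f =
     (let B = (SOME B. \<not> module.dependent sc B \<and> module.span sc B = V)
      in \<Sum>b\<in>B. module.representation sc B (f b) b)"

definition set_plus_of :: "'v::ab_group_add set \<Rightarrow> 'v set \<Rightarrow> 'v set" where
  "set_plus_of U V = {x + y | x y. x \<in> U \<and> y \<in> V}"

definition direct_sum :: "'v::ab_group_add set \<Rightarrow> 'v set \<Rightarrow> 'v set \<Rightarrow> bool" where
  "direct_sum X U V \<longleftrightarrow> X = set_plus_of U V \<and> U \<inter> V = {0}"


section \<open>Tensor products and exterior powers\<close>

text \<open>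
  Let \<open>P\<close> be the set of bilinear forms on \<open>V \<times> W\<close> (or of alternating \<open>k\<close>-linear forms on \<open>V\<close>).
  The pure tensor (or decomposable \<open>k\<close>-vector) with components \<open>x\<close> is represented by the
  functional ``evaluate at \<open>x\<close>'' on \<open>P\<close>, and the tensor product (or exterior power) is the span of
  these inside the dual of \<open>P\<close>.  Functionals are extended by \<open>0\<close> outside \<open>P\<close>.  The universal
  property is proved below.
\<close>

definition fun_scale :: "('k \<Rightarrow> 'v \<Rightarrow> 'v) \<Rightarrow> 'k \<Rightarrow> ('x \<Rightarrow> 'v) \<Rightarrow> ('x \<Rightarrow> 'v)" where
  "fun_scale sc c f = (\<lambda>x. sc c (f x))"

abbreviation dual_scale :: "'k::field \<Rightarrow> (('x \<Rightarrow> 'k) \<Rightarrow> 'k) \<Rightarrow> (('x \<Rightarrow> 'k) \<Rightarrow> 'k)" where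
  "dual_scale \<equiv> fun_scale (*)"

definition evaluation :: "('x \<Rightarrow> 'k::field) set \<Rightarrow> 'x \<Rightarrow> (('x \<Rightarrow> 'k) \<Rightarrow> 'k)" where
  "evaluation P x = (\<lambda>\<beta>. if \<beta> \<in> P then \<beta> x else 0)"

text \<open>The transpose of an operator \<open>D\<close> on forms.\<close>

definition dual_action ::
    "('x \<Rightarrow> 'k::field) set \<Rightarrow> (('x \<Rightarrow> 'k) \<Rightarrow> ('x \<Rightarrow> 'k)) \<Rightarrow> (('x \<Rightarrow> 'k) \<Rightarrow> 'k) \<Rightarrow> (('x \<Rightarrow> 'k) \<Rightarrow> 'k)" where
  "dual_action P D T = (\<lambda>\<beta>. if \<beta> \<in> P then T (D \<beta>) else 0)"

lemma vector_space_fun_scale: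
  assumes "vector_space sc"
  shows "vector_space (fun_scale sc)"
proof -
  interpret vector_space sc by fact
  show ?thesis
    by unfold_locales (auto simp: fun_scale_def fun_eq_iff algebra_simps)
qed

text \<open>
  The universal property, for both instances at once: \<open>b\<close> factors uniquely through \<open>evaluation P\<close>
  as soon as the composites of \<open>b\<close> with linear functionals lie in \<open>P\<close>.
\<close>

lemma evaluation_universal:
  fixes scU :: "'k::field \<Rightarrow> 'u::ab_group_add \<Rightarrow> 'u" and b :: "'x \<Rightarrow> 'u"
  assumes U: "vector_space scU"
    and P: "\<And>\<phi>. linear_map scU UNIV (*) UNIV \<phi> \<Longrightarrow> \<phi> \<circ> b \<in> P"
  shows "\<exists>f. linear_map dual_scale UNIV scU UNIV f \<and> (\<forall>x. f (evaluation P x) = b x)"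
proof -
  interpret U: vector_space scU by fact
  interpret D: vector_space "dual_scale :: 'k \<Rightarrow> (('x \<Rightarrow> 'k) \<Rightarrow> 'k) \<Rightarrow> _"
    by (rule vector_space_fun_scale) (rule vector_space_over_itself.vector_space_axioms)
  interpret UK: vector_space_pair scU "(*) :: 'k \<Rightarrow> 'k \<Rightarrow> 'k" ..
  interpret DU: vector_space_pair "dual_scale :: 'k \<Rightarrow> (('x \<Rightarrow> 'k) \<Rightarrow> 'k) \<Rightarrow> _" scU ..
  have sep: "u = 0" if "\<And>\<phi>. linear_map scU UNIV (*) UNIV \<phi> \<Longrightarrow> \<phi> u = 0" for u
  proof (rule ccontr)
    assume "u \<noteq> 0"
    then have "U.independent {u}" by simp
    from UK.linear_independent_extend[OF this, of "\<lambda>_. 1"]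
    obtain \<phi> where \<phi>: "Vector_Spaces.linear scU (*) \<phi>" "\<phi> u = 1" by auto
    interpret \<phi>: Vector_Spaces.linear scU "(*)" \<phi> by fact
    have "linear_map scU UNIV (*) UNIV \<phi>"
      by (auto simp: linear_map_def \<phi>.add \<phi>.scale)
    with that \<phi>(2) show False by force
  qed
  let ?R = "range (evaluation P)"
  obtain B where B: "B \<subseteq> ?R" "D.independent B" "?R \<subseteq> D.span B"
    using D.maximal_independent_subset[of ?R] by metis
  define g where "g T = b (SOME x. evaluation P x = T)" for T
  obtain f where f: "Vector_Spaces.linear dual_scale scU f" "\<And>T. T \<in> B \<Longrightarrow> f T = g T"
    using DU.linear_independent_extend[OF B(2), of g] by auto
  interpret f: Vector_Spaces.linear dual_scale scU f by fact
  have ev: "\<phi> (f T) = T (\<phi> \<circ> b)"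
    if \<phi>: "linear_map scU UNIV (*) UNIV \<phi>" and T: "T \<in> D.span B" for \<phi> T
    using T
  proof (induction rule: D.span_induct_alt)
    case base
    have "\<phi> 0 = 0" using \<phi> unfolding linear_map_def by (metis UNIV_I add_cancel_right_right)
    then show ?case using f.zero by (simp add: zero_fun_def)
  next
    case (step c T T')
    from step(1) B obtain y where "evaluation P y = T" by auto
    then have "evaluation P (SOME x. evaluation P x = T) = T" by (rule someI)
    moreover have "evaluation P x (\<phi> \<circ> b) = \<phi> (b x)" for x
      using P[OF \<phi>] by (simp add: evaluation_def)
    ultimately have "T (\<phi> \<circ> b) = \<phi> (g T)"
      unfolding g_def by metis
    moreover have "\<phi> (f (dual_scale c T + T')) = c * \<phi> (f T) + \<phi> (f T')"
      using \<phi> by (simp only: f.add f.scale linear_map_def UNIV_I ball_UNIV)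
    moreover have "(dual_scale c T + T') (\<phi> \<circ> b) = c * T (\<phi> \<circ> b) + T' (\<phi> \<circ> b)"
      by (simp add: fun_scale_def)
    moreover have "f T = g T" "\<phi> (f T') = T' (\<phi> \<circ> b)"
      using step f(2) by blast+
    ultimately show ?case by metis
  qed
  have "f (evaluation P x) = b x" for x
  proof -
    have "f (evaluation P x) - b x = 0"
    proof (rule sep)
      fix \<phi> assume \<phi>: "linear_map scU UNIV (*) UNIV \<phi>"
      have "\<phi> (f (evaluation P x)) = \<phi> (b x)"
        using ev[OF \<phi>, of "evaluation P x"] B P[OF \<phi>] by (auto simp: evaluation_def)
      moreover have "\<phi> (f (evaluation P x)) = \<phi> (f (evaluation P x) - b x) + \<phi> (b x)"
        using \<phi> unfolding linear_map_def by (metis UNIV_I diff_add_cancel)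
      ultimately show "\<phi> (f (evaluation P x) - b x) = 0" by simp
    qed
    then show ?thesis by simp
  qed
  then show ?thesis
    by (intro exI[of _ f]) (auto simp: linear_map_def f.add f.scale)
qed

lemma linear_map_unique_on_span:
  assumes "vector_space sc" "vector_space scU"
    and "linear_map sc (module.span sc S) scU U f" "linear_map sc (module.span sc S) scU U g"
    and "\<And>x. x \<in> S \<Longrightarrow> f x = g x" and "x \<in> module.span sc S"
  shows "f x = g x"
proof -
  interpret vector_space sc by fact
  interpret U: vector_space scU by fact
  have z: "h 0 = 0" if "linear_map sc (span S) scU U h" for h
    using that span_zero[of S] unfolding linear_map_def by (metis U.scale_zero_left scale_zero_left)
  have "x \<in> span S \<and> f x = g x"
    using assms(6)
  proof (induction rule: span_induct_alt)
    case base
    show ?case using z[OF assms(3)] z[OF assms(4)] span_zero by simp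
  next
    case (step c x y)
    then show ?case
      using assms(3,4,5) span_base[of x S] span_scale[of x S c] span_add[of "sc c x" S y]
      by (auto simp: linear_map_def)
  qed
  then show ?thesis by simp
qed

definition bilinear_forms :: "('k::field \<Rightarrow> 'v::ab_group_add \<Rightarrow> 'v) \<Rightarrow> 'v set \<Rightarrow>
    ('k \<Rightarrow> 'w::ab_group_add \<Rightarrow> 'w) \<Rightarrow> 'w set \<Rightarrow> ('v \<times> 'w \<Rightarrow> 'k) set" where
  "bilinear_forms scV V scW W = {\<beta>. bilinear_map scV V scW W (*) UNIV (\<lambda>v w. \<beta> (v, w))}"

definition pure_tensor where
  "pure_tensor scV V scW W v w = evaluation (bilinear_forms scV V scW W) (v, w)"

definition tensor_product :: "('k::field \<Rightarrow> 'v::ab_group_add \<Rightarrow> 'v) \<Rightarrow> 'v set \<Rightarrow>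
    ('k \<Rightarrow> 'w::ab_group_add \<Rightarrow> 'w) \<Rightarrow> 'w set \<Rightarrow> (('v \<times> 'w \<Rightarrow> 'k) \<Rightarrow> 'k) set" where
  "tensor_product scV V scW W =
     module.span dual_scale {pure_tensor scV V scW W v w | v w. v \<in> V \<and> w \<in> W}"

text \<open>For operators \<open>f\<close> on \<open>V\<close> and \<open>g\<close> on \<open>W\<close>, the operator \<open>f \<otimes> 1 + 1 \<otimes> g\<close>.\<close>

definition tensor_action where
  "tensor_action scV V scW W f g =
     dual_action (bilinear_forms scV V scW W) (\<lambda>\<beta> (v, w). \<beta> (f v, w) + \<beta> (v, g w))"

lemma tensor_product_universal:
  assumes "vector_space scU" and "bilinear_map scV V scW W scU UNIV b"
  shows "\<exists>f. linear_map dual_scale UNIV scU UNIV f \<and>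
             (\<forall>v w. f (pure_tensor scV V scW W v w) = b v w)"
proof -
  have "\<phi> \<circ> (\<lambda>(v, w). b v w) \<in> bilinear_forms scV V scW W"
    if "linear_map scU UNIV (*) UNIV \<phi>" for \<phi>
    using that assms(2) by (auto simp: bilinear_forms_def bilinear_map_def linear_map_def)
  from evaluation_universal[OF assms(1) this] show ?thesis
    by (auto simp: pure_tensor_def)
qed

lemma linear_map_comp:
  assumes "linear_map sc X sc X h" "linear_map sc X (*) UNIV \<gamma>"
  shows "linear_map sc X (*) UNIV (\<lambda>x. \<gamma> (h x))"
  using assms by (simp add: linear_map_def)

lemma linear_map_add:
  assumes "linear_map sc X (*) UNIV \<gamma>" "linear_map sc X (*) UNIV \<delta>"
  shows "linear_map sc X (*) UNIV (\<lambda>x. \<gamma> x + \<delta> x)"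
  using assms by (simp add: linear_map_def distrib_left)

lemma tensor_action_pure:
  assumes f: "linear_map scV V scV V f" and g: "linear_map scW W scW W g"
    and v: "v \<in> V" and w: "w \<in> W"
  shows "tensor_action scV V scW W f g (pure_tensor scV V scW W v w) =
           pure_tensor scV V scW W (f v) w + pure_tensor scV V scW W v (g w)"
proof -
  have *: "(\<lambda>(v, w). \<beta> (f v, w) + \<beta> (v, g w)) \<in> bilinear_forms scV V scW W"
    if \<beta>: "\<beta> \<in> bilinear_forms scV V scW W" for \<beta>
  proof -
    have l: "linear_map scW W (*) UNIV (\<lambda>w. \<beta> (x, w))" if "x \<in> V" for x
      using \<beta> that by (simp add: bilinear_forms_def bilinear_map_def)
    have r: "linear_map scV V (*) UNIV (\<lambda>v. \<beta> (v, y))" if "y \<in> W" for y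
      using \<beta> that by (simp add: bilinear_forms_def bilinear_map_def)
    have "f x \<in> V" if "x \<in> V" for x using f that by (simp add: linear_map_def)
    moreover have "g y \<in> W" if "y \<in> W" for y using g that by (simp add: linear_map_def)
    ultimately show ?thesis
      unfolding bilinear_forms_def bilinear_map_def mem_Collect_eq prod.case
      using l r linear_map_add[OF l linear_map_comp[OF g l]]
        linear_map_add[OF linear_map_comp[OF f r] r]
      by blast
  qed
  show ?thesis
  proof (rule ext)
    fix \<beta>
    show "tensor_action scV V scW W f g (pure_tensor scV V scW W v w) \<beta> =
        (pure_tensor scV V scW W (f v) w + pure_tensor scV V scW W v (g w)) \<beta>"
      using *[of \<beta>]
      by (cases "\<beta> \<in> bilinear_forms scV V scW W")
        (simp_all add: tensor_action_def pure_tensor_def dual_action_def evaluation_def)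
  qed
qed

definition alternating_forms ::
    "('k::field \<Rightarrow> 'v::ab_group_add \<Rightarrow> 'v) \<Rightarrow> 'v set \<Rightarrow> nat \<Rightarrow> ('v list \<Rightarrow> 'k) set" where
  "alternating_forms sc V k = {\<beta>. \<forall>xs. set xs \<subseteq> V \<and> length xs = k \<longrightarrow>
     (\<forall>i<k. linear_map sc V (*) UNIV (\<lambda>v. \<beta> (xs[i := v]))) \<and>
     (\<forall>i<k. \<forall>j<k. i \<noteq> j \<and> xs ! i = xs ! j \<longrightarrow> \<beta> xs = 0)}"

definition wedge where
  "wedge sc V k xs = evaluation (alternating_forms sc V k) xs"

definition exterior_power ::
    "('k::field \<Rightarrow> 'v::ab_group_add \<Rightarrow> 'v) \<Rightarrow> 'v set \<Rightarrow> nat \<Rightarrow> (('v list \<Rightarrow> 'k) \<Rightarrow> 'k) set" where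
  "exterior_power sc V k =
     module.span dual_scale {wedge sc V k xs | xs. set xs \<subseteq> V \<and> length xs = k}"

text \<open>The derivation of the exterior power induced by an operator \<open>f\<close> on \<open>V\<close>.\<close>

definition exterior_action where
  "exterior_action sc V k f =
     dual_action (alternating_forms sc V k) (\<lambda>\<beta> xs. \<Sum>i<k. \<beta> (xs[i := f (xs ! i)]))"

lemma alternating_forms_skew:
  assumes \<beta>: "\<beta> \<in> alternating_forms sc V k" and V: "vspace sc V"
    and xs: "set xs \<subseteq> V" "length xs = k"
    and pq: "p < k" "q < k" "p \<noteq> q" and ab: "a \<in> V" "b \<in> V"
  shows "\<beta> (xs[p := a, q := b]) = - \<beta> (xs[p := b, q := a])"
proof -
  interpret vector_space sc using V by (simp add: vspace_def)
  have c: "a + b \<in> V" using V ab by (simp add: vspace_def subspace_add)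
  have set: "set (xs[p := x, q := y]) \<subseteq> V" if "x \<in> V" "y \<in> V" for x y
    using xs(1) that set_update_subset_insert[of "xs[p := x]" q y]
      set_update_subset_insert[of xs p x] by auto
  have addq: "\<beta> (xs[p := z, q := x + y]) = \<beta> (xs[p := z, q := x]) + \<beta> (xs[p := z, q := y])"
    if "x \<in> V" "y \<in> V" "z \<in> V" for x y z
  proof -
    have "set (xs[p := z]) \<subseteq> V" "length (xs[p := z]) = k"
      using xs that set_update_subset_insert[of xs p z] by auto
    with \<beta> pq that show ?thesis
      unfolding alternating_forms_def linear_map_def by blast
  qed
  have addp: "\<beta> (xs[p := x + y, q := z]) = \<beta> (xs[p := x, q := z]) + \<beta> (xs[p := y, q := z])"
    if "x \<in> V" "y \<in> V" "z \<in> V" for x y z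
  proof -
    have "set (xs[q := z]) \<subseteq> V" "length (xs[q := z]) = k"
      using xs that set_update_subset_insert[of xs q z] by auto
    with \<beta> pq that
    have "\<beta> (xs[q := z, p := x + y]) = \<beta> (xs[q := z, p := x]) + \<beta> (xs[q := z, p := y])"
      unfolding alternating_forms_def linear_map_def by blast
    then show ?thesis using pq by (simp add: list_update_swap)
  qed
  have diag: "\<beta> (xs[p := x, q := x]) = 0" if "x \<in> V" for x
  proof -
    have "length (xs[p := x, q := x]) = k" "xs[p := x, q := x] ! p = xs[p := x, q := x] ! q"
      using xs pq by auto
    with \<beta> set[OF that that] pq show ?thesis
      unfolding alternating_forms_def by blast
  qed
  have "\<beta> (xs[p := a, q := b]) + \<beta> (xs[p := b, q := a]) = 0"
    using diag[OF c] diag[OF ab(1)] diag[OF ab(2)] ab c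
    by (simp add: addq addp add.commute)
  then show ?thesis by (simp add: eq_neg_iff_add_eq_0)
qed

lemma alternating_forms_derivation:
  assumes V: "vspace sc V" and f: "linear_map sc V sc V f"
    and \<beta>: "\<beta> \<in> alternating_forms sc V k"
  shows "(\<lambda>xs. \<Sum>i<k. \<beta> (xs[i := f (xs ! i)])) \<in> alternating_forms sc V k"
proof -
  interpret vector_space sc using V by (simp add: vspace_def)
  have fV: "f x \<in> V" if "x \<in> V" for x using f that by (simp add: linear_map_def)
  have lin: "linear_map sc V (*) UNIV (\<lambda>v. \<beta> (xs[i := v]))"
    if "set xs \<subseteq> V" "length xs = k" "i < k" for xs i
    using \<beta> that unfolding alternating_forms_def by blast
  have multi: "linear_map sc V (*) UNIV (\<lambda>v. \<Sum>i<k. \<beta> (xs[j := v, i := f (xs[j := v] ! i)]))"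
    if xs: "set xs \<subseteq> V" "length xs = k" and j: "j < k" for xs j
  proof -
    have "linear_map sc V (*) UNIV (\<lambda>v. \<beta> (xs[j := v, i := f (xs[j := v] ! i)]))"
      if i: "i < k" for i
    proof (cases "i = j")
      case True
      then have "(\<lambda>v. \<beta> (xs[j := v, i := f (xs[j := v] ! i)])) = (\<lambda>v. \<beta> (xs[j := f v]))"
        using xs j by simp
      with lin[OF xs j] f show ?thesis
        by (simp add: linear_map_def)
    next
      case False
      have xi: "xs ! i \<in> V" using xs i nth_mem by blast
      have "set (xs[i := f (xs ! i)]) \<subseteq> V"
        using xs fV[OF xi] set_update_subset_insert[of xs i "f (xs ! i)"] by auto
      from lin[OF this _ j] xs False show ?thesis
        by (simp add: list_update_swap)
    qed
    then show ?thesis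
      by (auto simp: linear_map_def sum.distrib sum_distrib_left)
  qed
  have alt: "(\<Sum>i<k. \<beta> (xs[i := f (xs ! i)])) = 0"
    if xs: "set xs \<subseteq> V" "length xs = k" and pq: "p < k" "q < k" "p \<noteq> q" "xs ! p = xs ! q"
    for xs p q
  proof -
    have xV: "xs ! i \<in> V" if "i < k" for i using xs that nth_mem by blast
    have 0: "\<beta> (xs[i := f (xs ! i)]) = 0" if i: "i < k" "i \<noteq> p" "i \<noteq> q" for i
    proof -
      have "set (xs[i := f (xs ! i)]) \<subseteq> V"
        using xs fV[OF xV[OF i(1)]] set_update_subset_insert[of xs i "f (xs ! i)"] by auto
      moreover have "length (xs[i := f (xs ! i)]) = k"
        "xs[i := f (xs ! i)] ! p = xs[i := f (xs ! i)] ! q"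
        using xs pq i by auto
      ultimately show ?thesis
        using \<beta> pq unfolding alternating_forms_def by blast
    qed
    let ?x = "xs ! p"
    have "\<beta> (xs[p := f ?x]) = \<beta> (xs[p := f ?x, q := ?x])"
      using pq by (metis list_update_id list_update_swap)
    also have "\<dots> = - \<beta> (xs[p := ?x, q := f ?x])"
      by (rule alternating_forms_skew[OF \<beta> V xs pq(1-3)]) (use fV xV pq in auto)
    also have "xs[p := ?x, q := f ?x] = xs[q := f (xs ! q)]" by (simp only: list_update_id pq(4)[symmetric])
    finally have "\<beta> (xs[p := f ?x]) + \<beta> (xs[q := f (xs ! q)]) = 0" by simp
    moreover have "(\<Sum>i<k. \<beta> (xs[i := f (xs ! i)])) = (\<Sum>i\<in>{p, q}. \<beta> (xs[i := f (xs ! i)]))"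
      by (rule sum.mono_neutral_right) (use 0 pq in auto)
    ultimately show ?thesis using pq by simp
  qed
  show ?thesis
    using multi alt unfolding alternating_forms_def by blast
qed

lemma exterior_action_wedge:
  fixes sc :: "'a::field \<Rightarrow> 'b::ab_group_add \<Rightarrow> 'b"
  assumes "vspace sc V" "linear_map sc V sc V f" "set xs \<subseteq> V" "length xs = k"
  shows "exterior_action sc V k f (wedge sc V k xs) = (\<Sum>i<k. wedge sc V k (xs[i := f (xs ! i)]))"
proof (rule ext)
  fix \<beta> :: "'b list \<Rightarrow> 'a"
  have sum: "(\<Sum>i<n. g i) \<beta> = (\<Sum>i<n. g i \<beta>)" for g :: "nat \<Rightarrow> _ \<Rightarrow> 'a" and n
    by (induction n) auto
  show "exterior_action sc V k f (wedge sc V k xs) \<beta> =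
      (\<Sum>i<k. wedge sc V k (xs[i := f (xs ! i)])) \<beta>"
    using alternating_forms_derivation[OF assms(1,2), of \<beta> k]
    by (auto simp: sum exterior_action_def dual_action_def wedge_def evaluation_def)
qed

lemma exterior_power_universal:
  assumes "vector_space scU"
    and "\<And>xs i. set xs \<subseteq> V \<Longrightarrow> length xs = k \<Longrightarrow> i < k \<Longrightarrow>
           linear_map sc V scU UNIV (\<lambda>v. b (xs[i := v]))"
    and "\<And>xs i j. set xs \<subseteq> V \<Longrightarrow> length xs = k \<Longrightarrow> i < k \<Longrightarrow> j < k \<Longrightarrow> i \<noteq> j \<Longrightarrow>
           xs ! i = xs ! j \<Longrightarrow> b xs = 0"
  shows "\<exists>f. linear_map dual_scale UNIV scU UNIV f \<and> (\<forall>xs. f (wedge sc V k xs) = b xs)"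
proof -
  have "\<phi> \<circ> b \<in> alternating_forms sc V k" if \<phi>: "linear_map scU UNIV (*) UNIV \<phi>" for \<phi>
  proof -
    have "\<phi> 0 = 0" using \<phi> unfolding linear_map_def by (metis UNIV_I add_cancel_right_right)
    moreover have "linear_map sc V (*) UNIV (\<lambda>v. \<phi> (b (xs[i := v])))"
      if "set xs \<subseteq> V" "length xs = k" "i < k" for xs i
      using assms(2)[OF that] \<phi> by (simp add: linear_map_def)
    ultimately show ?thesis
      unfolding alternating_forms_def by (auto simp: assms(3))
  qed
  from evaluation_universal[OF assms(1) this] show ?thesis
    by (simp add: wedge_def)
qed


section \<open>Lie algebras and modules\<close>

definition lie_algebra ::
    "('k::field \<Rightarrow> 'v::ab_group_add \<Rightarrow> 'v) \<Rightarrow> 'v set \<Rightarrow> ('v \<Rightarrow> 'v \<Rightarrow> 'v) \<Rightarrow> bool" where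
  "lie_algebra sc L br \<longleftrightarrow>
     vspace sc L \<and> bilinear_map sc L sc L sc L br \<and>
     (\<forall>x\<in>L. br x x = 0) \<and>
     (\<forall>x\<in>L. \<forall>y\<in>L. \<forall>z\<in>L. br x (br y z) + br y (br z x) + br z (br x y) = 0)"

definition lie_subalgebra where
  "lie_subalgebra sc L br K \<longleftrightarrow>
     module.subspace sc K \<and> K \<subseteq> L \<and> (\<forall>x\<in>K. \<forall>y\<in>K. br x y \<in> K)"

definition lie_ideal where
  "lie_ideal sc L br I \<longleftrightarrow>
     module.subspace sc I \<and> I \<subseteq> L \<and> (\<forall>x\<in>L. \<forall>y\<in>I. br x y \<in> I)"

definition simple_lie_algebra where
  "simple_lie_algebra sc L br \<longleftrightarrow>
     lie_algebra sc L br \<and> (\<exists>x\<in>L. \<exists>y\<in>L. br x y \<noteq> 0) \<and>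
     (\<forall>I. lie_ideal sc L br I \<longrightarrow> I = {0} \<or> I = L)"

definition lie_isomorphism where
  "lie_isomorphism scL L brL scM M brM f \<longleftrightarrow>
     linear_map scL L scM M f \<and> bij_betw f L M \<and>
     (\<forall>x\<in>L. \<forall>y\<in>L. f (brL x y) = brM (f x) (f y))"

definition killing_form where
  "killing_form sc L br x y = endo_trace sc L (\<lambda>z. br x (br y z))"

definition lie_module ::
    "('k::field \<Rightarrow> 'v::ab_group_add \<Rightarrow> 'v) \<Rightarrow> 'v set \<Rightarrow> ('v \<Rightarrow> 'v \<Rightarrow> 'v) \<Rightarrow>
     ('k \<Rightarrow> 'w::ab_group_add \<Rightarrow> 'w) \<Rightarrow> 'w set \<Rightarrow> ('v \<Rightarrow> 'w \<Rightarrow> 'w) \<Rightarrow> bool" where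
  "lie_module sc L br scW W act \<longleftrightarrow>
     lie_algebra sc L br \<and> vspace scW W \<and> bilinear_map sc L scW W scW W act \<and>
     (\<forall>x\<in>L. \<forall>y\<in>L. \<forall>w\<in>W. act (br x y) w = act x (act y w) - act y (act x w))"

definition irreducible_module where
  "irreducible_module sc L br scW W act \<longleftrightarrow>
     lie_module sc L br scW W act \<and> W \<noteq> {0} \<and>
     (\<forall>U. module.subspace scW U \<and> U \<subseteq> W \<and> (\<forall>x\<in>L. \<forall>u\<in>U. act x u \<in> U) \<longrightarrow> U = {0} \<or> U = W)"

text \<open>
  The space of \<open>L\<close>-module homomorphisms from \<open>U\<close> to \<open>V\<close>.  Requiring value \<open>0\<close> outside the carrier
  \<open>U\<close> makes a homomorphism determined by its restriction to \<open>U\<close>.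
\<close>

definition hom_space where
  "hom_space L scU U actU scV V actV =
     {f. linear_map scU U scV V f \<and> (\<forall>u. u \<notin> U \<longrightarrow> f u = 0) \<and>
         (\<forall>x\<in>L. \<forall>u\<in>U. f (actU x u) = actV x (f u))}"

definition hom_dim where
  "hom_dim L scU U actU scV V actV =
     vector_space.dim (fun_scale scV) (hom_space L scU U actU scV V actV)"


section \<open>Complexification\<close>

text \<open>The pair \<open>(x, y)\<close> stands for \<open>x + i y\<close>; the complexification of \<open>V\<close> has carrier \<open>V \<times> V\<close>.\<close>

definition cscale :: "complex \<Rightarrow> 'g::real_vector \<times> 'g \<Rightarrow> 'g \<times> 'g" where
  "cscale c = (\<lambda>(x, y). (Re c *\<^sub>R x - Im c *\<^sub>R y, Re c *\<^sub>R y + Im c *\<^sub>R x))"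

definition cbracket :: "('g::real_vector \<Rightarrow> 'g \<Rightarrow> 'g) \<Rightarrow> 'g \<times> 'g \<Rightarrow> 'g \<times> 'g \<Rightarrow> 'g \<times> 'g" where
  "cbracket br = (\<lambda>(x, y) (x', y'). (br x x' - br y y', br x y' + br y x'))"

abbreviation complexification :: "'g set \<Rightarrow> ('g \<times> 'g) set" where
  "complexification V \<equiv> V \<times> V"


section \<open>Root systems and highest weight modules\<close>

datatype dynkin = Dynkin_A nat | Dynkin_C nat | Dynkin_D nat | Dynkin_E nat | Dynkin_F4 | Dynkin_G2

fun dynkin_rank :: "dynkin \<Rightarrow> nat" where
  "dynkin_rank (Dynkin_A n) = n"
| "dynkin_rank (Dynkin_C n) = n"
| "dynkin_rank (Dynkin_D n) = n"
| "dynkin_rank (Dynkin_E n) = n"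
| "dynkin_rank Dynkin_F4 = 4"
| "dynkin_rank Dynkin_G2 = 2"

text \<open>
  The integers \<open>\<langle>\<alpha>\<^sub>i, \<alpha>\<^sub>j\<^sup>\<or>\<rangle>\<close> for \<open>i, j \<in> {1..rank}\<close> in Bourbaki's (equivalently Humphreys')
  numbering and convention.  So \<open>\<alpha>\<^sub>n\<close> is the long simple root of \<open>C\<^sub>n\<close>; in \<open>D\<^sub>n\<close> the node
  \<open>n - 2\<close> is joined to both \<open>n - 1\<close> and \<open>n\<close>; in \<open>E\<^sub>n\<close> the node \<open>2\<close> is joined to the node \<open>4\<close> of the
  chain \<open>1, 3, 4, ..., n\<close>; \<open>\<alpha>\<^sub>3, \<alpha>\<^sub>4\<close> are short in \<open>F\<^sub>4\<close> and \<open>\<alpha>\<^sub>1\<close> is short in \<open>G\<^sub>2\<close>.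
\<close>

fun cartan_matrix :: "dynkin \<Rightarrow> nat \<Rightarrow> nat \<Rightarrow> int" where
  "cartan_matrix (Dynkin_A n) i j =
     (if i = j then 2 else if j = i + 1 \<or> i = j + 1 then - 1 else 0)"
| "cartan_matrix (Dynkin_C n) i j =
     (if i = j then 2 else if i = n \<and> i = j + 1 then - 2
      else if j = i + 1 \<or> i = j + 1 then - 1 else 0)"
| "cartan_matrix (Dynkin_D n) i j =
     (if i = j then 2
      else if {i, j} = {n - 2, n} \<or> (j = i + 1 \<and> j < n) \<or> (i = j + 1 \<and> i < n) then - 1 else 0)"
| "cartan_matrix (Dynkin_E n) i j =
     (if i = j then 2
      else if {i, j} = {1, 3} \<or> {i, j} = {2, 4} \<or> (j = i + 1 \<and> 3 \<le> i) \<or> (i = j + 1 \<and> 3 \<le> j)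
      then - 1 else 0)"
| "cartan_matrix Dynkin_F4 i j =
     (if i = j then 2 else if i = 2 \<and> j = 3 then - 2
      else if j = i + 1 \<or> i = j + 1 then - 1 else 0)"
| "cartan_matrix Dynkin_G2 i j = (if i = j then 2 else if i = 2 \<and> j = 1 then - 3 else - 1)"

definition root_space where
  "root_space sc L br H \<alpha> = {x \<in> L. \<forall>h\<in>H. br h x = sc (\<alpha> h) x}"

text \<open>
  Cartan subalgebras of semisimple Lie algebras: abelian subalgebras acting diagonally on \<open>L\<close> that
  are equal to their own centralizers.  (A function \<open>\<alpha>\<close> that is not linear on \<open>H\<close> has zero root
  space, so it is harmless to let \<open>\<alpha>\<close> range over all functions.)
\<close>

definition cartan_subalgebra where
  "cartan_subalgebra sc L br H \<longleftrightarrow>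
     lie_subalgebra sc L br H \<and> (\<forall>x\<in>H. \<forall>y\<in>H. br x y = 0) \<and>
     module.span sc (\<Union>\<alpha>. root_space sc L br H \<alpha>) = L \<and>
     {x \<in> L. \<forall>h\<in>H. br h x = 0} = H"

text \<open>Roots are linear functionals on \<open>H\<close>, extended by \<open>0\<close> outside \<open>H\<close>.\<close>

definition roots where
  "roots sc L br H =
     {\<alpha>. linear_map sc H (*) UNIV \<alpha> \<and> (\<forall>x. x \<notin> H \<longrightarrow> \<alpha> x = 0) \<and> (\<exists>h\<in>H. \<alpha> h \<noteq> 0) \<and>
         root_space sc L br H \<alpha> \<noteq> {0}}"

definition positive_roots where
  "positive_roots sc L br H n \<alpha> =
     {\<beta> \<in> roots sc L br H. \<exists>c::nat \<Rightarrow> nat. \<forall>h\<in>H. \<beta> h = (\<Sum>i=1..n. of_nat (c i) * \<alpha> i h)}"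

definition root_base where
  "root_base sc L br H n \<alpha> \<longleftrightarrow>
     (\<forall>i\<in>{1..n}. \<alpha> i \<in> roots sc L br H) \<and>
     (\<forall>c. (\<forall>h\<in>H. (\<Sum>i=1..n. c i * \<alpha> i h) = 0) \<longrightarrow> (\<forall>i\<in>{1..n}. c i = 0)) \<and>
     (\<forall>\<beta>\<in>roots sc L br H.
        \<beta> \<in> positive_roots sc L br H n \<alpha> \<or> (\<lambda>h. - \<beta> h) \<in> positive_roots sc L br H n \<alpha>)"

definition is_coroot where
  "is_coroot sc L br H \<alpha> t \<longleftrightarrow>
     t \<in> module.span sc {br x y | x y. x \<in> root_space sc L br H \<alpha> \<and>
                                     y \<in> root_space sc L br H (\<lambda>h. - \<alpha> h)} \<and>
     \<alpha> t = 2"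

definition simple_root_data where
  "simple_root_data X sc L br H \<alpha> t \<longleftrightarrow>
     cartan_subalgebra sc L br H \<and>
     root_base sc L br H (dynkin_rank X) \<alpha> \<and>
     (\<forall>i\<in>{1..dynkin_rank X}. is_coroot sc L br H (\<alpha> i) (t i)) \<and>
     (\<forall>i\<in>{1..dynkin_rank X}. \<forall>j\<in>{1..dynkin_rank X}.
        \<alpha> i (t j) = of_int (cartan_matrix X i j))"

definition has_type where
  "has_type X sc L br \<longleftrightarrow> (\<exists>H \<alpha> t. simple_root_data X sc L br H \<alpha> t)"

text \<open>
  \<open>W\<close> is the irreducible module \<open>V(\<Sum>i. m i \<lambda>\<^sub>i)\<close> of the Lie algebra \<open>L\<close> of type \<open>X\<close>, where
  \<open>\<lambda>\<^sub>1, \<lambda>\<^sub>2, ...\<close> are the fundamental weights; \<open>\<mu>\<close> is the highest weight and \<open>v\<close> a highest weight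
  vector.
\<close>

definition highest_weight_module where
  "highest_weight_module X m sc L br scW W act \<longleftrightarrow>
     irreducible_module sc L br scW W act \<and>
     (\<exists>H \<alpha> t \<mu> v. simple_root_data X sc L br H \<alpha> t \<and>
        linear_map sc H (*) UNIV \<mu> \<and>
        (\<forall>i\<in>{1..dynkin_rank X}. \<mu> (t i) = of_nat (m i)) \<and>
        v \<in> W \<and> v \<noteq> 0 \<and>
        (\<forall>h\<in>H. act h v = scW (\<mu> h) v) \<and>
        (\<forall>\<beta>\<in>positive_roots sc L br H (dynkin_rank X) \<alpha>.
           \<forall>x\<in>root_space sc L br H \<beta>. act x v = 0))"

text \<open>Compact real simple Lie algebras whose complexification has type \<open>X\<close>.\<close>

definition compact_simple :: "dynkin \<Rightarrow> 'g::real_vector set \<Rightarrow> ('g \<Rightarrow> 'g \<Rightarrow> 'g) \<Rightarrow> bool" where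
  "compact_simple X L br \<longleftrightarrow>
     simple_lie_algebra scaleR L br \<and> findim scaleR L \<and>
     (\<forall>x\<in>L. x \<noteq> 0 \<longrightarrow> killing_form scaleR L br x x < 0) \<and>
     has_type X cscale (complexification L) (cbracket br)"


section \<open>Classical matrix Lie algebras\<close>

definition commutator :: "'a::ring_1^'n^'n \<Rightarrow> 'a^'n^'n \<Rightarrow> 'a^'n^'n" where
  "commutator A B = A ** B - B ** A"

definition adjoint_matrix :: "complex^'n^'n \<Rightarrow> complex^'n^'n" where
  "adjoint_matrix A = (\<chi> i j. cnj (A $ j $ i))"

definition so_algebra :: "(real^'n^'n) set" where
  "so_algebra = {A. transpose A = - A}"

definition su_algebra :: "(complex^'n^'n) set" where
  "su_algebra = {A. adjoint_matrix A = - A \<and> trace A = 0}"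

definition symplectic_J :: "complex^('n::finite + 'n)^('n + 'n)" where
  "symplectic_J = (\<chi> i j. case (i, j) of
     (Inl a, Inr b) \<Rightarrow> if a = b then 1 else 0
   | (Inr a, Inl b) \<Rightarrow> if a = b then - 1 else 0
   | _ \<Rightarrow> 0)"

text \<open>The compact algebra \<open>\<ss>\<pp>(n) = \<uu>(2n) \<inter> \<ss>\<pp>(2n, \<complex>)\<close>, where \<open>n\<close> is the cardinality of \<open>'n\<close>.\<close>

definition sp_algebra :: "(complex^('n::finite + 'n)^('n + 'n)) set" where
  "sp_algebra = {A. adjoint_matrix A = - A \<and>
     transpose A ** symplectic_J + symplectic_J ** A = 0}"

definition sl_algebra :: "('a::field^'n^'n) set" where
  "sl_algebra = {A. trace A = 0}"

definition matrix_scale :: "'a::field \<Rightarrow> 'a^'n^'m \<Rightarrow> 'a^'n^'m" where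
  "matrix_scale c A = (\<chi> i j. c * A $ i $ j)"

definition isomorphic_to_matrices ::
    "'g::real_vector set \<Rightarrow> ('g \<Rightarrow> 'g \<Rightarrow> 'g) \<Rightarrow> ('a::{real_algebra_1,real_vector}^'n^'n) set \<Rightarrow> bool" where
  "isomorphic_to_matrices L br M \<longleftrightarrow> (\<exists>f. lie_isomorphism scaleR L br scaleR M commutator f)"


section \<open>The five decompositions\<close>

text \<open>
  The index \<open>s \<in> {1..5}\<close> stands for \<open>G\<^sub>2/Sp(1)\<close>, \<open>F\<^sub>4/Sp(3)\<close>, \<open>E\<^sub>6/SU(6)\<close>, \<open>E\<^sub>7/Spin(12)\<close>,
  \<open>E\<^sub>8/E\<^sub>7\<close>.
\<close>

definition g_type :: "nat \<Rightarrow> dynkin" where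
  "g_type s = [Dynkin_G2, Dynkin_F4, Dynkin_E 6, Dynkin_E 7, Dynkin_E 8] ! (s - 1)"

definition h_type :: "nat \<Rightarrow> dynkin" where
  "h_type s = [Dynkin_A 1, Dynkin_C 3, Dynkin_A 5, Dynkin_D 6, Dynkin_E 7] ! (s - 1)"

definition is_isotropy_algebra :: "nat \<Rightarrow> 'g::real_vector set \<Rightarrow> ('g \<Rightarrow> 'g \<Rightarrow> 'g) \<Rightarrow> bool" where
  "is_isotropy_algebra s h br \<longleftrightarrow>
     (s = 1 \<and> isomorphic_to_matrices h br (sp_algebra :: (complex^(1 + 1)^(1 + 1)) set)) \<or>
     (s = 2 \<and> isomorphic_to_matrices h br (sp_algebra :: (complex^(3 + 3)^(3 + 3)) set)) \<or>
     (s = 3 \<and> isomorphic_to_matrices h br (su_algebra :: (complex^6^6) set)) \<or>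
     (s = 4 \<and> isomorphic_to_matrices h br (so_algebra :: (real^12^12) set)) \<or>
     (s = 5 \<and> compact_simple (Dynkin_E 7) h br)"

text \<open>
  Coefficients of the highest weight of \<open>W\<^sub>s\<close> in the fundamental weights of \<open>h_type s\<close>:
  \<open>3 \<lambda>\<^sub>1, \<lambda>\<^sub>3, \<lambda>\<^sub>3, \<lambda>\<^sub>5, \<lambda>\<^sub>7\<close>.
\<close>

definition W_weight :: "nat \<Rightarrow> nat \<Rightarrow> nat" where
  "W_weight s = [(\<lambda>i. if i = 1 then 3 else 0),
                 (\<lambda>i. if i = 3 then 1 else 0),
                 (\<lambda>i. if i = 3 then 1 else 0),
                 (\<lambda>i. if i = 5 then 1 else 0),
                 (\<lambda>i. if i = 7 then 1 else 0)] ! (s - 1)"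

definition Z2_graded :: "'g::real_vector set \<Rightarrow> ('g \<Rightarrow> 'g \<Rightarrow> 'g) \<Rightarrow> 'g set \<Rightarrow> 'g set \<Rightarrow> bool" where
  "Z2_graded g br g\<^sub>0 g\<^sub>1 \<longleftrightarrow>
     subspace g\<^sub>0 \<and> subspace g\<^sub>1 \<and> direct_sum g g\<^sub>0 g\<^sub>1 \<and>
     (\<forall>x\<in>g\<^sub>0. \<forall>y\<in>g\<^sub>0. br x y \<in> g\<^sub>0) \<and>
     (\<forall>x\<in>g\<^sub>0. \<forall>y\<in>g\<^sub>1. br x y \<in> g\<^sub>1) \<and>
     (\<forall>x\<in>g\<^sub>1. \<forall>y\<in>g\<^sub>1. br x y \<in> g\<^sub>0)"

definition sum_of_ideals :: "'g::real_vector set \<Rightarrow> ('g \<Rightarrow> 'g \<Rightarrow> 'g) \<Rightarrow> 'g set \<Rightarrow> 'g set \<Rightarrow> bool" where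
  "sum_of_ideals g\<^sub>0 br q h \<longleftrightarrow>
     lie_ideal scaleR g\<^sub>0 br q \<and> lie_ideal scaleR g\<^sub>0 br h \<and> direct_sum g\<^sub>0 q h"

text \<open>
  The complexification of \<open>g\<^sub>1\<close> is isomorphic to \<open>\<complex>\<^sup>2 \<otimes> W\<close> over that of \<open>q \<oplus> h\<close>, where \<open>\<complex>\<^sup>2\<close> is the
  natural module under an isomorphism \<open>\<phi>\<close> from the complexification of \<open>q\<close> to \<open>\<ss>\<ll>(2, \<complex>)\<close>.
\<close>

definition odd_part_iso ::
    "('g::real_vector \<Rightarrow> 'g \<Rightarrow> 'g) \<Rightarrow> 'g set \<Rightarrow> 'g set \<Rightarrow> 'g set \<Rightarrow>
     (complex \<Rightarrow> 'w::ab_group_add \<Rightarrow> 'w) \<Rightarrow> 'w set \<Rightarrow> ('g \<times> 'g \<Rightarrow> 'w \<Rightarrow> 'w) \<Rightarrow> bool" where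
  "odd_part_iso br q h g\<^sub>1 scW W act \<longleftrightarrow>
     (\<exists>(\<phi> :: 'g \<times> 'g \<Rightarrow> complex^2^2) \<Psi>.
        lie_isomorphism cscale (complexification q) (cbracket br)
          matrix_scale sl_algebra commutator \<phi> \<and>
        linear_map cscale (complexification g\<^sub>1)
          dual_scale (tensor_product (*s) (UNIV :: (complex^2) set) scW W) \<Psi> \<and>
        bij_betw \<Psi> (complexification g\<^sub>1) (tensor_product (*s) UNIV scW W) \<and>
        (\<forall>x\<in>complexification q. \<forall>y\<in>complexification h. \<forall>z\<in>complexification g\<^sub>1.
           \<Psi> (cbracket br (x + y) z) =
             tensor_action (*s) UNIV scW W (\<lambda>u. \<phi> x *v u) (act y) (\<Psi> z)))"

end

theory Submission
  imports Defs "HOL-Computational_Algebra.Fundamental_Theorem_Algebra"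
begin

text \<open>
  The module \<open>m\<close> is \<open>q \<oplus> g\<^sub>1\<close>, where \<open>h\<close> acts trivially on the three-dimensional \<open>q\<close>, because \<open>q\<close> and
  \<open>h\<close> are ideals with zero intersection, and where \<open>g\<^sub>1\<close> is a real form of \<open>\<complex>\<^sup>2 \<otimes> W = W \<oplus> W\<close>.  All three
  spaces of homomorphisms are spaces of \<open>h\<close>-invariant trilinear forms on \<open>m\<close>: an invariant inner
  product on \<open>m\<close> identifies \<open>Hom(m \<otimes> m, m)\<close> with all of them, \<open>Hom(m, \<Lambda>\<^sup>2 m)\<close> with those that alternate
  in the last two arguments, and \<open>Hom(\<Lambda>\<^sup>3 m, \<real>)\<close> with the alternating ones (\<open>dim_Hom_TP\<close>,
  \<open>dim_Hom_Ext2\<close>, \<open>dim_Hom_Ext3\<close>).  These forms are determined by their restrictions to \<open>q\<close> and \<open>g\<^sub>1\<close>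
  in each argument, so the invariant linear, bilinear and trilinear forms on \<open>g\<^sub>1\<close> are needed.

  There are no nonzero invariant linear or trilinear forms on \<open>g\<^sub>1\<close>.  In each of the five cases some
  sum \<open>c\<close> of simple coroots of the complexified \<open>h\<close> takes even values on all roots and an odd value on the
  highest weight (\<open>W_weight_parity\<close>), so \<open>W\<close> is spanned by eigenvectors of \<open>c\<close> with odd eigenvalues
  (\<open>odd_coweight_exists\<close>).  An invariant form pairs eigenvectors nontrivially only if their eigenvalues
  add up to \<open>0\<close>, which is impossible for one or three odd numbers.

  The invariant bilinear forms on \<open>g\<^sub>1\<close> form a space of dimension 4: one inner product and three
  alternating forms.  By Schur's lemma an endomorphism of \<open>g\<^sub>1\<close> that commutes with \<open>h\<close> complexifies to
  \<open>A \<otimes> 1\<close> with a \<open>2 \<times> 2\<close> matrix \<open>A\<close>, and such a matrix is a scalar plus an element of \<open>\<ss>\<ll>\<^sub>2\<close>, that is, of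
  the complexified \<open>q\<close>.  So the commutant of \<open>h\<close> on \<open>g\<^sub>1\<close> is spanned by the identity and \<open>ad q\<close>
  (\<open>odd_part_endomorphisms\<close>).  The Killing form, which is definite and for which \<open>ad q\<close> is skew, turns
  the identity into an inner product and \<open>ad q\<close> into alternating forms (locale \<open>killing_pairing\<close>).

  Counting the forms by how many arguments lie in \<open>q\<close> gives \<open>27 + 3 \<cdot> (3 \<cdot> 4) = 63\<close> forms in total.
  With alternation in the last two arguments there are \<open>3 \<cdot> 3\<close> forms on \<open>q\<close>, \<open>3 \<cdot> 3\<close> with the first
  argument in \<open>q\<close> and an alternating form on \<open>g\<^sub>1\<close>, and \<open>3 \<cdot> 4\<close> with one of the last two arguments in \<open>q\<close>;
  this gives 30.  The alternating forms are the volume form on \<open>q\<close> and, for each basis vector of \<open>q\<close> and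
  each of the three alternating forms on \<open>g\<^sub>1\<close>, one more; this gives 10.
\<close>

section \<open>Linear algebra on carriers\<close>

text \<open>
  The dimension of a space is read off from a separating family of functionals: if their values on the
  space are exactly the combinations of finitely many independent value tables \<open>T i\<close>, preimages
  of the tables form a basis.  The tables will be trilinear forms.
\<close>

lemma dim_eq_card_by_evaluation:
  fixes sc :: "real \<Rightarrow> 'v::ab_group_add \<Rightarrow> 'v"
  assumes vs: "vector_space sc" and S: "module.subspace sc S" and I: "finite I"
    and lin: "\<And>p. p \<in> P \<Longrightarrow> linear_map sc S (*) UNIV (ev p)"
    and sep: "\<And>F. F \<in> S \<Longrightarrow> (\<And>p. p \<in> P \<Longrightarrow> ev p F = 0) \<Longrightarrow> F = 0"
    and ex: "\<And>i. i \<in> I \<Longrightarrow> \<exists>F\<in>S. \<forall>p\<in>P. ev p F = T i p"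
    and sp: "\<And>F. F \<in> S \<Longrightarrow> \<exists>c. \<forall>p\<in>P. ev p F = (\<Sum>i\<in>I. c i * T i p)"
    and ind: "\<And>c i. (\<And>p. p \<in> P \<Longrightarrow> (\<Sum>i\<in>I. c i * T i p) = 0) \<Longrightarrow> i \<in> I \<Longrightarrow> c i = 0"
  shows "vector_space.dim sc S = card I"
proof -
  interpret vector_space sc by fact
  obtain F where F: "\<And>i. i \<in> I \<Longrightarrow> F i \<in> S" "\<And>i p. i \<in> I \<Longrightarrow> p \<in> P \<Longrightarrow> ev p (F i) = T i p"
    using ex by metis
  have z: "ev p 0 = 0" if "p \<in> P" for p
    using lin[OF that] subspace_0[OF S] unfolding linear_map_def
    by (metis mult_zero_left scale_zero_left)
  have ev: "ev p (\<Sum>i\<in>J. sc (c i) (F i)) = (\<Sum>i\<in>J. c i * T i p)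
            \<and> (\<Sum>i\<in>J. sc (c i) (F i)) \<in> S" if "p \<in> P" "J \<subseteq> I" for p c J
    using finite_subset[OF \<open>J \<subseteq> I\<close> I] that(2)
  proof (induction J rule: finite_induct)
    case empty
    then show ?case using z[OF that(1)] subspace_0[OF S] by simp
  next
    case (insert j J)
    then have "sc (c j) (F j) \<in> S" "(\<Sum>i\<in>J. sc (c i) (F i)) \<in> S" "F j \<in> S"
      using F subspace_scale[OF S] by auto
    then show ?case
      using insert lin[OF that(1)] F(2)[OF _ that(1)] subspace_add[OF S]
      by (auto simp: linear_map_def)
  qed
  have zero: "c i = 0" if "(\<Sum>i\<in>I. sc (c i) (F i)) = 0" "i \<in> I" for c i
    by (rule ind[OF _ that(2)]) (use ev[of _ I c] z that in auto)
  have inj: "inj_on F I"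
  proof (rule inj_onI, rule ccontr)
    fix i j assume ij: "i \<in> I" "j \<in> I" "F i = F j" "i \<noteq> j"
    let ?c = "\<lambda>k. if k = i then 1 else if k = j then - 1 else 0 :: real"
    have "(\<Sum>k\<in>I. sc (?c k) (F k)) = (\<Sum>k\<in>{i, j}. sc (?c k) (F k))"
      by (rule sum.mono_neutral_right) (use ij I in auto)
    then have "(\<Sum>k\<in>I. sc (?c k) (F k)) = 0" using ij by simp
    from zero[OF this ij(1)] show False by simp
  qed
  have "independent (F ` I)"
  proof (rule independent_if_scalars_zero)
    fix f x assume "(\<Sum>x\<in>F ` I. sc (f x) x) = 0" "x \<in> F ` I"
    then show "f x = 0" using zero[of "\<lambda>i. f (F i)"] by (auto simp: sum.reindex[OF inj])
  qed (use I in simp)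
  moreover have "S \<subseteq> span (F ` I)"
  proof
    fix G assume G: "G \<in> S"
    from sp[OF this] obtain c where c: "\<And>p. p \<in> P \<Longrightarrow> ev p G = (\<Sum>i\<in>I. c i * T i p)" by auto
    let ?s = "\<Sum>i\<in>I. sc (c i) (F i)"
    have s: "?s \<in> S" by (rule subspace_sum[OF S]) (use F subspace_scale[OF S] in auto)
    have "G - ?s = 0"
    proof (rule sep)
      show d: "G - ?s \<in> S" using G s subspace_diff[OF S] by blast
      fix p assume p: "p \<in> P"
      have "ev p (G - ?s + ?s) = ev p (G - ?s) + ev p ?s"
        using lin[OF p] d s unfolding linear_map_def by blast
      then show "ev p (G - ?s) = 0" using c[OF p] ev[OF p order.refl, of c] by simp
    qed
    then have "G = ?s" by simp
    also have "\<dots> \<in> span (F ` I)" by (intro span_sum span_scale span_base) auto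
    finally show "G \<in> span (F ` I)" .
  qed
  ultimately have "card (F ` I) = dim S"
    using F by (intro basis_card_eq_dim) auto
  then show ?thesis by (simp add: card_image[OF inj])
qed

lemma findim_subspace:
  assumes vs: "vector_space sc" and V: "findim sc V" and U: "module.subspace sc U" "U \<subseteq> V"
  shows "findim sc U"
proof -
  interpret vector_space sc by fact
  obtain B where B: "finite B" "V = span B" using V by (auto simp: findim_def)
  obtain C where C: "C \<subseteq> U" "independent C" "U \<subseteq> span C"
    using maximal_independent_subset by blast
  have "finite C" using independent_span_bound[OF B(1) C(2)] C U B by auto
  moreover have "span C = U" using C U(1) by (metis span_subspace)
  ultimately show ?thesis by (auto simp: findim_def)
qed

lemma linear_map_0:
  assumes "vspace sc V" "vector_space scW" "linear_map sc V scW W f"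
  shows "f 0 = 0"
proof -
  interpret vector_space sc using assms by (simp add: vspace_def)
  interpret W: vector_space scW by fact
  have "0 \<in> V" using assms by (simp add: vspace_def subspace_0)
  then show ?thesis using assms(3) unfolding linear_map_def
    by (metis W.scale_zero_left scale_zero_left)
qed

lemma linear_map_sum:
  assumes "vspace sc V" "vector_space scW" "linear_map sc V scW W f"
    and "\<And>i. i \<in> I \<Longrightarrow> x i \<in> V"
  shows "f (\<Sum>i\<in>I. sc (c i) (x i)) = (\<Sum>i\<in>I. scW (c i) (f (x i)))"
proof -
  interpret vector_space sc using assms by (simp add: vspace_def)
  have V: "subspace V" using assms(1) by (simp add: vspace_def)
  show ?thesis using assms(4)
  proof (induction I rule: infinite_finite_induct)
    case (insert i I)
    have "sc (c i) (x i) \<in> V" "(\<Sum>i\<in>I. sc (c i) (x i)) \<in> V"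
      using insert.prems V by (auto intro!: subspace_sum subspace_scale)
    then show ?case using insert assms(3) by (simp add: linear_map_def)
  qed (use linear_map_0[OF assms(1-3)] in auto)
qed

lemma vspace_real [simp]: "vspace scaleR V \<longleftrightarrow> subspace V"
  by (simp add: vspace_def real_vector.vector_space_axioms subspace_raw_def)

lemma vector_space_mult [simp]: "vector_space ((*) :: 'k::field \<Rightarrow> 'k \<Rightarrow> 'k)"
  by (rule vector_space_over_itself.vector_space_axioms)

lemma
  assumes "linear_map scV V scW W f"
  shows linear_map_mem: "x \<in> V \<Longrightarrow> f x \<in> W"
    and linear_map_plus: "x \<in> V \<Longrightarrow> y \<in> V \<Longrightarrow> f (x + y) = f x + f y"
    and linear_map_scale: "x \<in> V \<Longrightarrow> f (scV c x) = scW c (f x)"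
  using assms by (simp_all add: linear_map_def)

lemma linear_map_compose:
  "linear_map scU U scV V f \<Longrightarrow> linear_map scV V scW W g \<Longrightarrow> linear_map scU U scW W (\<lambda>x. g (f x))"
  by (simp add: linear_map_def)

lemma linear_map_inv_into:
  assumes V: "vspace scV V" and f: "linear_map scV V scW W f" and bij: "bij_betw f V W"
  shows "linear_map scW W scV V (inv_into V f)"
proof -
  interpret vector_space scV using V by (simp add: vspace_def)
  have sV: "subspace V" using V by (simp add: vspace_def)
  have mem: "inv_into V f w \<in> V" "f (inv_into V f w) = w" if "w \<in> W" for w
    using that bij by (auto simp: bij_betw_def inv_into_into f_inv_into_f)
  have inj: "inv_into V f (f v) = v" if "v \<in> V" for v
    using that bij by (simp add: bij_betw_def)
  have "inv_into V f (x + y) = inv_into V f x + inv_into V f y" if "x \<in> W" "y \<in> W" for x y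
    using inj[OF subspace_add[OF sV mem(1)[OF that(1)] mem(1)[OF that(2)]]] f mem that
    by (simp add: linear_map_def)
  moreover have "inv_into V f (scW c x) = scV c (inv_into V f x)" if "x \<in> W" for x c
    using inj[OF subspace_scale[OF sV mem(1)[OF that]]] f mem that
    by (simp add: linear_map_def)
  ultimately show ?thesis using mem by (simp add: linear_map_def)
qed

lemma linear_image_findim:
  assumes V: "vspace scV V" "findim scV V" and W: "vspace scW W"
    and f: "linear_map scV V scW W f" and surj: "W \<subseteq> f ` V"
  shows "findim scW W"
proof -
  have vV: "vector_space scV" and vW: "vector_space scW" and sW: "module.subspace scW W"
    using V W by (auto simp: vspace_def)
  interpret V: vector_space scV by (rule vV)
  interpret W: vector_space scW by (rule vW)
  obtain B where B: "finite B" "V = V.span B" using V by (auto simp: findim_def)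
  have BV: "b \<in> V" if "b \<in> B" for b using that B V.span_base by auto
  have "f x \<in> W.span (f ` B)" if "x \<in> V" for x
  proof -
    have "x \<in> V.span B" using that B by simp
    then obtain t r where x: "x = (\<Sum>a\<in>t. scV (r a) a)" and t: "t \<subseteq> B"
      by (auto simp: V.span_explicit)
    have "f x = (\<Sum>a\<in>t. scW (r a) (f a))"
      unfolding x using t BV by (intro linear_map_sum[OF V(1) vW f]) auto
    then show ?thesis using t by (auto intro!: W.span_sum W.span_scale intro: W.span_base)
  qed
  then have "W \<subseteq> W.span (f ` B)" using surj by auto
  moreover have "W.span (f ` B) \<subseteq> W"
    by (rule W.span_minimal[OF _ sW]) (use f BV in \<open>auto simp: linear_map_def\<close>)
  ultimately show ?thesis using B(1) unfolding findim_def by blast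
qed

lemma linear_map_vanishes:
  assumes sc: "vector_space sc" and V: "module.subspace sc V" and L: "linear_map sc V (*) UNIV L"
    and S: "S \<subseteq> V" "V \<subseteq> module.span sc S" and zero: "\<And>z. z \<in> S \<Longrightarrow> L z = 0" and z: "z \<in> V"
  shows "L z = 0"
proof -
  interpret vector_space sc by (rule sc)
  have eq: "V = span S" using S span_minimal[OF S(1) V] by blast
  show ?thesis
  proof (rule linear_map_unique_on_span[OF sc vector_space_mult, of S UNIV L "\<lambda>_. 0"])
    show "linear_map sc (span S) (*) UNIV L" using L eq by metis
    show "z \<in> span S" using z eq by metis
  qed (simp_all add: linear_map_def zero)
qed

text \<open>
  A finite family with the expansion \<open>x = \<Sum>\<langle>x, u\<rangle> u\<close> is a Parseval frame; Gram--Schmidt produces one.  The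
  expansion of the frame so far is what makes the next vector orthogonal to the span of the previous ones.
\<close>

lemma parseval_frame_exists:
  fixes V :: "'g::real_vector set"
  assumes fin: "findim scaleR V"
    and sym: "\<And>x y. x \<in> V \<Longrightarrow> y \<in> V \<Longrightarrow> ip x y = ip y x"
    and lin: "\<And>x. x \<in> V \<Longrightarrow> linear_map scaleR V (*) UNIV (ip x)"
    and pos: "\<And>x. x \<in> V \<Longrightarrow> x \<noteq> 0 \<Longrightarrow> ip x x > (0::real)"
  shows "\<exists>E. finite E \<and> E \<subseteq> V \<and> (\<forall>x\<in>V. x = (\<Sum>e\<in>E. ip x e *\<^sub>R e))"
proof -
  obtain B where B: "finite B" "V = span B"
    using fin by (auto simp: findim_def span_raw_def)
  have sV: "subspace V" using B by simp
  have "\<exists>E. finite E \<and> E \<subseteq> span C \<and> (\<forall>x\<in>span C. x = (\<Sum>e\<in>E. ip x e *\<^sub>R e))"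
    if "C \<subseteq> V" "finite C" for C
    using that(2,1)
  proof (induction C rule: finite_induct)
    case empty
    then show ?case by (intro exI[of _ "{}"]) auto
  next
    case (insert b C)
    then obtain E where E: "finite E" "E \<subseteq> span C" "\<And>x. x \<in> span C \<Longrightarrow> x = (\<Sum>e\<in>E. ip x e *\<^sub>R e)"
      by auto
    have CV: "span C \<subseteq> V" using insert.prems span_minimal[OF _ sV] by auto
    have bV: "b \<in> V" using insert.prems by auto
    have add: "ip x (y + z) = ip x y + ip x z" and scale: "ip x (r *\<^sub>R y) = r * ip x y"
      if "x \<in> V" "y \<in> V" "z \<in> V" for x y z r
      using lin[OF that(1)] that unfolding linear_map_def by auto
    have addl: "ip (y + z) x = ip y x + ip z x" and scalel: "ip (r *\<^sub>R y) x = r * ip y x"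
      if "x \<in> V" "y \<in> V" "z \<in> V" for x y z r
      using add[OF that] scale[OF that] sym that sV by (metis subspace_add, metis subspace_scale)
    have sums: "ip x (\<Sum>e\<in>E. c e *\<^sub>R e) = (\<Sum>e\<in>E. c e * ip x e)" if "x \<in> V" for x c
      using E(2) CV by (intro linear_map_sum[OF _ _ lin[OF that]]) (auto simp: sV)
    let ?p = "\<Sum>e\<in>E. ip b e *\<^sub>R e"
    define d where "d = b - ?p"
    have p: "?p \<in> span C" using E(2) by (intro span_sum span_scale) auto
    then have pV: "?p \<in> V" using CV by auto
    have dV: "d \<in> V" unfolding d_def using bV pV sV subspace_diff by blast
    have orth: "ip d y = 0" if y: "y \<in> span C" for y
    proof -
      have yV: "y \<in> V" using y CV by auto
      have "ip y ?p = (\<Sum>e\<in>E. ip y e * ip b e)" by (simp add: sums[OF yV] mult.commute)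
      also have "\<dots> = ip b (\<Sum>e\<in>E. ip y e *\<^sub>R e)" by (simp add: sums[OF bV])
      also have "(\<Sum>e\<in>E. ip y e *\<^sub>R e) = y" using E(3)[OF y] by simp
      finally have "ip ?p y = ip b y" using sym pV yV by simp
      moreover have "ip b y = ip d y + ip ?p y"
        using addl[OF yV dV pV] by (simp add: d_def)
      ultimately show ?thesis by simp
    qed
    have decomp: "\<exists>y\<in>span C. \<exists>k. x = y + k *\<^sub>R d" if x: "x \<in> span (insert b C)" for x
    proof -
      obtain k where k: "x - k *\<^sub>R b \<in> span C" using x by (auto simp: span_insert)
      have "x - k *\<^sub>R b + k *\<^sub>R ?p \<in> span C" using k p span_add span_scale by blast
      moreover have "x = (x - k *\<^sub>R b + k *\<^sub>R ?p) + k *\<^sub>R d" by (simp add: d_def algebra_simps)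
      ultimately show ?thesis by blast
    qed
    have dspan: "d \<in> span (insert b C)"
      unfolding d_def using p span_mono[of C "insert b C"]
      by (intro span_diff) (auto intro: span_base)
    show ?case
    proof (cases "d = 0")
      case True
      then have "span (insert b C) \<subseteq> span C" using decomp by force
      then show ?thesis using E span_mono[of C "insert b C"] by (intro exI[of _ E]) auto
    next
      case False
      have dd: "ip d d > 0" using pos[OF dV False] .
      define u where "u = (1 / sqrt (ip d d)) *\<^sub>R d"
      have uV: "u \<in> V" unfolding u_def using dV sV subspace_scale by blast
      have xu: "ip x u = ip x d / sqrt (ip d d)" if "x \<in> V" for x
        unfolding u_def using scale[OF that dV dV] by simp
      have "u \<notin> E"
      proof
        assume "u \<in> E"
        then have "ip d u = 0" using orth E(2) by auto
        then show False using xu[OF dV] dd by (simp add: real_div_sqrt)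
      qed
      have "x = (\<Sum>e\<in>insert u E. ip x e *\<^sub>R e)" if x: "x \<in> span (insert b C)" for x
      proof -
        obtain y k where yk: "y \<in> span C" "x = y + k *\<^sub>R d" using decomp[OF x] by auto
        have yV: "y \<in> V" and kV: "k *\<^sub>R d \<in> V" using yk CV dV sV subspace_scale by auto
        have "ip x e = ip y e" if "e \<in> E" for e
        proof -
          have "e \<in> span C" "e \<in> V" using that E(2) CV by auto
          then show ?thesis
            using addl[OF _ yV kV, of e] scalel[OF _ dV dV, of e k] orth[of e] yk(2) by simp
        qed
        then have 1: "(\<Sum>e\<in>E. ip x e *\<^sub>R e) = y" using E(3)[OF yk(1)] by simp
        have "ip y d = 0" using orth[OF yk(1)] sym[OF yV dV] by simp
        then have "ip x d = k * ip d d"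
          using addl[OF dV yV kV] scalel[OF dV dV dV, of k] yk by simp
        moreover have "x \<in> V" using yk yV kV sV subspace_add by blast
        ultimately have "ip x u *\<^sub>R u = k *\<^sub>R d"
          using xu[of x] dd by (simp add: u_def)
        then show ?thesis using 1 yk E(1) \<open>u \<notin> E\<close> by simp
      qed
      moreover have "u \<in> span (insert b C)" unfolding u_def using dspan span_scale by blast
      ultimately show ?thesis using E span_mono[of C "insert b C"]
        by (intro exI[of _ "insert u E"]) auto
    qed
  qed
  from this[of B] B show ?thesis using span_superset[of B] by auto
qed

subsection \<open>Traces\<close>

text \<open>
  The trace is defined by a basis that is chosen once for the space, not for the endomorphism, so
  one basis computes all traces.
\<close>

lemma endo_trace_basis:
  assumes vs: "vector_space sc" and V: "findim sc V"
  shows "\<exists>B. finite B \<and> \<not> module.dependent sc B \<and> module.span sc B = V \<and>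
    (\<forall>f. endo_trace sc V f = (\<Sum>b\<in>B. module.representation sc B (f b) b))"
proof -
  interpret vector_space sc by fact
  obtain B where B: "finite B" "V = span B" using V by (auto simp: findim_def)
  have "\<exists>C. independent C \<and> span C = V"
    using maximal_independent_subset[of B] B
    by (metis span_eq_iff span_mono span_subspace subspace_span subset_antisym)
  then have C: "independent (SOME C. independent C \<and> span C = V)"
    "span (SOME C. independent C \<and> span C = V) = V"
    by (metis (mono_tags, lifting) someI_ex)+
  then have "finite (SOME C. independent C \<and> span C = V)"
    using independent_span_bound[OF B(1)] B(2) span_superset by metis
  with C show ?thesis by (auto simp: endo_trace_def Let_def)
qed

lemma
  assumes vs: "vector_space sc" and V: "findim sc V"
  shows endo_trace_add: "\<lbrakk>\<And>x. x \<in> V \<Longrightarrow> f x \<in> V; \<And>x. x \<in> V \<Longrightarrow> g x \<in> V\<rbrakk>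
      \<Longrightarrow> endo_trace sc V (\<lambda>x. f x + g x) = endo_trace sc V f + endo_trace sc V g"
    and endo_trace_scale: "(\<And>x. x \<in> V \<Longrightarrow> f x \<in> V)
      \<Longrightarrow> endo_trace sc V (\<lambda>x. sc c (f x)) = c * endo_trace sc V f"
    and endo_trace_cong: "(\<And>x. x \<in> V \<Longrightarrow> f x = g x) \<Longrightarrow> endo_trace sc V f = endo_trace sc V g"
    and endo_trace_commute: "\<lbrakk>linear_map sc V sc V f; linear_map sc V sc V g\<rbrakk>
      \<Longrightarrow> endo_trace sc V (\<lambda>x. f (g x)) = endo_trace sc V (\<lambda>x. g (f x))"
proof -
  interpret vector_space sc by fact
  obtain B where B: "finite B" "independent B" "span B = V"
    and tr: "\<And>f. endo_trace sc V f = (\<Sum>b\<in>B. representation B (f b) b)"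
    using endo_trace_basis[OF vs V] by blast
  have BV: "b \<in> V" if "b \<in> B" for b using B(3) span_base[OF that] by simp
  show "endo_trace sc V (\<lambda>x. f x + g x) = endo_trace sc V f + endo_trace sc V g"
    if "\<And>x. x \<in> V \<Longrightarrow> f x \<in> V" "\<And>x. x \<in> V \<Longrightarrow> g x \<in> V"
    using that BV B by (simp add: tr representation_add flip: sum.distrib)
  show "endo_trace sc V (\<lambda>x. sc c (f x)) = c * endo_trace sc V f"
    if "\<And>x. x \<in> V \<Longrightarrow> f x \<in> V"
    using that BV B by (simp add: tr representation_scale sum_distrib_left)
  show "endo_trace sc V f = endo_trace sc V g" if "\<And>x. x \<in> V \<Longrightarrow> f x = g x"
    using that BV by (simp add: tr)
  have comp: "endo_trace sc V (\<lambda>x. f (g x)) =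
      (\<Sum>b\<in>B. \<Sum>b'\<in>B. representation B (g b) b' * representation B (f b') b)"
    if f: "linear_map sc V sc V f" and g: "linear_map sc V sc V g" for f g
    unfolding tr
  proof (rule sum.cong[OF refl])
    fix b assume b: "b \<in> B"
    have fV: "f x \<in> V" and gV: "g x \<in> V" if "x \<in> V" for x
      using f g that by (auto simp: linear_map_def)
    have "g b = (\<Sum>b'\<in>B. sc (representation B (g b) b') b')"
      using sum_representation_eq[OF B(2) _ B(1) order.refl] gV BV[OF b] B(3) by simp
    then have "f (g b) = f (\<Sum>b'\<in>B. sc (representation B (g b) b') b')" by simp
    also have "\<dots> = (\<Sum>b'\<in>B. sc (representation B (g b) b') (f b'))"
      by (rule linear_map_sum[OF _ vs f]) (use BV vs B(3) in \<open>auto simp: vspace_def\<close>)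
    finally have fgb: "f (g b) = \<dots>" .
    show "representation B (f (g b)) b =
        (\<Sum>b'\<in>B. representation B (g b) b' * representation B (f b') b)"
      unfolding fgb
      by (subst representation_sum[OF B(2)])
         (use fV BV B in \<open>auto simp: representation_scale intro!: span_scale\<close>)
  qed
  show "endo_trace sc V (\<lambda>x. f (g x)) = endo_trace sc V (\<lambda>x. g (f x))"
    if "linear_map sc V sc V f" "linear_map sc V sc V g"
    unfolding comp[OF that] comp[OF that(2,1)]
    by (subst sum.swap) (simp add: mult.commute)
qed

section \<open>Schur's lemma over the complex numbers\<close>

text \<open>
  The vector \<open>p(f) v\<close>.
\<close>

definition poly_operator :: "('k::field \<Rightarrow> 'v::ab_group_add \<Rightarrow> 'v) \<Rightarrow> ('v \<Rightarrow> 'v) \<Rightarrow> 'k poly \<Rightarrow> 'v \<Rightarrow> 'v" where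
  "poly_operator sc f p v = (\<Sum>i\<le>degree p. sc (coeff p i) ((f ^^ i) v))"

lemma poly_operator_eq:
  assumes "vector_space sc" "degree p \<le> n"
  shows "poly_operator sc f p v = (\<Sum>i\<le>n. sc (coeff p i) ((f ^^ i) v))"
proof -
  interpret vector_space sc by fact
  show ?thesis unfolding poly_operator_def
    by (rule sum.mono_neutral_left) (use assms(2) in \<open>auto simp: coeff_eq_0\<close>)
qed

lemma funpow_in_carrier:
  assumes "linear_map sc V sc V f" "v \<in> V"
  shows "(f ^^ i) v \<in> V"
  using assms by (induction i) (auto simp: linear_map_def)

lemma poly_operator_linear_factor:
  assumes V: "vspace sc V" and f: "linear_map sc V sc V f" and v: "v \<in> V"
  shows "poly_operator sc f ([:- a, 1:] * r) v = f (poly_operator sc f r v) - sc a (poly_operator sc f r v)"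
proof -
  have vs: "vector_space sc" using V by (simp add: vspace_def)
  interpret vector_space sc by fact
  let ?n = "degree r"
  have eq: "[:- a, 1:] * r = pCons 0 r - smult a r" by simp
  have deg: "degree ([:- a, 1:] * r) \<le> Suc ?n"
    unfolding eq by (rule degree_diff_le) (auto intro: le_SucI simp: degree_pCons_le)
  have "f (poly_operator sc f r v) = (\<Sum>i\<le>?n. sc (coeff r i) (f ((f ^^ i) v)))"
    unfolding poly_operator_def
    by (rule linear_map_sum[OF V vs f]) (rule funpow_in_carrier[OF f v])
  also have "\<dots> = (\<Sum>i\<le>Suc ?n. sc (coeff (pCons 0 r) i) ((f ^^ i) v))"
    by (simp add: sum.atMost_Suc_shift del: sum.atMost_Suc)
  finally have 1: "f (poly_operator sc f r v) = \<dots>" .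
  have 2: "sc a (poly_operator sc f r v) = (\<Sum>i\<le>Suc ?n. sc (coeff (smult a r) i) ((f ^^ i) v))"
    unfolding poly_operator_eq[OF vs le_SucI[OF order.refl]]
    by (simp add: scale_sum_right scale_right_distrib)
  show ?thesis
    unfolding poly_operator_eq[OF vs deg] 1 2 unfolding eq
    by (simp add: scale_left_diff_distrib sum_subtractf)
qed

lemma span_image_lessThan:
  assumes "vector_space sc" "x \<in> module.span sc (u ` {..<n::nat})"
  shows "\<exists>c. x = (\<Sum>i<n. sc (c i) (u i))"
proof -
  interpret vector_space sc by fact
  show ?thesis using assms(2)
  proof (induction rule: span_induct_alt)
    case base
    show ?case by (rule exI[of _ "\<lambda>_. 0"]) simp
  next
    case (step k y z)
    then obtain i c where i: "i < n" "y = u i" and c: "z = (\<Sum>i<n. sc (c i) (u i))" by auto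
    have "sc k y = (\<Sum>j<n. sc (if j = i then k else 0) (u j))"
      using i by (simp add: if_distrib[of "\<lambda>a. sc a _"] cong: if_cong)
    then have "sc k y + z = (\<Sum>j<n. sc ((if j = i then k else 0) + c j) (u j))"
      by (simp add: c scale_left_distrib sum.distrib)
    then show ?case by (intro exI[of _ "\<lambda>j. (if j = i then k else 0) + c j"])
  qed
qed

text \<open>
  In finite dimension the iterates of a vector are eventually dependent on the previous ones, so
  some nonzero polynomial in the operator annihilates the vector.
\<close>

lemma annihilating_polynomial_exists:
  assumes V: "vspace sc V" "findim sc V" and f: "linear_map sc V sc V f" and v: "v \<in> V"
  shows "\<exists>p. p \<noteq> 0 \<and> poly_operator sc f p v = 0"
proof -
  have vs: "vector_space sc" using V by (simp add: vspace_def)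
  interpret vector_space sc by fact
  obtain B where B: "finite B" "V = span B" using V by (auto simp: findim_def)
  define u where "u i = (f ^^ i) v" for i
  have uV: "u i \<in> V" for i unfolding u_def by (rule funpow_in_carrier[OF f v])
  have "\<exists>n. u n \<in> span (u ` {..<n})"
  proof (rule ccontr)
    assume *: "\<not> ?thesis"
    have "independent (u ` {..<n}) \<and> card (u ` {..<n}) = n" for n
    proof (induction n)
      case (Suc n)
      have n: "u n \<notin> span (u ` {..<n})" using * by simp
      then have "u n \<notin> u ` {..<n}" using span_base by metis
      moreover have "u ` {..<Suc n} = insert (u n) (u ` {..<n})" by (simp add: lessThan_Suc)
      ultimately show ?case using independent_insertI[OF n] Suc by (simp del: image_insert)
    qed (simp add: independent_empty)
    then have "Suc (card B) \<le> card B"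
      using independent_span_bound[OF B(1), of "u ` {..<Suc (card B)}"] uV B(2)
      by (metis image_subsetI)
    then show False by simp
  qed
  then obtain n c where c: "u n = (\<Sum>i<n. sc (c i) (u i))"
    using span_image_lessThan[OF vs] by metis
  define p where "p = monom 1 n - (\<Sum>i<n. monom (c i) i)"
  have coeff: "coeff p i = (if i = n then 1 else if i < n then - c i else 0)" for i
    by (simp add: p_def coeff_sum)
  have "degree p \<le> n" by (rule degree_le) (simp add: coeff)
  then have "poly_operator sc f p v = (\<Sum>i\<le>n. sc (coeff p i) (u i))"
    by (simp add: poly_operator_eq[OF vs] u_def)
  also have "\<dots> = sc 1 (u n) + (\<Sum>i<n. sc (- c i) (u i))"
    by (simp add: coeff flip: lessThan_Suc_atMost)
  also have "\<dots> = 0" using c by (simp add: sum_negf)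
  finally show ?thesis using coeff[of n] by (intro exI[of _ p]) auto
qed

text \<open>
  Take a nonzero polynomial \<open>p\<close> of least degree with \<open>p(f) v = 0\<close> and split off a root, \<open>p = (X - a) r\<close>.
  Then \<open>r(f) v\<close> is nonzero by minimality, and \<open>f - a\<close> annihilates it.
\<close>

lemma eigenvector_exists:
  fixes sc :: "complex \<Rightarrow> 'v::ab_group_add \<Rightarrow> 'v"
  assumes V: "vspace sc V" "findim sc V" and f: "linear_map sc V sc V f" and v: "v \<in> V" "v \<noteq> 0"
  shows "\<exists>a. \<exists>w\<in>V. w \<noteq> 0 \<and> f w = sc a w"
proof -
  have vs: "vector_space sc" using V by (simp add: vspace_def)
  interpret vector_space sc by fact
  let ?P = "\<lambda>p. p \<noteq> 0 \<and> poly_operator sc f p v = 0"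
  obtain p where p: "?P p" and min: "\<And>r. ?P r \<Longrightarrow> degree p \<le> degree r"
    using annihilating_polynomial_exists[OF V f v(1)]
      ex_has_least_nat[of ?P _ degree] by metis
  have "degree p \<noteq> 0"
  proof
    assume "degree p = 0"
    then obtain a where a: "p = [:a:]" by (rule degree_eq_zeroE)
    with p v show False by (simp add: poly_operator_def)
  qed
  then obtain a where "poly p a = 0"
    using fundamental_theorem_of_algebra[of p] constant_degree[of p] by auto
  then obtain r where r: "p = [:- a, 1:] * r" by (auto simp: poly_eq_0_iff_dvd)
  then have r0: "r \<noteq> 0" using p by auto
  have "degree p = Suc (degree r)" unfolding r by (subst degree_mult_eq) (use r0 in auto)
  then have "poly_operator sc f r v \<noteq> 0" using min[of r] r0 by auto
  moreover have "poly_operator sc f r v \<in> V"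
    unfolding poly_operator_def using V(1) funpow_in_carrier[OF f v(1)]
    by (intro subspace_sum subspace_scale) (auto simp: vspace_def)
  moreover have "f (poly_operator sc f r v) = sc a (poly_operator sc f r v)"
    using p poly_operator_linear_factor[OF V(1) f v(1), of a r] r by simp
  ultimately show ?thesis by blast
qed

text \<open>
  An eigenspace of an equivariant endomorphism is a nonzero submodule, hence everything.
\<close>

lemma schur:
  fixes scW :: "complex \<Rightarrow> 'w::ab_group_add \<Rightarrow> 'w"
  assumes irr: "irreducible_module sc L br scW W act" and fin: "findim scW W"
    and f: "linear_map scW W scW W f"
    and comm: "\<And>x w. x \<in> L \<Longrightarrow> w \<in> W \<Longrightarrow> f (act x w) = act x (f w)"
  shows "\<exists>a. \<forall>w\<in>W. f w = scW a w"
proof -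
  have V: "vspace scW W" and W0: "W \<noteq> {0}"
    and act: "\<And>x. x \<in> L \<Longrightarrow> linear_map scW W scW W (act x)"
    using irr by (auto simp: irreducible_module_def lie_module_def bilinear_map_def)
  then have vs: "vector_space scW" and sW: "module.subspace scW W" by (auto simp: vspace_def)
  interpret vector_space scW by fact
  obtain v where "v \<in> W" "v \<noteq> 0" using W0 subspace_0[OF sW] by auto
  from eigenvector_exists[OF V fin f this]
  obtain a w where a: "w \<in> W" "w \<noteq> 0" "f w = scW a w" by auto
  let ?U = "{w \<in> W. f w = scW a w}"
  have "module.subspace scW ?U"
    unfolding subspace_def using f linear_map_0[OF V vs f] sW
    by (auto simp: linear_map_def scale_right_distrib subspace_0 subspace_add subspace_scale mult.commute)
  moreover have "act x u \<in> ?U" if "x \<in> L" "u \<in> ?U" for x u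
    using that act[OF that(1)] comm[OF that(1)] by (auto simp: linear_map_def)
  ultimately have "?U = {0} \<or> ?U = W"
    using irr unfolding irreducible_module_def by blast
  then have "?U = W" using a by auto
  then show ?thesis by auto
qed

section \<open>Parity of weights\<close>

text \<open>
  The element \<open>c\<close> is the sum of the coroots \<open>t i\<close> for \<open>i \<in> S\<close>.  Every root takes an even value on \<open>c\<close>, so the
  root spaces preserve the span of the eigenvectors of \<open>c\<close> with odd eigenvalue.  This span is a submodule
  that contains the highest weight vector.  In terms of groups, \<open>exp(\<pi>\<i>c)\<close> is central and acts on \<open>W\<close>
  by \<open>- 1\<close>.
\<close>

lemma odd_coweight_exists:
  fixes sc :: "complex \<Rightarrow> 'l::ab_group_add \<Rightarrow> 'l" and scW :: "complex \<Rightarrow> 'w::ab_group_add \<Rightarrow> 'w"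
  assumes hw: "highest_weight_module X m sc L br scW W act"
    and S: "S \<subseteq> {1..dynkin_rank X}"
    and even: "\<And>j. j \<in> {1..dynkin_rank X} \<Longrightarrow> even (\<Sum>i\<in>S. cartan_matrix X j i)"
    and odd: "odd (\<Sum>i\<in>S. m i)"
  shows "\<exists>c\<in>L. module.span scW {w \<in> W. \<exists>k::int. act c w = scW (of_int (2 * k + 1)) w} = W"
proof -
  from hw have irr: "irreducible_module sc L br scW W act"
    by (simp add: highest_weight_module_def)
  then have lm: "lie_module sc L br scW W act" by (simp add: irreducible_module_def)
  from hw obtain H \<alpha> t \<mu> v where srd: "simple_root_data X sc L br H \<alpha> t"
    and \<mu>: "linear_map sc H (*) UNIV \<mu>"
    and \<mu>t: "\<And>i. i \<in> {1..dynkin_rank X} \<Longrightarrow> \<mu> (t i) = of_nat (m i)"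
    and v: "v \<in> W" "v \<noteq> 0" and vwt: "\<And>h. h \<in> H \<Longrightarrow> act h v = scW (\<mu> h) v"
    unfolding highest_weight_module_def by blast
  have vsL: "vspace sc L" and vsW: "vspace scW W"
    and brb: "bilinear_map sc L sc L sc L br" and actb: "bilinear_map sc L scW W scW W act"
    and act_br: "\<And>x y w. x \<in> L \<Longrightarrow> y \<in> L \<Longrightarrow> w \<in> W \<Longrightarrow> act (br x y) w = act x (act y w) - act y (act x w)"
    using lm by (auto simp: lie_module_def lie_algebra_def)
  have csa: "cartan_subalgebra sc L br H" and rb: "root_base sc L br H (dynkin_rank X) \<alpha>"
    and co: "\<And>i. i \<in> {1..dynkin_rank X} \<Longrightarrow> is_coroot sc L br H (\<alpha> i) (t i)"
    and cm: "\<And>i j. i \<in> {1..dynkin_rank X} \<Longrightarrow> j \<in> {1..dynkin_rank X} \<Longrightarrow>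
      \<alpha> i (t j) = of_int (cartan_matrix X i j)"
    using srd unfolding simple_root_data_def by auto
  have vs: "vector_space sc" and vs': "vector_space scW" and sW: "module.subspace scW W"
    and sL: "module.subspace sc L"
    using vsL vsW by (auto simp: vspace_def)
  interpret L: vector_space sc by fact
  interpret W: vector_space scW by fact
  have sH: "L.subspace H" and HL: "H \<subseteq> L"
    and spanL: "L.span (\<Union>\<beta>. root_space sc L br H \<beta>) = L"
    using csa by (auto simp: cartan_subalgebra_def lie_subalgebra_def)
  have \<alpha>: "linear_map sc H (*) UNIV (\<alpha> i)" and \<alpha>0: "\<And>x. x \<notin> H \<Longrightarrow> \<alpha> i x = 0"
    if "i \<in> {1..dynkin_rank X}" for i
    using rb that by (auto simp: root_base_def roots_def)
  have tH: "t i \<in> H" if "i \<in> {1..dynkin_rank X}" for i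
    using co[OF that] \<alpha>0[OF that, of "t i"] by (auto simp: is_coroot_def)
  define c where "c = (\<Sum>i\<in>S. t i)"
  have cH: "c \<in> H" unfolding c_def using S tH by (intro L.subspace_sum[OF sH]) auto
  then have cL: "c \<in> L" using HL by auto
  have sum_c: "\<beta> c = (\<Sum>i\<in>S. \<beta> (t i))" if "linear_map sc H (*) UNIV \<beta>" for \<beta>
    using linear_map_sum[OF _ _ that, of S t "\<lambda>_. 1"] vs sH S tH
    by (auto simp: c_def vspace_def subset_eq)
  have \<alpha>c: "\<exists>k::int. \<alpha> j c = of_int (2 * k)" if j: "j \<in> {1..dynkin_rank X}" for j
  proof -
    have "\<alpha> j c = of_int (\<Sum>i\<in>S. cartan_matrix X j i)"
      using sum_c[OF \<alpha>[OF j]] cm[OF j] S by (auto simp: subset_eq intro!: sum.cong)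
    moreover obtain k where "(\<Sum>i\<in>S. cartan_matrix X j i) = 2 * k" using even[OF j] by (rule evenE)
    ultimately have "\<alpha> j c = of_int (2 * k)" by simp
    then show ?thesis by blast
  qed
  have pos: "\<exists>k::int. \<beta> c = of_int (2 * k)"
    if \<beta>: "\<beta> \<in> positive_roots sc L br H (dynkin_rank X) \<alpha>" for \<beta>
  proof -
    obtain n :: "nat \<Rightarrow> nat" where n: "\<beta> c = (\<Sum>i=1..dynkin_rank X. of_nat (n i) * \<alpha> i c)"
      using \<beta> cH unfolding positive_roots_def by blast
    obtain k :: "nat \<Rightarrow> int" where k: "\<And>j. j \<in> {1..dynkin_rank X} \<Longrightarrow> \<alpha> j c = of_int (2 * k j)"
      using \<alpha>c by metis
    have "\<beta> c = of_int (2 * (\<Sum>i=1..dynkin_rank X. int (n i) * k i))"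
      unfolding n of_int_mult of_int_sum sum_distrib_left
      by (intro sum.cong refl) (simp add: k)
    then show ?thesis by blast
  qed
  \<comment> \<open>root spaces are indexed by arbitrary functions; the root itself is the restriction to \<open>H\<close>,
    extended by \<open>0\<close>\<close>
  have root_even: "\<exists>k::int. br c x = sc (of_int (2 * k)) x"
    if x: "x \<in> root_space sc L br H \<beta>" for \<beta> x
  proof (cases "x = 0 \<or> (\<forall>h\<in>H. \<beta> h = 0)")
    case True
    then have "br c x = sc (of_int (2 * 0)) x"
      using x cH by (auto simp: root_space_def)
    then show ?thesis by blast
  next
    case False
    have xL: "x \<in> L" and wt: "\<And>h. h \<in> H \<Longrightarrow> br h x = sc (\<beta> h) x"
      using x by (auto simp: root_space_def)
    have lin: "linear_map sc L sc L (\<lambda>h. br h x)" using brb xL by (simp add: bilinear_map_def)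
    define \<beta>' where "\<beta>' h = (if h \<in> H then \<beta> h else 0)" for h
    have "\<beta> (h + h') = \<beta> h + \<beta> h'" if "h \<in> H" "h' \<in> H" for h h'
    proof -
      have "sc (\<beta> (h + h')) x = sc (\<beta> h + \<beta> h') x"
        using lin that HL wt[OF that(1)] wt[OF that(2)] wt[OF L.subspace_add[OF sH that]]
        unfolding linear_map_def by (metis L.scale_left_distrib subsetD)
      then show ?thesis using False by simp
    qed
    moreover have "\<beta> (sc r h) = r * \<beta> h" if "h \<in> H" for h r
    proof -
      have "sc (\<beta> (sc r h)) x = sc (r * \<beta> h) x"
        using lin that HL wt[OF that(1)] wt[OF L.subspace_scale[OF sH that(1)]]
        unfolding linear_map_def by (metis L.scale_scale subsetD)
      then show ?thesis using False by simp
    qed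
    ultimately have "linear_map sc H (*) UNIV \<beta>'"
      using L.subspace_add[OF sH] L.subspace_scale[OF sH] by (auto simp: linear_map_def \<beta>'_def)
    moreover have "root_space sc L br H \<beta>' = root_space sc L br H \<beta>"
      by (auto simp: root_space_def \<beta>'_def)
    ultimately have "\<beta>' \<in> roots sc L br H"
      using False x by (auto simp: roots_def \<beta>'_def)
    then have "\<exists>k::int. \<beta>' c = of_int (2 * k)"
    proof (cases "\<beta>' \<in> positive_roots sc L br H (dynkin_rank X) \<alpha>")
      case False
      with \<open>\<beta>' \<in> roots sc L br H\<close>
      have "(\<lambda>h. - \<beta>' h) \<in> positive_roots sc L br H (dynkin_rank X) \<alpha>"
        using rb unfolding root_base_def by blast
      from pos[OF this] obtain k :: int where "- \<beta>' c = of_int (2 * k)" by auto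
      then have "\<beta>' c = - of_int (2 * k)" by (metis minus_minus)
      then have "\<beta>' c = of_int (2 * (- k))" by simp
      then show ?thesis by blast
    qed (rule pos)
    then show ?thesis using wt[OF cH] cH by (auto simp: \<beta>'_def)
  qed
  let ?O = "{w \<in> W. \<exists>k::int. act c w = scW (of_int (2 * k + 1)) w}"
  let ?M = "W.span ?O"
  have MW: "?M \<subseteq> W" by (rule W.span_minimal[OF _ sW]) auto
  have lin: "linear_map scW W scW W (act x)" if "x \<in> L" for x
    using actb that by (simp add: bilinear_map_def)
  have linL: "linear_map sc L scW W (\<lambda>x. act x w)" if "w \<in> W" for w
    using actb that by (simp add: bilinear_map_def)
  have inv1: "act x w \<in> ?O" if x: "x \<in> root_space sc L br H \<beta>" and w: "w \<in> ?O" for x w \<beta>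
  proof -
    obtain k l :: int where k: "br c x = sc (of_int (2 * k)) x"
      and l: "act c w = scW (of_int (2 * l + 1)) w" using root_even[OF x] w by auto
    have xL: "x \<in> L" and wW: "w \<in> W" using x w by (auto simp: root_space_def)
    have "act c (act x w) = act (br c x) w + act x (act c w)"
      using act_br[OF cL xL wW] by simp
    also have "act (br c x) w = scW (of_int (2 * k)) (act x w)"
      using k linL[OF wW] xL by (simp add: linear_map_def)
    also have "act x (act c w) = scW (of_int (2 * l + 1)) (act x w)"
      using l lin[OF xL] wW by (simp add: linear_map_def)
    finally have "act c (act x w) = scW (of_int (2 * (k + l) + 1)) (act x w)"
      by (simp add: distrib_left add.assoc flip: W.scale_left_distrib)
    moreover have "act x w \<in> W" using lin[OF xL] wW by (simp add: linear_map_def)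
    ultimately show ?thesis by blast
  qed
  have inv2: "act x w \<in> ?M" if x: "x \<in> root_space sc L br H \<beta>" and w: "w \<in> ?M" for x w \<beta>
  proof -
    have xL: "x \<in> L" using x by (simp add: root_space_def)
    have "w \<in> W \<and> act x w \<in> ?M"
      using w
    proof (induction rule: W.span_induct_alt)
      case base
      show ?case using linear_map_0[OF vsW vs' lin[OF xL]] W.subspace_0[OF sW]
        by (simp add: W.span_zero)
    next
      case (step r y z)
      then have "act x (scW r y + z) = scW r (act x y) + act x z"
        using lin[OF xL] W.subspace_scale[OF sW] by (auto simp: linear_map_def)
      then show ?case using step inv1[OF x step(1)] sW
        by (simp add: W.span_add W.span_scale W.span_base W.subspace_add W.subspace_scale)
    qed
    then show ?thesis by simp
  qed
  have inv: "act x w \<in> ?M" if w: "w \<in> ?M" and x: "x \<in> L" for x w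
  proof -
    have wW: "w \<in> W" using w MW by auto
    have "x \<in> L.span (\<Union>\<beta>. root_space sc L br H \<beta>)" using x spanL by simp
    then have "x \<in> L \<and> act x w \<in> ?M"
    proof (induction rule: L.span_induct_alt)
      case base
      show ?case using linear_map_0[OF vsL vs' linL[OF wW]] L.subspace_0[OF sL]
        by (simp add: W.span_zero)
    next
      case (step r y z)
      then obtain \<beta> where y: "y \<in> root_space sc L br H \<beta>" by auto
      then have yL: "y \<in> L" by (simp add: root_space_def)
      have "act (sc r y + z) w = scW r (act y w) + act z w"
        using linL[OF wW] yL step(2) L.subspace_scale[OF sL] by (auto simp: linear_map_def)
      then show ?case using step inv2[OF y w] yL sL
        by (auto simp: W.span_add W.span_scale L.subspace_add L.subspace_scale)
    qed
    then show ?thesis by simp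
  qed
  have "\<mu> c = of_int (int (\<Sum>i\<in>S. m i))"
    using sum_c[OF \<mu>] \<mu>t S by (auto simp: subset_eq intro!: sum.cong)
  moreover obtain k where "(\<Sum>i\<in>S. m i) = 2 * k + 1" using odd by (rule oddE)
  ultimately have "\<mu> c = of_int (2 * int k + 1)" by simp
  then have "act c v = scW (of_int (2 * int k + 1)) v" using vwt[OF cH] by simp
  then have "v \<in> ?O" using v by blast
  then have "v \<in> ?M" by (rule W.span_base)
  have "?M = {0} \<or> ?M = W"
    using irr W.subspace_span[of ?O] MW inv unfolding irreducible_module_def by blast
  with \<open>v \<in> ?M\<close> v(2) have "?M = W" by auto
  with cL show ?thesis by blast
qed

text \<open>
  The sets are \<open>{1}\<close>, \<open>{1, 3}\<close>, \<open>{1, 3, 5}\<close>, \<open>{1, 3, 5}\<close>, \<open>{2, 5, 7}\<close>.  Each of them solves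
  \<open>\<Sum>i\<in>S. \<langle>\<alpha>\<^sub>j, \<alpha>\<^sub>i\<^sup>\<or>\<rangle> = 0\<close> modulo 2 for all \<open>j\<close>, and contains an odd number of the nodes at which the highest
  weight has an odd coefficient.
\<close>

lemma W_weight_parity:
  assumes "s \<in> {1..5}"
  shows "\<exists>S\<subseteq>{1..dynkin_rank (h_type s)}.
    (\<forall>j\<in>{1..dynkin_rank (h_type s)}. even (\<Sum>i\<in>S. cartan_matrix (h_type s) j i)) \<and>
    odd (\<Sum>i\<in>S. W_weight s i)"
proof -
  have small: "j = 1 \<or> j = 2 \<or> j = 3 \<or> j = 4 \<or> j = 5 \<or> j = 6 \<or> j = 7"
    if "j \<in> {1..n}" "n \<le> 7" for j n :: nat
    using that by (simp only: atLeastAtMost_iff) presburger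
  have C: "even (\<Sum>i\<in>{1, 3}. cartan_matrix (Dynkin_C 3) j i)" if "j \<in> {1..3}" for j
    using small[OF that, simplified] that by (elim disjE) simp_all
  have A: "even (\<Sum>i\<in>{1, 3, 5}. cartan_matrix (Dynkin_A 5) j i)" if "j \<in> {1..5}" for j
    using small[OF that, simplified] that by (elim disjE) simp_all
  have D: "even (\<Sum>i\<in>{1, 3, 5}. cartan_matrix (Dynkin_D 6) j i)" if "j \<in> {1..6}" for j
    using small[OF that, simplified] that by (elim disjE) (simp_all add: doubleton_eq_iff)
  have E: "even (\<Sum>i\<in>{2, 5, 7}. cartan_matrix (Dynkin_E 7) j i)" if "j \<in> {1..7}" for j
    using small[OF that, simplified] by (elim disjE) (simp_all add: doubleton_eq_iff)
  have "s = 1 \<or> s = 2 \<or> s = 3 \<or> s = 4 \<or> s = 5"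
    using assms by (simp only: atLeastAtMost_iff) presburger
  then show ?thesis
  proof (elim disjE)
    assume "s = 1"
    then show ?thesis by (intro exI[of _ "{1}"]) (simp add: h_type_def W_weight_def)
  next
    assume s: "s = 2"
    show ?thesis
      by (intro exI[of _ "{1,3}"] conjI ballI)
        (use C in \<open>simp_all add: s h_type_def W_weight_def del: cartan_matrix.simps One_nat_def\<close>)
  next
    assume s: "s = 3"
    show ?thesis
      by (intro exI[of _ "{1,3,5}"] conjI ballI)
        (use A in \<open>simp_all add: s h_type_def W_weight_def del: cartan_matrix.simps One_nat_def\<close>)
  next
    assume s: "s = 4"
    show ?thesis
      by (intro exI[of _ "{1,3,5}"] conjI ballI)
        (use D in \<open>simp_all add: s h_type_def W_weight_def del: cartan_matrix.simps One_nat_def\<close>)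
  next
    assume s: "s = 5"
    show ?thesis
      by (intro exI[of _ "{2,5,7}"] conjI ballI)
        (use E in \<open>simp_all add: s h_type_def W_weight_def del: cartan_matrix.simps One_nat_def\<close>)
  qed
qed

section \<open>The odd part as a module\<close>

lemma vector_space_cscale: "vector_space cscale"
  by unfold_locales (auto simp: cscale_def algebra_simps split: prod.splits)

lemma vspace_complexification: "subspace V \<Longrightarrow> vspace cscale (V \<times> V)"
proof -
  assume V: "subspace V"
  interpret C: vector_space cscale by (rule vector_space_cscale)
  show ?thesis
    unfolding vspace_def C.subspace_def
    using V vector_space_cscale
    by (auto simp: cscale_def zero_prod_def intro: subspace_0 subspace_add subspace_diff subspace_scale)
qed

lemma vector_space_matrix_scale: "vector_space (matrix_scale :: complex \<Rightarrow> complex^2^2 \<Rightarrow> _)"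
  by unfold_locales (auto simp: matrix_scale_def vec_eq_iff algebra_simps)

lemma
  assumes V: "vspace scV V" and W: "vspace scW W"
  shows pure_tensor_linear_left:
      "w \<in> W \<Longrightarrow> linear_map scV V dual_scale (tensor_product scV V scW W) (\<lambda>v. pure_tensor scV V scW W v w)"
    and pure_tensor_linear_right:
      "v \<in> V \<Longrightarrow> linear_map scW W dual_scale (tensor_product scV V scW W) (pure_tensor scV V scW W v)"
proof -
  have 0: "vector_space (dual_scale :: 'a \<Rightarrow> (('b \<times> 'c \<Rightarrow> 'a) \<Rightarrow> 'a) \<Rightarrow> _)"
    by (rule vector_space_fun_scale) simp
  interpret D: vector_space "dual_scale :: 'a \<Rightarrow> (('b \<times> 'c \<Rightarrow> 'a) \<Rightarrow> 'a) \<Rightarrow> _" by (rule 0)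
  have in_T: "pure_tensor scV V scW W v w \<in> tensor_product scV V scW W" if "v \<in> V" "w \<in> W" for v w
    unfolding tensor_product_def by (rule D.span_base) (use that in blast)
  have \<beta>1: "linear_map scV V (*) UNIV (\<lambda>v. \<beta> (v, w))"
    if "\<beta> \<in> bilinear_forms scV V scW W" "w \<in> W" for \<beta> w
    using that by (simp add: bilinear_forms_def bilinear_map_def)
  have \<beta>2: "linear_map scW W (*) UNIV (\<lambda>w. \<beta> (v, w))"
    if "\<beta> \<in> bilinear_forms scV V scW W" "v \<in> V" for \<beta> v
    using that by (simp add: bilinear_forms_def bilinear_map_def)
  show "linear_map scV V dual_scale (tensor_product scV V scW W) (\<lambda>v. pure_tensor scV V scW W v w)"
    if w: "w \<in> W"
    unfolding linear_map_def
    using \<beta>1[OF _ w] in_T[OF _ w]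
    by (auto simp: pure_tensor_def evaluation_def fun_scale_def fun_eq_iff linear_map_def)
  show "linear_map scW W dual_scale (tensor_product scV V scW W) (pure_tensor scV V scW W v)"
    if v: "v \<in> V"
    unfolding linear_map_def
    using \<beta>2[OF _ v] in_T[OF v]
    by (auto simp: pure_tensor_def evaluation_def fun_scale_def fun_eq_iff linear_map_def)
qed

lemma vector_space_vec: "vector_space ((*s) :: complex \<Rightarrow> complex^2 \<Rightarrow> complex^2)"
  by (rule vec.vector_space_axioms)

lemma vspace_vec: "vspace ((*s) :: complex \<Rightarrow> complex^2 \<Rightarrow> complex^2) UNIV"
  by (auto simp: vspace_def vector_space_vec)

text \<open>
  \<open>\<complex>\<^sup>2 \<otimes> W\<close> is \<open>W \<oplus> W\<close>: the bilinear maps \<open>(u, w) \<mapsto> u\<^sub>j w\<close> factor through the tensor product and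
  give the two coordinates.
\<close>

lemma tensor_coordinates:
  fixes scW :: "complex \<Rightarrow> 'w::ab_group_add \<Rightarrow> 'w"
  assumes W: "vspace scW W"
  defines "TP \<equiv> tensor_product (*s) (UNIV :: (complex^2) set) scW W"
    and "pt \<equiv> pure_tensor (*s) (UNIV :: (complex^2) set) scW W"
  obtains f :: "2 \<Rightarrow> _" where "\<And>j. linear_map dual_scale TP scW W (f j)"
    "\<And>j u w. w \<in> W \<Longrightarrow> f j (pt u w) = scW (u $ j) w"
    "\<And>T. T \<in> TP \<Longrightarrow> T = (\<Sum>j\<in>UNIV. pt (axis j 1) (f j T))"
proof -
  let ?D = "dual_scale :: complex \<Rightarrow> (((complex^2) \<times> 'w \<Rightarrow> complex) \<Rightarrow> complex) \<Rightarrow> _"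
  have vD: "vector_space ?D" by (rule vector_space_fun_scale) simp
  interpret D: vector_space ?D by (rule vD)
  have vW: "vector_space scW" and sW: "module.subspace scW W" using W by (auto simp: vspace_def)
  interpret W: vector_space scW by (rule vW)
  have TP: "TP = D.span {pt u w | u w. w \<in> W}"
    by (simp add: TP_def pt_def tensor_product_def)
  have "\<exists>f. linear_map ?D UNIV scW UNIV f \<and> (\<forall>u w. f (pt u w) = scW (u $ j) w)" for j
    unfolding pt_def
    by (rule tensor_product_universal[OF vW])
      (auto simp: bilinear_map_def linear_map_def W.scale_right_distrib W.scale_left_distrib mult.commute)
  then obtain f where f: "\<And>j. linear_map ?D UNIV scW UNIV (f j)"
    and fp: "\<And>j u w. f j (pt u w) = scW (u $ j) w" by metis
  have f_in: "f j T \<in> W" if "T \<in> TP" for j T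
    using that unfolding TP
  proof (induction rule: D.span_induct_alt)
    case base
    have "f j 0 = 0" by (rule linear_map_0[OF _ vW f]) (simp add: vspace_def vD)
    then show ?case using W.subspace_0[OF sW] by (simp only:)
  next
    case (step c x y)
    then have "f j x \<in> W" using fp W.subspace_scale[OF sW] by auto
    moreover have "f j (?D c x + y) = scW c (f j x) + f j y"
      using f[of j] unfolding linear_map_def by (metis UNIV_I)
    ultimately show ?case using step(2) W.subspace_add[OF sW] W.subspace_scale[OF sW]
      by (simp only:)
  qed
  have lin: "linear_map ?D TP scW W (f j)" for j
    using f f_in by (auto simp: linear_map_def)
  have right: "linear_map scW W ?D TP (pt u)" for u
    unfolding pt_def TP_def by (rule pure_tensor_linear_right[OF vspace_vec W]) simp
  have left: "linear_map (*s) UNIV ?D TP (\<lambda>u. pt u w)" if "w \<in> W" for w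
    unfolding pt_def TP_def by (rule pure_tensor_linear_left[OF vspace_vec W that])
  have "T = (\<Sum>j\<in>UNIV. pt (axis j 1) (f j T))" if T: "T \<in> TP" for T
  proof (rule linear_map_unique_on_span[OF vD vD, of "{pt u w | u w. w \<in> W}" UNIV "\<lambda>T. T"])
    show "linear_map ?D (D.span {pt u w |u w. w \<in> W}) ?D UNIV (\<lambda>T. T)"
      by (simp add: linear_map_def)
    show "linear_map ?D (D.span {pt u w |u w. w \<in> W}) ?D UNIV (\<lambda>T. \<Sum>j\<in>UNIV. pt (axis j 1) (f j T))"
      using lin right f_in unfolding TP[symmetric] linear_map_def
      by (simp add: sum.distrib D.scale_sum_right del: sum_2)
    show "T \<in> D.span {pt u w |u w. w \<in> W}" using T by (simp add: TP)
    fix x assume "x \<in> {pt u w |u w. w \<in> W}"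
    then obtain u w where x: "x = pt u w" "w \<in> W" by auto
    have "u = (\<Sum>j\<in>UNIV. (u $ j) *s axis j 1)"
      by (simp add: vec_eq_iff axis_def if_distrib cong: if_cong)
    then have "pt u w = pt (\<Sum>j\<in>UNIV. (u $ j) *s axis j 1) w" by simp
    also have "\<dots> = (\<Sum>j\<in>UNIV. ?D (u $ j) (pt (axis j 1) w))"
      by (rule linear_map_sum[OF vspace_vec vD left[OF x(2)]]) simp
    also have "\<dots> = (\<Sum>j\<in>UNIV. pt (axis j 1) (f j x))"
    proof (rule sum.cong[OF refl])
      fix j
      have "f j x = scW (u $ j) w" using x fp by simp
      moreover have "pt (axis j 1) (scW (u $ j) w) = ?D (u $ j) (pt (axis j 1) w)"
        using right[of "axis j 1"] x(2) unfolding linear_map_def by blast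
      ultimately show "?D (u $ j) (pt (axis j 1) w) = pt (axis j 1) (f j x)" by simp
    qed
    finally show "x = (\<Sum>j\<in>UNIV. pt (axis j 1) (f j x))" using x by simp
  qed
  with lin fp show thesis by (rule that)
qed

lemma matrix_vector_mult_axis: "(A *v axis i 1) $ j = (A :: complex^2^2) $ j $ i"
  by (simp add: matrix_vector_mult_def axis_def if_distrib cong: if_cong)

text \<open>
  The two copies of \<open>W\<close> in the complexified \<open>g\<^sub>1\<close>, with inclusions \<open>P i\<close> and projections \<open>Q i\<close>: \<open>h\<close> acts on each
  copy, and \<open>q\<close> mixes the copies by the matrices \<open>\<phi> x\<close>.  All later arguments use \<open>W \<oplus> W\<close> in place of the
  tensor product.
\<close>

lemma odd_part_coordinates:
  fixes br :: "'g::real_vector \<Rightarrow> 'g \<Rightarrow> 'g" and scW :: "complex \<Rightarrow> 'w::ab_group_add \<Rightarrow> 'w"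
  assumes iso: "odd_part_iso br q h g1 scW W act"
    and lm: "lie_module cscale (h \<times> h) (cbracket br) scW W act"
    and q: "subspace q" and g1: "subspace g1"
    and qg1: "\<And>x y. x \<in> q \<Longrightarrow> y \<in> g1 \<Longrightarrow> br x y \<in> g1"
    and hg1: "\<And>x y. x \<in> h \<Longrightarrow> y \<in> g1 \<Longrightarrow> br x y \<in> g1"
  obtains \<phi> :: "'g \<times> 'g \<Rightarrow> complex^2^2" and P :: "2 \<Rightarrow> 'w \<Rightarrow> 'g \<times> 'g" and Q :: "2 \<Rightarrow> 'g \<times> 'g \<Rightarrow> 'w"
  where "lie_isomorphism cscale (q \<times> q) (cbracket br) matrix_scale sl_algebra commutator \<phi>"
    "\<And>i. linear_map scW W cscale (g1 \<times> g1) (P i)"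
    "\<And>i. linear_map cscale (g1 \<times> g1) scW W (Q i)"
    "\<And>i j w. w \<in> W \<Longrightarrow> Q j (P i w) = (if j = i then w else 0)"
    "\<And>z. z \<in> g1 \<times> g1 \<Longrightarrow> z = (\<Sum>i\<in>UNIV. P i (Q i z))"
    "\<And>i y w. y \<in> h \<times> h \<Longrightarrow> w \<in> W \<Longrightarrow> cbracket br y (P i w) = P i (act y w)"
    "\<And>i x w. x \<in> q \<times> q \<Longrightarrow> w \<in> W \<Longrightarrow>
      cbracket br x (P i w) = (\<Sum>j\<in>UNIV. P j (scW (\<phi> x $ j $ i) w))"
proof -
  let ?TP = "tensor_product (*s) (UNIV :: (complex^2) set) scW W"
  let ?pt = "pure_tensor (*s) (UNIV :: (complex^2) set) scW W"
  let ?D = "dual_scale :: complex \<Rightarrow> (((complex^2) \<times> 'w \<Rightarrow> complex) \<Rightarrow> complex) \<Rightarrow> _"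
  have vD: "vector_space ?D" by (rule vector_space_fun_scale) simp
  interpret D: vector_space ?D by (rule vD)
  interpret C: vector_space cscale by (rule vector_space_cscale)
  have W: "vspace scW W" and vh: "vspace cscale (h \<times> h)"
    and act: "bilinear_map cscale (h \<times> h) scW W scW W act"
    using lm by (auto simp: lie_module_def lie_algebra_def)
  have vW: "vector_space scW" and sW: "module.subspace scW W" using W by (auto simp: vspace_def)
  interpret W: vector_space scW by (rule vW)
  have vq: "vspace cscale (q \<times> q)" and vg1: "vspace cscale (g1 \<times> g1)"
    using q g1 by (auto intro: vspace_complexification)
  obtain \<phi> :: "'g \<times> 'g \<Rightarrow> complex^2^2" and \<Psi> where
    \<phi>: "lie_isomorphism cscale (q \<times> q) (cbracket br) matrix_scale sl_algebra commutator \<phi>"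
    and \<Psi>: "linear_map cscale (g1 \<times> g1) ?D ?TP \<Psi>" and bij: "bij_betw \<Psi> (g1 \<times> g1) ?TP"
    and eq: "\<And>x y z. x \<in> q \<times> q \<Longrightarrow> y \<in> h \<times> h \<Longrightarrow> z \<in> g1 \<times> g1 \<Longrightarrow>
      \<Psi> (cbracket br (x + y) z) = tensor_action (*s) UNIV scW W (\<lambda>u. \<phi> x *v u) (act y) (\<Psi> z)"
    using iso unfolding odd_part_iso_def by blast
  have \<phi>lin: "linear_map cscale (q \<times> q) matrix_scale sl_algebra \<phi>"
    using \<phi> by (simp add: lie_isomorphism_def)
  have \<phi>0: "\<phi> 0 = 0" by (rule linear_map_0[OF vq vector_space_matrix_scale \<phi>lin])
  have q0: "0 \<in> q \<times> q" and h0: "0 \<in> h \<times> h"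
    using vq vh by (auto simp: vspace_def C.subspace_0)
  obtain f :: "2 \<Rightarrow> _" where flin: "\<And>j. linear_map ?D ?TP scW W (f j)"
    and fp: "\<And>j u w. w \<in> W \<Longrightarrow> f j (?pt u w) = scW (u $ j) w"
    and fT: "\<And>T. T \<in> ?TP \<Longrightarrow> T = (\<Sum>j\<in>UNIV. ?pt (axis j 1) (f j T))"
    using tensor_coordinates[OF W] by blast
  have right: "linear_map scW W ?D ?TP (?pt u)" for u
    by (rule pure_tensor_linear_right[OF vspace_vec W]) simp
  have left: "linear_map (*s) UNIV ?D ?TP (\<lambda>u. ?pt u w)" if "w \<in> W" for w
    by (rule pure_tensor_linear_left[OF vspace_vec W that])
  define I where "I = inv_into (g1 \<times> g1) \<Psi>"
  have I: "linear_map ?D ?TP cscale (g1 \<times> g1) I"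
    unfolding I_def by (rule linear_map_inv_into[OF vg1 \<Psi> bij])
  have \<Psi>I: "\<Psi> (I T) = T" if "T \<in> ?TP" for T
    unfolding I_def using bij that by (auto simp: bij_betw_def f_inv_into_f)
  have I\<Psi>: "I (\<Psi> z) = z" if "z \<in> g1 \<times> g1" for z
    unfolding I_def using bij that by (auto simp: bij_betw_def)
  define P where "P i w = I (?pt (axis i 1) w)" for i w
  define Q where "Q j z = f j (\<Psi> z)" for j z
  have ptT: "?pt u w \<in> ?TP" if "w \<in> W" for u w using right that by (simp add: linear_map_def)
  have P: "linear_map scW W cscale (g1 \<times> g1) (P i)" for i
    using right I by (simp add: linear_map_def P_def)
  have Q: "linear_map cscale (g1 \<times> g1) scW W (Q i)" for i
    using flin \<Psi> by (simp add: linear_map_def Q_def)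
  have QP: "Q j (P i w) = (if j = i then w else 0)" if "w \<in> W" for i j w
    using that by (simp add: Q_def P_def \<Psi>I[OF ptT] fp axis_def)
  have Isum: "I (\<Sum>j\<in>UNIV. T j) = (\<Sum>j\<in>UNIV. I (T j))" if "\<And>j. T j \<in> ?TP" for T :: "2 \<Rightarrow> _"
    using that I by (simp add: sum_2 linear_map_def)
  have PQ: "z = (\<Sum>i\<in>UNIV. P i (Q i z))" if z: "z \<in> g1 \<times> g1" for z
  proof -
    have T: "\<Psi> z \<in> ?TP" using \<Psi> z unfolding linear_map_def by blast
    have "z = I (\<Psi> z)" using I\<Psi>[OF z] by simp
    also have "\<dots> = I (\<Sum>j\<in>UNIV. ?pt (axis j 1) (f j (\<Psi> z)))" using fT[OF T] by simp
    also have "\<dots> = (\<Sum>j\<in>UNIV. P j (Q j z))"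
      unfolding P_def Q_def by (rule Isum) (use flin T in \<open>auto intro!: ptT simp: linear_map_def\<close>)
    finally show ?thesis .
  qed
  have Pin: "P i w \<in> g1 \<times> g1" if "w \<in> W" for i w using P that by (simp add: linear_map_def)
  have act_lin: "linear_map scW W scW W (act y)" if "y \<in> h \<times> h" for y
    using act that unfolding bilinear_map_def by blast
  have mv: "linear_map (*s) UNIV (*s) UNIV (\<lambda>u. A *v u)" for A :: "complex^2^2"
    by (simp add: linear_map_def matrix_vector_right_distrib vector_scalar_commute)
  have cb: "cbracket br x z \<in> g1 \<times> g1" if "x \<in> q \<times> q \<or> x \<in> h \<times> h" "z \<in> g1 \<times> g1" for x z
    using that qg1 hg1 g1 by (auto simp: cbracket_def intro: subspace_add subspace_diff)
  have main: "\<Psi> (cbracket br (x + y) (P i w)) = ?pt (\<phi> x *v axis i 1) w + ?pt (axis i 1) (act y w)"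
    if "x \<in> q \<times> q" "y \<in> h \<times> h" "w \<in> W" for x y i w
  proof -
    have "\<Psi> (P i w) = ?pt (axis i 1) w" unfolding P_def by (rule \<Psi>I[OF ptT[OF that(3)]])
    then show ?thesis
      using eq[OF that(1,2) Pin[OF that(3)]]
        tensor_action_pure[OF mv act_lin[OF that(2)] _ that(3), of "axis i 1" "\<phi> x"] by simp
  qed
  have pt0: "?pt 0 w = 0" if "w \<in> W" for w
    by (rule linear_map_0[OF vspace_vec vD left[OF that]])
  have pt0': "?pt u 0 = 0" for u by (rule linear_map_0[OF W vD right])
  have actP: "cbracket br y (P i w) = P i (act y w)" if "y \<in> h \<times> h" "w \<in> W" for i y w
  proof -
    have "\<Psi> (cbracket br y (P i w)) = ?pt (axis i 1) (act y w)"
      using main[OF q0 that, of i] by (simp add: \<phi>0 pt0[OF that(2)])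
    moreover have "I (\<Psi> (cbracket br y (P i w))) = cbracket br y (P i w)"
      by (rule I\<Psi>[OF cb[OF disjI2[OF that(1)] Pin[OF that(2)]]])
    ultimately show ?thesis by (simp only: P_def)
  qed
  have act0: "act 0 w = 0" if "w \<in> W" for w
    using act that linear_map_0[OF vh vW, of W "\<lambda>y. act y w"] by (simp add: bilinear_map_def)
  have qP: "cbracket br x (P i w) = (\<Sum>j\<in>UNIV. P j (scW (\<phi> x $ j $ i) w))"
    if x: "x \<in> q \<times> q" and w: "w \<in> W" for i x w
  proof -
    have swW: "scW a w \<in> W" for a using w W.subspace_scale[OF sW] by simp
    have "\<Psi> (cbracket br x (P i w)) = ?pt (\<phi> x *v axis i 1) w"
      using main[OF x h0 w, of i] by (simp add: act0[OF w] pt0')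
    also have "\<dots> = (\<Sum>j\<in>UNIV. ?pt (axis j 1) (scW (\<phi> x $ j $ i) w))"
      using fT[OF ptT[OF w], of "\<phi> x *v axis i 1"] by (simp add: fp[OF w] matrix_vector_mult_axis)
    finally have "cbracket br x (P i w) = I (\<Sum>j\<in>UNIV. ?pt (axis j 1) (scW (\<phi> x $ j $ i) w))"
      using I\<Psi>[OF cb[OF disjI1[OF x] Pin[OF w, of i]]] by simp
    also have "\<dots> = (\<Sum>j\<in>UNIV. P j (scW (\<phi> x $ j $ i) w))"
      unfolding P_def by (rule Isum) (rule ptT[OF swW])
    finally show ?thesis .
  qed
  show thesis by (rule that[OF \<phi> P Q QP PQ actP qP])
qed

lemma findim_complexification:
  assumes V: "findim scaleR V"
  shows "findim cscale (V \<times> V)"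
proof -
  interpret C: vector_space cscale by (rule vector_space_cscale)
  obtain B where B: "finite B" "V = span B" using V by (auto simp: findim_def span_raw_def)
  have sV: "subspace V" using B by simp
  have 1: "(x, 0) \<in> C.span ((\<lambda>b. (b, 0)) ` B)" if "x \<in> span B" for x
    using that
  proof (induction rule: span_induct_alt)
    case base
    show ?case using C.span_zero by (simp add: zero_prod_def)
  next
    case (step c x y)
    have "(c *\<^sub>R x + y, 0) = cscale (of_real c) (x, 0) + (y, 0)" by (simp add: cscale_def)
    then show ?case using step by (simp only:) (rule C.span_add[OF C.span_scale[OF C.span_base]], auto)
  qed
  have "(x, y) \<in> C.span ((\<lambda>b. (b, 0)) ` B)" if "x \<in> V" "y \<in> V" for x y
  proof -
    have "(x, y) = (x, 0) + cscale \<i> (y, 0)" by (simp add: cscale_def)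
    also have "\<dots> \<in> C.span ((\<lambda>b. (b, 0)) ` B)" using that 1 B(2) by (intro C.span_add C.span_scale) auto
    finally show ?thesis .
  qed
  then have "V \<times> V \<subseteq> C.span ((\<lambda>b. (b, 0)) ` B)" by auto
  moreover have "C.span ((\<lambda>b. (b, 0)) ` B) \<subseteq> V \<times> V"
    by (rule C.span_minimal)
      (use B span_base vspace_complexification[OF sV] in \<open>auto simp: vspace_def subspace_0\<close>)
  ultimately have "V \<times> V = C.span ((\<lambda>b. (b, 0)) ` B)" by blast
  with B(1) show ?thesis unfolding findim_def by blast
qed

text \<open>
  An endomorphism that commutes with \<open>h\<close> complexifies to \<open>A \<otimes> 1\<close> on \<open>\<complex>\<^sup>2 \<otimes> W\<close> by Schur's lemma, and a
  \<open>2 \<times> 2\<close> matrix is a scalar plus an element of \<open>\<ss>\<ll>\<^sub>2\<close>.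
\<close>

lemma odd_part_endomorphisms:
  fixes br :: "'g::real_vector \<Rightarrow> 'g \<Rightarrow> 'g" and scW :: "complex \<Rightarrow> 'w::ab_group_add \<Rightarrow> 'w"
  assumes iso: "odd_part_iso br q h g1 scW W act"
    and irr: "irreducible_module cscale (h \<times> h) (cbracket br) scW W act"
    and fin: "findim scaleR g1"
    and q: "subspace q" and g1: "subspace g1"
    and qg1: "\<And>x. x \<in> q \<Longrightarrow> linear_map scaleR g1 scaleR g1 (br x)"
    and hg1: "\<And>x. x \<in> h \<Longrightarrow> linear_map scaleR g1 scaleR g1 (br x)"
    and br0: "\<And>y. y \<in> g1 \<Longrightarrow> br 0 y = 0"
  shows "\<And>f. linear_map scaleR g1 scaleR g1 f \<Longrightarrow>
      (\<And>x y. x \<in> h \<Longrightarrow> y \<in> g1 \<Longrightarrow> f (br x y) = br x (f y)) \<Longrightarrow>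
      \<exists>a. \<exists>x\<in>q. \<forall>y\<in>g1. f y = a *\<^sub>R y + br x y"
    and "\<And>a x. x \<in> q \<Longrightarrow> (\<And>y. y \<in> g1 \<Longrightarrow> a *\<^sub>R y + br x y = 0) \<Longrightarrow> a = 0 \<and> x = 0"
proof -
  have lm: "lie_module cscale (h \<times> h) (cbracket br) scW W act" and W0: "W \<noteq> {0}"
    using irr by (auto simp: irreducible_module_def)
  have W: "vspace scW W" and act: "bilinear_map cscale (h \<times> h) scW W scW W act"
    using lm by (auto simp: lie_module_def)
  have vW: "vector_space scW" and sW: "module.subspace scW W" using W by (auto simp: vspace_def)
  interpret W: vector_space scW by (rule vW)
  interpret C: vector_space cscale by (rule vector_space_cscale)
  have vg1: "vspace cscale (g1 \<times> g1)" and vq: "vspace cscale (q \<times> q)"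
    using g1 q by (auto intro: vspace_complexification)
  have sg1: "C.subspace (g1 \<times> g1)" using vg1 by (simp add: vspace_def)
  have brq: "br x y \<in> g1" if "x \<in> q" "y \<in> g1" for x y
    using qg1[OF that(1)] that(2) by (simp add: linear_map_def)
  have brh: "br x y \<in> g1" if "x \<in> h" "y \<in> g1" for x y
    using hg1[OF that(1)] that(2) by (simp add: linear_map_def)
  have clin: "linear_map cscale (g1 \<times> g1) cscale (g1 \<times> g1) (cbracket br x)"
    if "x \<in> q \<times> q \<or> x \<in> h \<times> h" for x
  proof -
    obtain a b where x: "x = (a, b)" by force
    have la: "linear_map scaleR g1 scaleR g1 (br a)" and lb: "linear_map scaleR g1 scaleR g1 (br b)"
      using that qg1 hg1 by (auto simp: x)
    have mem: "y + z \<in> g1" "y - z \<in> g1" "r *\<^sub>R y \<in> g1" if "y \<in> g1" "z \<in> g1" for y z r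
      using that g1 by (auto intro: subspace_add subspace_diff subspace_scale)
    have diff: "f (r *\<^sub>R y - s *\<^sub>R z) = r *\<^sub>R f y - s *\<^sub>R f z"
      if f: "linear_map scaleR g1 scaleR g1 f" and yz: "y \<in> g1" "z \<in> g1" for f y z r s
    proof -
      have "f (r *\<^sub>R y - s *\<^sub>R z + s *\<^sub>R z) = f (r *\<^sub>R y - s *\<^sub>R z) + f (s *\<^sub>R z)"
        using f mem yz unfolding linear_map_def by blast
      then show ?thesis using f yz by (simp add: linear_map_def)
    qed
    show ?thesis
      using la lb mem
      by (auto simp: x linear_map_def cbracket_def cscale_def diff[OF la] diff[OF lb] algebra_simps)
  qed
  obtain \<phi> :: "'g \<times> 'g \<Rightarrow> complex^2^2" and P Q where
    \<phi>: "lie_isomorphism cscale (q \<times> q) (cbracket br) matrix_scale sl_algebra commutator \<phi>"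
    and P: "\<And>i. linear_map scW W cscale (g1 \<times> g1) (P i)"
    and Q: "\<And>i::2. linear_map cscale (g1 \<times> g1) scW W (Q i)"
    and QP: "\<And>i j w. w \<in> W \<Longrightarrow> Q j (P i w) = (if j = i then w else 0)"
    and PQ: "\<And>z. z \<in> g1 \<times> g1 \<Longrightarrow> z = (\<Sum>i\<in>UNIV. P i (Q i z))"
    and hP: "\<And>i y w. y \<in> h \<times> h \<Longrightarrow> w \<in> W \<Longrightarrow> cbracket br y (P i w) = P i (act y w)"
    and qP: "\<And>i x w. x \<in> q \<times> q \<Longrightarrow> w \<in> W \<Longrightarrow>
      cbracket br x (P i w) = (\<Sum>j\<in>UNIV. P j (scW (\<phi> x $ j $ i) w))"
    using odd_part_coordinates[OF iso lm q g1 brq brh] by blast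
  have Pin: "P i w \<in> g1 \<times> g1" if "w \<in> W" for i w using P that by (simp add: linear_map_def)
  have Qin: "Q i z \<in> W" if "z \<in> g1 \<times> g1" for i z using Q that unfolding linear_map_def by blast
  have actin: "act y w \<in> W" if "y \<in> h \<times> h" "w \<in> W" for y w
    using act that unfolding bilinear_map_def linear_map_def by blast
  have finW: "findim scW W"
  proof (rule linear_image_findim[OF vg1 findim_complexification[OF fin] W Q])
    show "W \<subseteq> Q 1 ` (g1 \<times> g1)" using QP[of _ 1 1] Pin[of _ 1] by (metis image_eqI subsetI)
  qed
  have Qsum: "Q j (\<Sum>i\<in>UNIV. P i (w i)) = w j" if "\<And>i. w i \<in> W" for j w
  proof -
    have "Q j (\<Sum>i\<in>UNIV. P i (w i)) = (\<Sum>i\<in>UNIV. Q j (P i (w i)))"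
      using Q Pin[OF that] unfolding sum_2 linear_map_def by blast
    then show ?thesis by (simp add: QP that)
  qed
  have Qh: "Q j (cbracket br y z) = act y (Q j z)" if y: "y \<in> h \<times> h" and z: "z \<in> g1 \<times> g1" for j y z
  proof -
    have "cbracket br y z = cbracket br y (\<Sum>i\<in>UNIV. P i (Q i z))" using PQ[OF z] by simp
    also have "\<dots> = (\<Sum>i\<in>UNIV. cbracket br y (P i (Q i z)))"
      using clin[of y] y Pin[OF Qin[OF z]] unfolding sum_2 linear_map_def by blast
    also have "\<dots> = (\<Sum>i\<in>UNIV. P i (act y (Q i z)))" by (simp add: hP[OF y Qin[OF z]])
    finally show ?thesis using Qsum actin[OF y Qin[OF z]] by simp
  qed
  have \<phi>lin: "linear_map cscale (q \<times> q) matrix_scale sl_algebra \<phi>"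
    and \<phi>bij: "bij_betw \<phi> (q \<times> q) sl_algebra"
    using \<phi> by (auto simp: lie_isomorphism_def)
  show "\<exists>a. \<exists>x\<in>q. \<forall>y\<in>g1. f y = a *\<^sub>R y + br x y"
    if f: "linear_map scaleR g1 scaleR g1 f"
      and comm: "\<And>x y. x \<in> h \<Longrightarrow> y \<in> g1 \<Longrightarrow> f (br x y) = br x (f y)" for f
  proof -
    define F where "F z = (f (fst z), f (snd z))" for z
    have fin: "f y \<in> g1" if "y \<in> g1" for y using f that by (simp add: linear_map_def)
    have fdiff: "f (y - z) = f y - f z" if "y \<in> g1" "z \<in> g1" for y z
    proof -
      have "f (y - z + z) = f (y - z) + f z"
        using that g1 f subspace_diff unfolding linear_map_def by blast
      then show ?thesis by simp
    qed
    have F: "linear_map cscale (g1 \<times> g1) cscale (g1 \<times> g1) F"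
      using f fdiff g1 by (auto simp: linear_map_def F_def cscale_def subspace_scale)
    have Fin: "F z \<in> g1 \<times> g1" if "z \<in> g1 \<times> g1" for z using F that unfolding linear_map_def by blast
    have Fh: "F (cbracket br y z) = cbracket br y (F z)" if "y \<in> h \<times> h" "z \<in> g1 \<times> g1" for y z
      using that comm brh fdiff f by (auto simp: F_def cbracket_def linear_map_def)
    have scalar: "\<exists>a. \<forall>w\<in>W. Q j (F (P i w)) = scW a w" for i j
    proof (rule schur[OF irr finW])
      show "linear_map scW W scW W (\<lambda>w. Q j (F (P i w)))"
        by (rule linear_map_compose[OF linear_map_compose[OF P F] Q])
      show "Q j (F (P i (act y w))) = act y (Q j (F (P i w)))" if "y \<in> h \<times> h" "w \<in> W" for y w
        unfolding hP[OF that, symmetric] Fh[OF that(1) Pin[OF that(2)]]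
        by (rule Qh[OF that(1) Fin[OF Pin[OF that(2)]]])
    qed
    define A where "A i j = (SOME a. \<forall>w\<in>W. Q j (F (P i w)) = scW a w)" for i j
    have A: "Q j (F (P i w)) = scW (A i j) w" if "w \<in> W" for i j w
      using someI_ex[OF scalar[of j i], folded A_def] that by blast
    \<comment> \<open>\<open>F\<close> acts as the matrix of scalars \<open>A\<close>, whose traceless part is the image of some \<open>x\<close> in the
      complexified \<open>q\<close>; since \<open>F\<close> is the extension of a real map, the real parts of \<open>\<tau>\<close> and \<open>x\<close>
      already describe it on \<open>g\<^sub>1\<close>\<close>
    define \<tau> where "\<tau> = (A 1 1 + A 2 2) / 2"
    define M :: "complex^2^2" where "M = (\<chi> j i. A i j - (if j = i then \<tau> else 0))"
    have "M \<in> sl_algebra" by (simp add: sl_algebra_def trace_def sum_2 M_def \<tau>_def)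
    then have "M \<in> \<phi> ` (q \<times> q)" using \<phi>bij by (simp only: bij_betw_def)
    then obtain x where x: "x \<in> q \<times> q" "\<phi> x = M" by (elim imageE) (rule that, simp_all only:)
    have FP: "F (P i w) = cscale \<tau> (P i w) + cbracket br x (P i w)" if w: "w \<in> W" for i w
    proof -
      have sw: "scW a w \<in> W" for a using W.subspace_scale[OF sW w] .
      have "cscale \<tau> (P i w) = P i (scW \<tau> w)" using P[of i] w by (simp add: linear_map_def)
      also have "\<dots> = (\<Sum>j\<in>UNIV. P j (scW (if j = i then \<tau> else 0) w))"
      proof -
        have "P j 0 = 0" for j by (rule linear_map_0[OF W vector_space_cscale P])
        then show ?thesis by (simp add: if_distrib[of "\<lambda>a. P _ (scW a w)"] cong: if_cong)
      qed
      finally have "cscale \<tau> (P i w) + cbracket br x (P i w) =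
          (\<Sum>j\<in>UNIV. P j (scW (if j = i then \<tau> else 0) w) + P j (scW (M $ j $ i) w))"
        by (simp add: qP[OF x(1) w] x(2) sum.distrib)
      also have "\<dots> = (\<Sum>j\<in>UNIV. P j (scW (A i j) w))"
      proof (rule sum.cong[OF refl])
        fix j
        have "P j (scW (if j = i then \<tau> else 0) w) + P j (scW (M $ j $ i) w) =
          P j (scW (if j = i then \<tau> else 0) w + scW (M $ j $ i) w)"
          using P[of j] sw unfolding linear_map_def by metis
        also have "\<dots> = P j (scW (A i j) w)" by (simp add: M_def flip: W.scale_left_distrib)
        finally show "P j (scW (if j = i then \<tau> else 0) w) + P j (scW (M $ j $ i) w) = P j (scW (A i j) w)" .
      qed
      also have "\<dots> = (\<Sum>j\<in>UNIV. P j (Q j (F (P i w))))" by (simp add: A[OF w])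
      also have "\<dots> = F (P i w)" using PQ[OF Fin[OF Pin[OF w]]] by simp
      finally show ?thesis by simp
    qed
    have Fz: "F z = cscale \<tau> z + cbracket br x z" if z: "z \<in> g1 \<times> g1" for z
    proof -
      have zz: "z = P 1 (Q 1 z) + P 2 (Q 2 z)" using PQ[OF z] by (simp add: sum_2)
      have in1: "P 1 (Q 1 z) \<in> g1 \<times> g1" "P 2 (Q 2 z) \<in> g1 \<times> g1" using Pin Qin[OF z] by auto
      have "F z = F (P 1 (Q 1 z)) + F (P 2 (Q 2 z))"
        using F in1 unfolding linear_map_def by (metis zz)
      also have "\<dots> = cscale \<tau> (P 1 (Q 1 z) + P 2 (Q 2 z)) +
          (cbracket br x (P 1 (Q 1 z)) + cbracket br x (P 2 (Q 2 z)))"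
        by (simp add: FP[OF Qin[OF z]] C.scale_right_distrib)
      also have "cbracket br x (P 1 (Q 1 z)) + cbracket br x (P 2 (Q 2 z)) = cbracket br x z"
        using clin[of x] x(1) in1 zz unfolding linear_map_def by metis
      finally show ?thesis using zz by simp
    qed
    obtain x1 x2 where x12: "x = (x1, x2)" "x1 \<in> q" "x2 \<in> q" using x(1) by auto
    have "f y = Re \<tau> *\<^sub>R y + br x1 y" if y: "y \<in> g1" for y
    proof -
      have z: "br x2 0 = 0"
        by (rule linear_map_0[OF _ _ qg1[OF x12(3)]]) (auto simp: g1 real_vector.vector_space_axioms)
      have "fst (F (y, 0)) = fst (cscale \<tau> (y, 0) + cbracket br x (y, 0))"
        using Fz[of "(y, 0)"] y g1 by (simp add: subspace_0)
      then show ?thesis by (simp add: F_def cscale_def cbracket_def x12(1) z)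
    qed
    with x12 show ?thesis by blast
  qed
  show "a = 0 \<and> x = 0" if x: "x \<in> q" and zero: "\<And>y. y \<in> g1 \<Longrightarrow> a *\<^sub>R y + br x y = 0" for a x
  proof -
    have x0: "(x, 0) \<in> q \<times> q" using x q by (simp add: subspace_0)
    obtain w where w: "w \<in> W" "w \<noteq> 0" using W0 W.subspace_0[OF sW] by auto
    have cz: "cscale (of_real a) z + cbracket br (x, 0) z = 0" if "z \<in> g1 \<times> g1" for z
      using that zero by (cases z) (auto simp: cscale_def cbracket_def br0 zero_prod_def)
    have ent: "(if j = i then of_real a else 0) + \<phi> (x, 0) $ j $ i = 0" for i j
    proof -
      have in1: "(\<Sum>j\<in>UNIV. P j (scW (\<phi> (x, 0) $ j $ i) w)) \<in> g1 \<times> g1"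
        by (rule C.subspace_sum[OF sg1]) (rule Pin[OF W.subspace_scale[OF sW w(1)]])
      have in2: "cscale (of_real a) (P i w) \<in> g1 \<times> g1"
        using C.subspace_scale[OF sg1 Pin[OF w(1)]] .
      have "cscale (of_real a) (P i w) + (\<Sum>j\<in>UNIV. P j (scW (\<phi> (x, 0) $ j $ i) w)) = 0"
        using cz[OF Pin[OF w(1)], of i] by (simp only: qP[OF x0 w(1)])
      then have "0 = Q j (cscale (of_real a) (P i w) + (\<Sum>j\<in>UNIV. P j (scW (\<phi> (x, 0) $ j $ i) w)))"
        using linear_map_0[OF vg1 vW Q, of j] by (simp only:)
      also have "\<dots> = Q j (cscale (of_real a) (P i w)) + Q j (\<Sum>j\<in>UNIV. P j (scW (\<phi> (x, 0) $ j $ i) w))"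
        by (rule linear_map_plus[OF Q in2 in1])
      also have "Q j (cscale (of_real a) (P i w)) = scW (of_real a) (Q j (P i w))"
        by (rule linear_map_scale[OF Q Pin[OF w(1)]])
      also have "\<dots> = scW (if j = i then of_real a else 0) w" by (simp add: QP w)
      also have "Q j (\<Sum>j\<in>UNIV. P j (scW (\<phi> (x, 0) $ j $ i) w)) = scW (\<phi> (x, 0) $ j $ i) w"
        by (rule Qsum) (rule W.subspace_scale[OF sW w(1)])
      finally have "scW ((if j = i then of_real a else 0) + \<phi> (x, 0) $ j $ i) w = 0"
        by (simp add: W.scale_left_distrib)
      then show ?thesis using w(2) by simp
    qed
    have "trace (\<phi> (x, 0)) = 0" using \<phi>lin x0 by (simp add: linear_map_def sl_algebra_def)
    then have "of_real a = (0::complex)"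
      using ent[of 1 1] ent[of 2 2] by (simp add: trace_def sum_2 add_eq_0_iff)
    then have a: "a = 0" by simp
    have "\<phi> (x, 0) $ j $ i = 0" for i j
      using ent[of j i] ent[of i j] a by (simp split: if_splits)
    then have "\<phi> (x, 0) = 0" by (simp add: vec_eq_iff)
    moreover have "\<phi> (0, 0) = 0"
      using linear_map_0[OF vq vector_space_matrix_scale \<phi>lin] by (simp add: zero_prod_def)
    moreover have "(0, 0) \<in> q \<times> q" using q by (simp add: subspace_0)
    moreover have "inj_on \<phi> (q \<times> q)" using \<phi>bij by (simp add: bij_betw_def)
    ultimately have "(x, 0) = (0, 0 :: 'g)" using x0 inj_onD[of \<phi> "q \<times> q"] by metis
    with a show ?thesis by simp
  qed
qed

section \<open>Invariant linear and trilinear forms on the odd part\<close>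

lemma odd_part_spanned_by_odd_vectors:
  fixes br :: "'g::real_vector \<Rightarrow> 'g \<Rightarrow> 'g" and scW :: "complex \<Rightarrow> 'w::ab_group_add \<Rightarrow> 'w"
  assumes iso: "odd_part_iso br q h g1 scW W act"
    and hw: "highest_weight_module X m cscale (h \<times> h) (cbracket br) scW W act"
    and S: "S \<subseteq> {1..dynkin_rank X}"
      "\<And>j. j \<in> {1..dynkin_rank X} \<Longrightarrow> even (\<Sum>i\<in>S. cartan_matrix X j i)" "odd (\<Sum>i\<in>S. m i)"
    and q: "subspace q" and g1: "subspace g1"
    and brq: "\<And>x y. x \<in> q \<Longrightarrow> y \<in> g1 \<Longrightarrow> br x y \<in> g1"
    and brh: "\<And>x y. x \<in> h \<Longrightarrow> y \<in> g1 \<Longrightarrow> br x y \<in> g1"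
  shows "\<exists>c\<in>h \<times> h. g1 \<times> g1 \<subseteq>
    module.span cscale {z \<in> g1 \<times> g1. \<exists>k::int. cbracket br c z = cscale (of_int (2 * k + 1)) z}"
proof -
  have lm: "lie_module cscale (h \<times> h) (cbracket br) scW W act"
    using hw by (auto simp: highest_weight_module_def irreducible_module_def)
  have W: "vspace scW W" using lm by (auto simp: lie_module_def)
  then have vW: "vector_space scW" by (auto simp: vspace_def)
  interpret W: vector_space scW by (rule vW)
  interpret C: vector_space cscale by (rule vector_space_cscale)
  obtain c where c: "c \<in> h \<times> h"
    and spW: "W.span {w \<in> W. \<exists>k::int. act c w = scW (of_int (2 * k + 1)) w} = W"
    using odd_coweight_exists[OF hw S] by blast
  obtain P Q where P: "\<And>i. linear_map scW W cscale (g1 \<times> g1) (P i)"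
    and Q: "\<And>i::2. linear_map cscale (g1 \<times> g1) scW W (Q i)"
    and PQ: "\<And>z. z \<in> g1 \<times> g1 \<Longrightarrow> z = (\<Sum>i\<in>UNIV. P i (Q i z))"
    and hP: "\<And>i y w. y \<in> h \<times> h \<Longrightarrow> w \<in> W \<Longrightarrow> cbracket br y (P i w) = P i (act y w)"
    by (rule odd_part_coordinates[OF iso lm q g1 brq brh]) blast+
  let ?OW = "{w \<in> W. \<exists>k::int. act c w = scW (of_int (2 * k + 1)) w}"
  let ?O = "{z \<in> g1 \<times> g1. \<exists>k::int. cbracket br c z = cscale (of_int (2 * k + 1)) z}"
  have "w \<in> W \<and> P i w \<in> C.span ?O" if "w \<in> W" for i w
  proof -
    have "w \<in> W.span ?OW" using that spW by simp
    then show ?thesis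
    proof (induction rule: W.span_induct_alt)
      case base
      have "P i 0 = 0" by (rule linear_map_0[OF W vector_space_cscale P])
      moreover have "0 \<in> W" using W by (simp add: vspace_def W.subspace_0)
      ultimately show ?case using C.span_zero by simp
    next
      case (step r x y)
      then obtain k :: int where x: "x \<in> W" and k: "act c x = scW (of_int (2 * k + 1)) x" by auto
      have "cbracket br c (P i x) = cscale (of_int (2 * k + 1)) (P i x)"
        unfolding hP[OF c x] k by (rule linear_map_scale[OF P x])
      then have Px: "P i x \<in> ?O" using linear_map_mem[OF P x, of i] by blast
      have rx: "scW r x \<in> W" using W x by (simp add: vspace_def W.subspace_scale)
      have "P i (scW r x + y) = cscale r (P i x) + P i y"
        using linear_map_plus[OF P rx, of y i] step(2) linear_map_scale[OF P x] by simp
      then have "P i (scW r x + y) \<in> C.span ?O"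
        using C.span_add[OF C.span_scale[OF C.span_base[OF Px]]] step(2) by simp
      moreover have "scW r x + y \<in> W" using W rx step(2) by (simp add: vspace_def W.subspace_add)
      ultimately show ?case by blast
    qed
  qed
  then have *: "P i (Q i z) \<in> C.span ?O" if "z \<in> g1 \<times> g1" for i z
    using linear_map_mem[OF Q that] by blast
  have "z \<in> C.span ?O" if z: "z \<in> g1 \<times> g1" for z
  proof -
    have "(\<Sum>i\<in>UNIV. P i (Q i z)) \<in> C.span ?O" by (rule C.span_sum) (rule *[OF z])
    then show ?thesis using PQ[OF z] by (simp only:)
  qed
  with c show ?thesis by (intro bexI[of _ c] subsetI)
qed

text \<open>Complex-linear extension of real-linear maps, one variable at a time.\<close>

definition complexify :: "('g \<Rightarrow> complex) \<Rightarrow> 'g \<times> 'g \<Rightarrow> complex" where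
  "complexify f z = f (fst z) + \<i> * f (snd z)"

lemma linear_map_complexify:
  fixes f :: "'g::real_vector \<Rightarrow> complex"
  assumes f: "linear_map scaleR V scaleR UNIV f" and V: "subspace V"
  shows "linear_map cscale (V \<times> V) (*) UNIV (complexify f)"
proof -
  have diff: "f (r *\<^sub>R x - s *\<^sub>R y) = r *\<^sub>R f x - s *\<^sub>R f y" if "x \<in> V" "y \<in> V" for x y r s
  proof -
    have "f (r *\<^sub>R x - s *\<^sub>R y + s *\<^sub>R y) = f (r *\<^sub>R x - s *\<^sub>R y) + f (s *\<^sub>R y)"
      using that V by (intro linear_map_plus[OF f] subspace_diff subspace_scale)
    then show ?thesis using linear_map_scale[OF f] that by simp
  qed
  show ?thesis
    using V
    by (auto simp: linear_map_def complexify_def cscale_def subspace_scale subspace_add diff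
        linear_map_plus[OF f] linear_map_scale[OF f] complex_eq_iff algebra_simps)
qed

text \<open>
  An invariant form pairs eigenvectors to zero unless the eigenvalues add up to zero; a sum of
  one or three odd integers does not vanish.
\<close>

lemma invariant_functional_vanishes:
  fixes f :: "'g::real_vector \<Rightarrow> real"
  assumes V: "subspace V" and c: "c \<in> h \<times> h"
    and span: "V \<times> V \<subseteq>
      module.span cscale {z \<in> V \<times> V. \<exists>k::int. cbracket br c z = cscale (of_int (2 * k + 1)) z}"
    and f: "linear_map scaleR V (*) UNIV f"
    and inv: "\<And>x y. x \<in> h \<Longrightarrow> y \<in> V \<Longrightarrow> f (br x y) = 0"
    and h: "\<And>x y. x \<in> h \<Longrightarrow> y \<in> V \<Longrightarrow> br x y \<in> V"
    and v: "v \<in> V"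
  shows "f v = 0"
proof -
  interpret C: vector_space cscale by (rule vector_space_cscale)
  let ?O = "{z \<in> V \<times> V. \<exists>k::int. cbracket br c z = cscale (of_int (2 * k + 1)) z}"
  let ?L = "complexify (\<lambda>v. of_real (f v))"
  have sV: "C.subspace (V \<times> V)" using vspace_complexification[OF V] by (simp add: vspace_def)
  have "linear_map scaleR V scaleR UNIV (\<lambda>v. complex_of_real (f v))"
    using f by (simp add: linear_map_def scaleR_conv_of_real)
  then have L: "linear_map cscale (V \<times> V) (*) UNIV ?L" by (rule linear_map_complexify[OF _ V])
  have diff: "f (x - y) = f x - f y" if "x \<in> V" "y \<in> V" for x y
    using linear_map_plus[OF f, of "x - y" y] that V subspace_diff by fastforce
  have zero: "?L z = 0" if z: "z \<in> ?O" for z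
  proof -
    obtain k :: int where zV: "z \<in> V \<times> V" and k: "cbracket br c z = cscale (of_int (2 * k + 1)) z"
      using z by auto
    have "?L (cbracket br c z) = 0"
      using c zV inv h V by (auto simp: complexify_def cbracket_def diff linear_map_plus[OF f])
    then have "of_int (2 * k + 1) * ?L z = 0" using k linear_map_scale[OF L zV] by simp
    moreover have "2 * k + 1 \<noteq> 0" by presburger
    ultimately show ?thesis by (metis mult_eq_0_iff of_int_eq_0_iff)
  qed
  have "?L (v, 0) = 0"
    by (rule linear_map_vanishes[OF vector_space_cscale sV L _ span zero])
      (use v V in \<open>auto simp: subspace_0\<close>)
  then show ?thesis by (simp add: complexify_def complex_eq_iff)
qed

definition trilinear_on :: "'g::real_vector set \<Rightarrow> ('g \<Rightarrow> 'g \<Rightarrow> 'g \<Rightarrow> real) \<Rightarrow> bool" where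
  "trilinear_on V T \<longleftrightarrow> (\<forall>x\<in>V. \<forall>y\<in>V.
     linear_map scaleR V (*) UNIV (\<lambda>z. T z x y) \<and>
     linear_map scaleR V (*) UNIV (\<lambda>z. T x z y) \<and>
     linear_map scaleR V (*) UNIV (\<lambda>z. T x y z))"

definition invariant_trilinear ::
    "'g::real_vector set \<Rightarrow> ('g \<Rightarrow> 'g \<Rightarrow> 'g) \<Rightarrow> 'g set \<Rightarrow> ('g \<Rightarrow> 'g \<Rightarrow> 'g \<Rightarrow> real) \<Rightarrow> bool" where
  "invariant_trilinear h br V T \<longleftrightarrow> trilinear_on V T \<and>
     (\<forall>a\<in>h. \<forall>x\<in>V. \<forall>y\<in>V. \<forall>z\<in>V. T (br a x) y z + T x (br a y) z + T x y (br a z) = 0)"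

lemma invariant_trilinear_vanishes:
  fixes T :: "'g::real_vector \<Rightarrow> 'g \<Rightarrow> 'g \<Rightarrow> real"
  assumes V: "subspace V" and c: "c \<in> h \<times> h"
    and span: "V \<times> V \<subseteq>
      module.span cscale {z \<in> V \<times> V. \<exists>k::int. cbracket br c z = cscale (of_int (2 * k + 1)) z}"
    and T: "invariant_trilinear h br V T"
    and h: "\<And>x y. x \<in> h \<Longrightarrow> y \<in> V \<Longrightarrow> br x y \<in> V"
    and xyz: "x \<in> V" "y \<in> V" "z \<in> V"
  shows "T x y z = 0"
proof -
  interpret C: vector_space cscale by (rule vector_space_cscale)
  let ?O = "{z \<in> V \<times> V. \<exists>k::int. cbracket br c z = cscale (of_int (2 * k + 1)) z}"
  define F where "F z1 z2 z3 = complexify (\<lambda>x1. complexify (\<lambda>x2. complexify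
    (\<lambda>x3. complex_of_real (T x1 x2 x3)) z3) z2) z1" for z1 z2 z3
  have sV: "C.subspace (V \<times> V)" using vspace_complexification[OF V] by (simp add: vspace_def)
  have T1: "linear_map scaleR V (*) UNIV (\<lambda>z. T z x y)"
    and T2: "linear_map scaleR V (*) UNIV (\<lambda>z. T x z y)"
    and T3: "linear_map scaleR V (*) UNIV (\<lambda>z. T x y z)" if "x \<in> V" "y \<in> V" for x y
    using T that by (auto simp: invariant_trilinear_def trilinear_on_def)
  have real: "linear_map scaleR V scaleR UNIV (\<lambda>z. complex_of_real (f z))"
    if "linear_map scaleR V (*) UNIV f" for f
    using that by (simp add: linear_map_def scaleR_conv_of_real)
  have comb: "linear_map scaleR V scaleR UNIV (\<lambda>z. f z + \<i> * g z)"
    if "linear_map scaleR V scaleR UNIV f" "linear_map scaleR V scaleR UNIV g" for f g :: "'g \<Rightarrow> complex"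
    using that by (simp add: linear_map_def algebra_simps)
  have F1: "linear_map cscale (V \<times> V) (*) UNIV (\<lambda>z1. F z1 z2 z3)"
    if "z2 \<in> V \<times> V" "z3 \<in> V \<times> V" for z2 z3
    unfolding F_def
    by (rule linear_map_complexify[OF _ V], unfold complexify_def)
      (use that in \<open>auto intro!: comb real T1\<close>)
  have swap12: "F z1 z2 z3 = complexify (\<lambda>x2. complexify (\<lambda>x1. complexify
    (\<lambda>x3. complex_of_real (T x1 x2 x3)) z3) z1) z2" for z1 z2 z3
    by (simp add: F_def complexify_def algebra_simps)
  have swap13: "F z1 z2 z3 = complexify (\<lambda>x3. complexify (\<lambda>x2. complexify
    (\<lambda>x1. complex_of_real (T x1 x2 x3)) z1) z2) z3" for z1 z2 z3
    by (simp add: F_def complexify_def algebra_simps)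
  have F2: "linear_map cscale (V \<times> V) (*) UNIV (\<lambda>z2. F z1 z2 z3)"
    if "z1 \<in> V \<times> V" "z3 \<in> V \<times> V" for z1 z3
    unfolding swap12
    by (rule linear_map_complexify[OF _ V], unfold complexify_def)
      (use that in \<open>auto intro!: comb real T2\<close>)
  have F3: "linear_map cscale (V \<times> V) (*) UNIV (\<lambda>z3. F z1 z2 z3)"
    if "z1 \<in> V \<times> V" "z2 \<in> V \<times> V" for z1 z2
    unfolding swap13
    by (rule linear_map_complexify[OF _ V], unfold complexify_def)
      (use that in \<open>auto intro!: comb real T3\<close>)
  have inv: "F (cbracket br c z1) z2 z3 + F z1 (cbracket br c z2) z3 + F z1 z2 (cbracket br c z3) = 0"
    if z: "z1 \<in> V \<times> V" "z2 \<in> V \<times> V" "z3 \<in> V \<times> V" for z1 z2 z3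
  proof -
    obtain c1 c2 where c12: "c = (c1, c2)" "c1 \<in> h" "c2 \<in> h" using c by auto
    have T0: "T x y (br a z) = - T (br a x) y z - T x (br a y) z"
      if "a \<in> h" "x \<in> V" "y \<in> V" "z \<in> V" for a x y z
    proof -
      have "T (br a x) y z + T x (br a y) z + T x y (br a z) = 0"
        using T that unfolding invariant_trilinear_def by blast
      then show ?thesis by linarith
    qed
    have diff: "f (u - v) = f u - f v" if "linear_map scaleR V (*) UNIV f" "u \<in> V" "v \<in> V"
      for f :: "'g \<Rightarrow> real" and u v
      using linear_map_plus[OF that(1), of "u - v" v] that V subspace_diff by fastforce
    obtain u u' v v' w w' where zs: "z1 = (u, u')" "z2 = (v, v')" "z3 = (w, w')"
      and mem: "u \<in> V" "u' \<in> V" "v \<in> V" "v' \<in> V" "w \<in> V" "w' \<in> V"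
      using z by auto
    note dp = diff[OF T1] diff[OF T2] diff[OF T3]
      linear_map_plus[OF T1] linear_map_plus[OF T2] linear_map_plus[OF T3]
    show ?thesis
      using c12(2,3) mem h
      by (simp add: F_def complexify_def zs c12(1) cbracket_def dp T0 complex_eq_iff)
  qed
  have zero: "F z1 z2 z3 = 0" if z: "z1 \<in> ?O" "z2 \<in> ?O" "z3 \<in> ?O" for z1 z2 z3
  proof -
    obtain k1 k2 k3 :: int where k: "cbracket br c z1 = cscale (of_int (2 * k1 + 1)) z1"
      "cbracket br c z2 = cscale (of_int (2 * k2 + 1)) z2"
      "cbracket br c z3 = cscale (of_int (2 * k3 + 1)) z3"
      and zV: "z1 \<in> V \<times> V" "z2 \<in> V \<times> V" "z3 \<in> V \<times> V"
      using z by blast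
    have "of_int (2 * k1 + 1) * F z1 z2 z3 + of_int (2 * k2 + 1) * F z1 z2 z3 +
        of_int (2 * k3 + 1) * F z1 z2 z3 = 0"
      using inv[OF zV] linear_map_scale[OF F1[OF zV(2,3)] zV(1)]
        linear_map_scale[OF F2[OF zV(1,3)] zV(2)] linear_map_scale[OF F3[OF zV(1,2)] zV(3)]
      unfolding k by simp
    then have "of_int ((2 * k1 + 1) + (2 * k2 + 1) + (2 * k3 + 1)) * F z1 z2 z3 = 0"
      by (simp only: of_int_add distrib_right)
    moreover have "(2 * k1 + 1) + (2 * k2 + 1) + (2 * k3 + 1) \<noteq> 0" by presburger
    ultimately show ?thesis by (metis mult_eq_0_iff of_int_eq_0_iff)
  qed
  have ext: "L z = 0" if "linear_map cscale (V \<times> V) (*) UNIV L" "\<And>z. z \<in> ?O \<Longrightarrow> L z = 0" "z \<in> V \<times> V"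
    for L :: "'g \<times> 'g \<Rightarrow> complex" and z
    by (rule linear_map_vanishes[OF vector_space_cscale sV that(1) _ span that(2,3)]) blast
  have OV: "z \<in> V \<times> V" if "z \<in> ?O" for z using that by blast
  have 1: "F z1 z2 z3 = 0" if "z1 \<in> V \<times> V" "z2 \<in> ?O" "z3 \<in> ?O" for z1 z2 z3
    using ext[OF F1[OF OV[OF that(2)] OV[OF that(3)]] zero[OF _ that(2,3)] that(1)] .
  have 2: "F z1 z2 z3 = 0" if "z1 \<in> V \<times> V" "z2 \<in> V \<times> V" "z3 \<in> ?O" for z1 z2 z3
    using ext[OF F2[OF that(1) OV[OF that(3)]] 1[OF that(1) _ that(3)] that(2)] .
  have 3: "F z1 z2 z3 = 0" if "z1 \<in> V \<times> V" "z2 \<in> V \<times> V" "z3 \<in> V \<times> V" for z1 z2 z3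
    using ext[OF F3[OF that(1,2)] 2[OF that(1,2)] that(3)] .
  have 0: "0 \<in> V" using V by (rule subspace_0)
  have z0: "T x y 0 = 0" "T x 0 z = 0" "T 0 y z = 0" if "x \<in> V" "y \<in> V" "z \<in> V" for x y z
    using that linear_map_0[OF _ vector_space_mult T1, of y z]
      linear_map_0[OF _ vector_space_mult T2, of x z] linear_map_0[OF _ vector_space_mult T3, of x y] V
    by auto
  show ?thesis
    using 3[of "(x, 0)" "(y, 0)" "(z, 0)"] xyz 0
    by (simp add: F_def complexify_def z0)
qed

section \<open>Invariant trilinear forms on the isotropy module\<close>

abbreviation (input) N3 :: "nat set" where "N3 \<equiv> {1, 2, 3}"
abbreviation (input) N4 :: "nat set" where "N4 \<equiv> {0, 1, 2, 3}"

definition bilinear_on :: "'g::real_vector set \<Rightarrow> ('g \<Rightarrow> 'g \<Rightarrow> real) \<Rightarrow> bool" where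
  "bilinear_on V B \<longleftrightarrow> (\<forall>x\<in>V. linear_map scaleR V (*) UNIV (\<lambda>y. B y x) \<and>
     linear_map scaleR V (*) UNIV (\<lambda>y. B x y))"

definition invariant_bilinear ::
    "'g::real_vector set \<Rightarrow> ('g \<Rightarrow> 'g \<Rightarrow> 'g) \<Rightarrow> 'g set \<Rightarrow> ('g \<Rightarrow> 'g \<Rightarrow> real) \<Rightarrow> bool" where
  "invariant_bilinear h br V B \<longleftrightarrow> bilinear_on V B \<and>
     (\<forall>a\<in>h. \<forall>x\<in>V. \<forall>y\<in>V. B (br a x) y + B x (br a y) = 0)"

lemma invariant_trilinear_combination:
  assumes "invariant_trilinear h br V T" "invariant_trilinear h br V T'"
  shows "invariant_trilinear h br V (\<lambda>x y z. T x y z + r * T' x y z)"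
proof -
  have 1: "linear_map scaleR V (*) UNIV (\<lambda>z. f z + r * g z)"
    if "linear_map scaleR V (*) UNIV f" "linear_map scaleR V (*) UNIV g" for f g :: "'a \<Rightarrow> real"
    using that by (simp add: linear_map_def algebra_simps)
  have "(T (br a x) y z + r * T' (br a x) y z) + (T x (br a y) z + r * T' x (br a y) z) +
      (T x y (br a z) + r * T' x y (br a z)) = 0"
    if "a \<in> h" "x \<in> V" "y \<in> V" "z \<in> V" for a x y z
  proof -
    have "T (br a x) y z + T x (br a y) z + T x y (br a z) = 0"
      "T' (br a x) y z + T' x (br a y) z + T' x y (br a z) = 0"
      using assms that unfolding invariant_trilinear_def by auto
    moreover have "(T (br a x) y z + r * T' (br a x) y z) + (T x (br a y) z + r * T' x (br a y) z) +
      (T x y (br a z) + r * T' x y (br a z)) =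
      (T (br a x) y z + T x (br a y) z + T x y (br a z)) +
      r * (T' (br a x) y z + T' x (br a y) z + T' x y (br a z))" by (simp add: algebra_simps)
    ultimately show ?thesis by simp
  qed
  then show ?thesis
    using assms 1 unfolding invariant_trilinear_def trilinear_on_def by auto
qed

lemma invariant_trilinear_permute:
  assumes "invariant_trilinear h br V T"
  shows "invariant_trilinear h br V (\<lambda>x y z. T y x z)"
    and "invariant_trilinear h br V (\<lambda>x y z. T z x y)"
  using assms unfolding invariant_trilinear_def trilinear_on_def
  by (auto simp: add_ac)

lemma sum_N3: "sum f N3 = f 1 + f 2 + f (3::nat)"
  and sum_N4: "sum f N4 = f 0 + f 1 + f 2 + f (3::nat)"
  for f :: "nat \<Rightarrow> real"
  by simp_all

text \<open>
  The isotropy module \<open>m\<close> is the sum of a trivial module with basis \<open>e\<^sub>1, e\<^sub>2, e\<^sub>3\<close> and a module \<open>V\<close>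
  without nonzero invariant linear or trilinear forms, whose invariant bilinear forms have
  a basis of one inner product \<open>\<omega>\<^sub>0\<close> and three alternating forms \<open>\<omega>\<^sub>1, \<omega>\<^sub>2, \<omega>\<^sub>3\<close>.  This is all that the
  dimensions depend on.
\<close>

locale isotropy_module =
  fixes h :: "'g::real_vector set" and br :: "'g \<Rightarrow> 'g \<Rightarrow> 'g" and m V :: "'g set"
    and e :: "nat \<Rightarrow> 'g" and co :: "nat \<Rightarrow> 'g \<Rightarrow> real" and pr :: "'g \<Rightarrow> 'g"
    and \<omega> :: "nat \<Rightarrow> 'g \<Rightarrow> 'g \<Rightarrow> real"
  assumes m: "subspace m" "findim scaleR m"
    and V: "subspace V" "V \<subseteq> m"
    and e: "\<And>i. i \<in> N3 \<Longrightarrow> e i \<in> m"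
    and co: "\<And>i. i \<in> N3 \<Longrightarrow> linear_map scaleR m (*) UNIV (co i)"
    and pr: "linear_map scaleR m scaleR V pr"
    and decomp: "\<And>x. x \<in> m \<Longrightarrow> x = (\<Sum>i\<in>N3. co i x *\<^sub>R e i) + pr x"
    and co_e: "\<And>i j. i \<in> N3 \<Longrightarrow> j \<in> N3 \<Longrightarrow> co i (e j) = (if i = j then 1 else 0)"
    and pr_e: "\<And>i. i \<in> N3 \<Longrightarrow> pr (e i) = 0"
    and co_V: "\<And>i v. i \<in> N3 \<Longrightarrow> v \<in> V \<Longrightarrow> co i v = 0"
    and pr_V: "\<And>v. v \<in> V \<Longrightarrow> pr v = v"
    and br_lin: "\<And>a. a \<in> h \<Longrightarrow> linear_map scaleR m scaleR m (br a)"
    and br_e: "\<And>a i. a \<in> h \<Longrightarrow> i \<in> N3 \<Longrightarrow> br a (e i) = 0"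
    and br_V: "\<And>a v. a \<in> h \<Longrightarrow> v \<in> V \<Longrightarrow> br a v \<in> V"
    and \<omega>: "\<And>l. l \<in> N4 \<Longrightarrow> invariant_bilinear h br V (\<omega> l)"
    and \<omega>0_sym: "\<And>x y. x \<in> V \<Longrightarrow> y \<in> V \<Longrightarrow> \<omega> 0 x y = \<omega> 0 y x"
    and \<omega>0_pos: "\<And>x. x \<in> V \<Longrightarrow> x \<noteq> 0 \<Longrightarrow> \<omega> 0 x x > 0"
    and \<omega>_alt: "\<And>l x. l \<in> N3 \<Longrightarrow> x \<in> V \<Longrightarrow> \<omega> l x x = 0"
    and \<omega>_span: "\<And>B. invariant_bilinear h br V B \<Longrightarrow>
      \<exists>c. \<forall>x\<in>V. \<forall>y\<in>V. B x y = (\<Sum>l\<in>N4. c l * \<omega> l x y)"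
    and \<omega>_indep: "\<And>c l. (\<And>x y. x \<in> V \<Longrightarrow> y \<in> V \<Longrightarrow> (\<Sum>l\<in>N4. c l * \<omega> l x y) = 0) \<Longrightarrow>
      l \<in> N4 \<Longrightarrow> c l = 0"
    and no_linear: "\<And>f v. linear_map scaleR V (*) UNIV f \<Longrightarrow>
      (\<And>a v. a \<in> h \<Longrightarrow> v \<in> V \<Longrightarrow> f (br a v) = 0) \<Longrightarrow> v \<in> V \<Longrightarrow> f v = 0"
    and no_trilinear: "\<And>T x y z. invariant_trilinear h br V T \<Longrightarrow>
      x \<in> V \<Longrightarrow> y \<in> V \<Longrightarrow> z \<in> V \<Longrightarrow> T x y z = 0"
begin

lemma pr_in_V: "x \<in> m \<Longrightarrow> pr x \<in> V"
  using pr by (simp add: linear_map_def)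

lemma pr_in_m: "x \<in> m \<Longrightarrow> pr x \<in> m"
  using pr_in_V V by auto

lemma br_in_m: "a \<in> h \<Longrightarrow> x \<in> m \<Longrightarrow> br a x \<in> m"
  using br_lin by (simp add: linear_map_def)

lemma \<omega>_linear:
  assumes "l \<in> N4" "x \<in> V"
  shows "linear_map scaleR V (*) UNIV (\<lambda>y. \<omega> l y x)" "linear_map scaleR V (*) UNIV (\<omega> l x)"
  using \<omega>[OF assms(1)] assms(2) by (auto simp: invariant_bilinear_def bilinear_on_def)

lemma linear_decomp:
  assumes f: "linear_map scaleR m scW W f" and W: "vector_space scW" and x: "x \<in> m"
  shows "f x = (\<Sum>i\<in>N3. scW (co i x) (f (e i))) + f (pr x)"
proof -
  have s: "(\<Sum>i\<in>N3. co i x *\<^sub>R e i) \<in> m"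
    using e m(1) by (intro subspace_sum subspace_scale) auto
  have "f x = f ((\<Sum>i\<in>N3. co i x *\<^sub>R e i) + pr x)" using decomp[OF x] by simp
  also have "\<dots> = f (\<Sum>i\<in>N3. co i x *\<^sub>R e i) + f (pr x)"
    by (rule linear_map_plus[OF f s pr_in_m[OF x]])
  also have "f (\<Sum>i\<in>N3. co i x *\<^sub>R e i) = (\<Sum>i\<in>N3. scW (co i x) (f (e i)))"
    by (rule linear_map_sum[OF _ W f]) (use e m(1) in auto)
  finally show ?thesis .
qed

lemma br_eq: "a \<in> h \<Longrightarrow> x \<in> m \<Longrightarrow> br a x = br a (pr x)"
  using linear_decomp[OF br_lin, of a x] br_e by (simp add: real_vector.vector_space_axioms)

lemma co_br: "i \<in> N3 \<Longrightarrow> a \<in> h \<Longrightarrow> x \<in> m \<Longrightarrow> co i (br a x) = 0"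
  using co_V br_eq br_V pr_in_V by metis

lemma pr_br: "a \<in> h \<Longrightarrow> x \<in> m \<Longrightarrow> pr (br a x) = br a (pr x)"
  using pr_V br_eq br_V pr_in_V by metis

lemma invariant_co_co_co:
  assumes "i \<in> N3" "j \<in> N3" "k \<in> N3"
  shows "invariant_trilinear h br m (\<lambda>x y z. co i x * co j y * co k z)"
  unfolding invariant_trilinear_def trilinear_on_def
  using co_br assms co[OF assms(1)] co[OF assms(2)] co[OF assms(3)]
  by (auto simp: linear_map_def algebra_simps)

lemma invariant_co_\<omega>:
  assumes i: "i \<in> N3" and l: "l \<in> N4"
  shows "invariant_trilinear h br m (\<lambda>x y z. co i x * \<omega> l (pr y) (pr z))"
proof -
  have "\<omega> l (br a y) z + \<omega> l y (br a z) = 0" if "a \<in> h" "y \<in> V" "z \<in> V" for a y z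
    using \<omega>[OF l] that by (simp add: invariant_bilinear_def)
  then have "co i x * \<omega> l (br a (pr y)) (pr z) + co i x * \<omega> l (pr y) (br a (pr z)) = 0"
    if "a \<in> h" "y \<in> m" "z \<in> m" for a x y z
    using that pr_in_V by (simp flip: distrib_left)
  moreover have "linear_map scaleR m (*) UNIV (\<lambda>z. r * \<omega> l (pr y) (pr z))"
    "linear_map scaleR m (*) UNIV (\<lambda>z. r * \<omega> l (pr z) (pr y))"
    "linear_map scaleR m (*) UNIV (\<lambda>z. co i z * r)"
    if "y \<in> m" for y r
    using linear_map_compose[OF pr \<omega>_linear(1)[OF l pr_in_V[OF that]]]
      linear_map_compose[OF pr \<omega>_linear(2)[OF l pr_in_V[OF that]]] co[OF i]
    by (auto simp: linear_map_def algebra_simps)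
  ultimately show ?thesis
    unfolding invariant_trilinear_def trilinear_on_def
    by (auto simp: co_br[OF i] pr_br)
qed

lemma invariant_co_\<omega>':
  assumes i: "i \<in> N3" and l: "l \<in> N4"
  shows "invariant_trilinear h br m (\<lambda>x y z. co i y * \<omega> l (pr x) (pr z))"
    and "invariant_trilinear h br m (\<lambda>x y z. co i z * \<omega> l (pr x) (pr y))"
  using invariant_trilinear_permute[OF invariant_co_\<omega>[OF assms]] by auto

lemma co_e_simps:
  "co 1 (e 1) = 1" "co 1 (e 2) = 0" "co 1 (e 3) = 0"
  "co 2 (e 1) = 0" "co 2 (e 2) = 1" "co 2 (e 3) = 0"
  "co 3 (e 1) = 0" "co 3 (e 2) = 0" "co 3 (e 3) = 1"
  by (simp_all add: co_e del: One_nat_def)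

text \<open>
  The general invariant form: the constants \<open>t\<close> belong to three arguments in the trivial part, and
  \<open>c\<close>, \<open>c'\<close>, \<open>c''\<close> to the first, second or third argument in the trivial part and the others in \<open>V\<close>.
\<close>

definition normal_form where
  "normal_form t c c' c'' x y z =
     (\<Sum>i\<in>N3. \<Sum>j\<in>N3. \<Sum>k\<in>N3. t i j k * (co i x * co j y * co k z)) +
     (\<Sum>i\<in>N3. \<Sum>l\<in>N4. c i l * (co i x * \<omega> l (pr y) (pr z))) +
     (\<Sum>i\<in>N3. \<Sum>l\<in>N4. c' i l * (co i y * \<omega> l (pr x) (pr z))) +
     (\<Sum>i\<in>N3. \<Sum>l\<in>N4. c'' i l * (co i z * \<omega> l (pr x) (pr y)))"

lemma invariant_trilinear_linear:
  assumes "invariant_trilinear h br m T" "x \<in> m" "y \<in> m"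
  shows "linear_map scaleR m (*) UNIV (\<lambda>z. T z x y)"
    "linear_map scaleR m (*) UNIV (\<lambda>z. T x z y)"
    "linear_map scaleR m (*) UNIV (\<lambda>z. T x y z)"
  using assms by (auto simp: invariant_trilinear_def trilinear_on_def)

lemma linear_map_on_V: "linear_map scaleR m scW W f \<Longrightarrow> linear_map scaleR V scW W f"
  using V(2) by (auto simp: linear_map_def subset_eq)

text \<open>
  As \<open>h\<close> annihilates \<open>e\<^sub>i\<close>, inserting \<open>e\<^sub>i\<close> into an invariant form leaves an invariant form in the
  other arguments.
\<close>

lemma invariant_form_e:
  assumes T: "invariant_trilinear h br m T" and i: "i \<in> N3"
  shows "\<exists>c. \<forall>y\<in>V. \<forall>z\<in>V. T (e i) y z = (\<Sum>l\<in>N4. c l * \<omega> l y z)"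
proof (rule \<omega>_span)
  have "T (e i) (br a y) z + T (e i) y (br a z) = 0" if "a \<in> h" "y \<in> V" "z \<in> V" for a y z
  proof -
    have yz: "y \<in> m" "z \<in> m" using that V by auto
    have "T (br a (e i)) y z = 0"
      using linear_map_0[OF _ vector_space_mult invariant_trilinear_linear(1)[OF T yz]] m
        br_e[OF that(1) i] by simp
    moreover have "T (br a (e i)) y z + T (e i) (br a y) z + T (e i) y (br a z) = 0"
      using T yz e[OF i] that(1) unfolding invariant_trilinear_def by blast
    ultimately show ?thesis by simp
  qed
  then show "invariant_bilinear h br V (T (e i))"
    using linear_map_on_V[OF invariant_trilinear_linear(2)[OF T e[OF i]]]
      linear_map_on_V[OF invariant_trilinear_linear(3)[OF T e[OF i]]] V(2)
    by (auto simp: invariant_bilinear_def bilinear_on_def)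
qed

lemma invariant_form_e_e:
  assumes T: "invariant_trilinear h br m T" and ij: "i \<in> N3" "j \<in> N3" and v: "v \<in> V"
  shows "T (e i) (e j) v = 0"
proof (rule no_linear[OF _ _ v])
  show "linear_map scaleR V (*) UNIV (T (e i) (e j))"
    using linear_map_on_V[OF invariant_trilinear_linear(3)[OF T e[OF ij(1)] e[OF ij(2)]]] .
  fix a w assume a: "a \<in> h" and w: "w \<in> V"
  have wm: "w \<in> m" using w V by auto
  have "T 0 (e j) w = 0" "T (e i) 0 w = 0"
    using linear_map_0[OF _ vector_space_mult invariant_trilinear_linear(1)[OF T e[OF ij(2)] wm]]
      linear_map_0[OF _ vector_space_mult invariant_trilinear_linear(2)[OF T e[OF ij(1)] wm]] m
    by auto
  moreover have "T (br a (e i)) (e j) w + T (e i) (br a (e j)) w + T (e i) (e j) (br a w) = 0"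
    using T wm e[OF ij(1)] e[OF ij(2)] a unfolding invariant_trilinear_def by blast
  ultimately show "T (e i) (e j) (br a w) = 0" by (simp add: br_e[OF a ij(1)] br_e[OF a ij(2)])
qed

text \<open>
  Expand every argument into its components.  The terms with exactly two arguments in the trivial part
  vanish since \<open>V\<close> has no invariant functionals, and the term without such arguments vanishes since \<open>V\<close> has no
  invariant trilinear forms.  The coefficients are parameters, because an alternating form allows
  one to choose \<open>c'\<close> and \<open>c''\<close> in terms of \<open>c\<close>.
\<close>

lemma invariant_form_expansion:
  assumes T: "invariant_trilinear h br m T"
    and c: "\<And>i y z. i \<in> N3 \<Longrightarrow> y \<in> V \<Longrightarrow> z \<in> V \<Longrightarrow> T (e i) y z = (\<Sum>l\<in>N4. c i l * \<omega> l y z)"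
    and c': "\<And>i y z. i \<in> N3 \<Longrightarrow> y \<in> V \<Longrightarrow> z \<in> V \<Longrightarrow> T y (e i) z = (\<Sum>l\<in>N4. c' i l * \<omega> l y z)"
    and c'': "\<And>i y z. i \<in> N3 \<Longrightarrow> y \<in> V \<Longrightarrow> z \<in> V \<Longrightarrow> T y z (e i) = (\<Sum>l\<in>N4. c'' i l * \<omega> l y z)"
    and xyz: "x \<in> m" "y \<in> m" "z \<in> m"
  shows "T x y z = normal_form (\<lambda>i j k. T (e i) (e j) (e k)) c c' c'' x y z"
proof -
  note lin = invariant_trilinear_linear[OF T]
  note ld = linear_decomp[OF _ vector_space_mult]
  note T' = invariant_trilinear_permute[OF T]
  have p: "pr x \<in> V" "pr y \<in> V" "pr z \<in> V" "pr x \<in> m" "pr y \<in> m" "pr z \<in> m"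
    using xyz pr_in_V pr_in_m by auto
  have T3: "T (e i) (e j) z = (\<Sum>k\<in>N3. co k z * T (e i) (e j) (e k))" if "i \<in> N3" "j \<in> N3" for i j
    using ld[OF lin(3)[OF e[OF that(1)] e[OF that(2)]] xyz(3)] invariant_form_e_e[OF T that p(3)] by simp
  have T2: "T (e i) (pr y) z = T (e i) (pr y) (pr z)" if "i \<in> N3" for i
  proof -
    have "T (e i) (pr y) (e k) = 0" if "k \<in> N3" for k
      using invariant_form_e_e[OF invariant_trilinear_permute(2)[OF T'(1)] \<open>i \<in> N3\<close> that p(2)] .
    then show ?thesis using ld[OF lin(3)[OF e[OF that] p(5)] xyz(3)] by simp
  qed
  have T1: "T (pr x) (e j) z = T (pr x) (e j) (pr z)" if "j \<in> N3" for j
  proof -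
    have "T (pr x) (e j) (e k) = 0" if "k \<in> N3" for k
      using invariant_form_e_e[OF T'(2) \<open>j \<in> N3\<close> that p(1)] .
    then show ?thesis using ld[OF lin(3)[OF p(4) e[OF that]] xyz(3)] by simp
  qed
  have "invariant_trilinear h br V T"
    using T V(2) unfolding invariant_trilinear_def trilinear_on_def
    by (auto intro!: linear_map_on_V simp: subset_eq)
  then have T0: "T (pr x) (pr y) z = (\<Sum>k\<in>N3. co k z * T (pr x) (pr y) (e k))"
    using ld[OF lin(3)[OF p(4,5)] xyz(3)] no_trilinear[OF _ p(1,2,3)] by simp
  have "T x y z = (\<Sum>i\<in>N3. co i x * T (e i) y z) + T (pr x) y z"
    by (rule ld[OF lin(1)[OF xyz(2,3)] xyz(1)])
  also have "(\<Sum>i\<in>N3. co i x * T (e i) y z) =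
      (\<Sum>i\<in>N3. co i x * ((\<Sum>j\<in>N3. co j y * (\<Sum>k\<in>N3. co k z * T (e i) (e j) (e k))) +
        (\<Sum>l\<in>N4. c i l * \<omega> l (pr y) (pr z))))"
    using ld[OF lin(2)[OF e xyz(3)] xyz(2)] T3 T2 c[OF _ p(2,3)] by (intro sum.cong refl) auto
  also have "T (pr x) y z = (\<Sum>j\<in>N3. co j y * T (pr x) (e j) z) + T (pr x) (pr y) z"
    by (rule ld[OF lin(2)[OF p(4) xyz(3)] xyz(2)])
  also have "(\<Sum>j\<in>N3. co j y * T (pr x) (e j) z) =
      (\<Sum>j\<in>N3. co j y * (\<Sum>l\<in>N4. c' j l * \<omega> l (pr x) (pr z)))"
    using T1 c'[OF _ p(1,3)] by (intro sum.cong refl) auto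
  also have "T (pr x) (pr y) z = (\<Sum>k\<in>N3. co k z * (\<Sum>l\<in>N4. c'' k l * \<omega> l (pr x) (pr y)))"
    unfolding T0 using c''[OF _ p(1,2)] by (intro sum.cong refl) auto
  finally show ?thesis
    unfolding normal_form_def by (simp only: sum_N3 sum_N4 algebra_simps)
qed

lemma normal_form_zero:
  assumes "\<forall>x\<in>m. \<forall>y\<in>m. \<forall>z\<in>m. normal_form t c c' c'' x y z = 0"
  shows "\<lbrakk>i \<in> N3; j \<in> N3; k \<in> N3\<rbrakk> \<Longrightarrow> t i j k = 0"
    "\<lbrakk>i \<in> N3; l \<in> N4\<rbrakk> \<Longrightarrow> c i l = 0"
    "\<lbrakk>i \<in> N3; l \<in> N4\<rbrakk> \<Longrightarrow> c' i l = 0"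
    "\<lbrakk>i \<in> N3; l \<in> N4\<rbrakk> \<Longrightarrow> c'' i l = 0"
proof -
  note zero = assms[rule_format]
  have z: "\<omega> l 0 x = 0" "\<omega> l x 0 = 0" if "l \<in> N4" "x \<in> V" for l x
    using linear_map_0[OF _ vector_space_mult \<omega>_linear(1)[OF that]]
      linear_map_0[OF _ vector_space_mult \<omega>_linear(2)[OF that]] V(1) by auto
  have V0: "0 \<in> V" using V(1) by (rule subspace_0)
  show "t i j k = 0" if "i \<in> N3" "j \<in> N3" "k \<in> N3"
  proof -
    have "normal_form t c c' c'' (e i) (e j) (e k) = t i j k"
      unfolding normal_form_def
      using that by (auto simp: pr_e z(1)[OF _ V0] co_e_simps sum_N3 sum_N4 simp del: One_nat_def)
    then show ?thesis using zero[OF e[OF that(1)] e[OF that(2)] e[OF that(3)]] by simp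
  qed
  show "c i l = 0" if i: "i \<in> N3" and l: "l \<in> N4"
  proof (rule \<omega>_indep[OF _ l])
    fix y z assume yz: "y \<in> V" "z \<in> V"
    have "normal_form t c c' c'' (e i) y z = (\<Sum>l\<in>N4. c i l * \<omega> l y z)"
      unfolding normal_form_def using i yz
      by (auto simp: pr_e pr_V co_V co_e_simps z sum_N3 sum_N4 simp del: One_nat_def)
    then show "(\<Sum>l\<in>N4. c i l * \<omega> l y z) = 0" using zero[OF e[OF i], of y z] yz V(2) by auto
  qed
  show "c' i l = 0" if i: "i \<in> N3" and l: "l \<in> N4"
  proof (rule \<omega>_indep[OF _ l])
    fix y z assume yz: "y \<in> V" "z \<in> V"
    have "normal_form t c c' c'' y (e i) z = (\<Sum>l\<in>N4. c' i l * \<omega> l y z)"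
      unfolding normal_form_def using i yz
      by (auto simp: pr_e pr_V co_V co_e_simps z sum_N3 sum_N4 simp del: One_nat_def)
    then show "(\<Sum>l\<in>N4. c' i l * \<omega> l y z) = 0" using zero[OF _ e[OF i], of y z] yz V(2) by auto
  qed
  show "c'' i l = 0" if i: "i \<in> N3" and l: "l \<in> N4"
  proof (rule \<omega>_indep[OF _ l])
    fix y z assume yz: "y \<in> V" "z \<in> V"
    have "normal_form t c c' c'' y z (e i) = (\<Sum>l\<in>N4. c'' i l * \<omega> l y z)"
      unfolding normal_form_def using i yz
      by (auto simp: pr_e pr_V co_V co_e_simps z sum_N3 sum_N4 simp del: One_nat_def)
    then show "(\<Sum>l\<in>N4. c'' i l * \<omega> l y z) = 0" using zero[OF _ _ e[OF i], of y z] yz V(2) by auto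
  qed
qed

end

text \<open>
  A basis, up to the values outside \<open>m\<close>, of the space of forms with property \<open>K\<close>.
\<close>

definition form_basis ::
    "'g set \<Rightarrow> (('g \<Rightarrow> 'g \<Rightarrow> 'g \<Rightarrow> real) \<Rightarrow> bool) \<Rightarrow> 'i set \<Rightarrow> ('i \<Rightarrow> 'g \<Rightarrow> 'g \<Rightarrow> 'g \<Rightarrow> real) \<Rightarrow> bool" where
  "form_basis m K I B \<longleftrightarrow> finite I \<and> (\<forall>i\<in>I. K (B i)) \<and>
     (\<forall>T. K T \<longrightarrow> (\<exists>d. \<forall>x\<in>m. \<forall>y\<in>m. \<forall>z\<in>m. T x y z = (\<Sum>i\<in>I. d i * B i x y z))) \<and>
     (\<forall>d. (\<forall>x\<in>m. \<forall>y\<in>m. \<forall>z\<in>m. (\<Sum>i\<in>I. d i * B i x y z) = 0) \<longrightarrow> (\<forall>i\<in>I. d i = 0))"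

context isotropy_module
begin

abbreviation "inv_form \<equiv> invariant_trilinear h br m"

definition alternating_23 where
  "alternating_23 T \<longleftrightarrow> inv_form T \<and> (\<forall>x\<in>m. \<forall>y\<in>m. T x y y = 0)"

definition alternating_123 where
  "alternating_123 T \<longleftrightarrow> alternating_23 T \<and> (\<forall>x\<in>m. \<forall>y\<in>m. T x x y = 0)"

lemma normal_form_cong:
  assumes "\<And>i j k. i \<in> N3 \<Longrightarrow> j \<in> N3 \<Longrightarrow> k \<in> N3 \<Longrightarrow> t i j k = u i j k"
    "\<And>i l. i \<in> N3 \<Longrightarrow> l \<in> N4 \<Longrightarrow> c i l = d i l"
    "\<And>i l. i \<in> N3 \<Longrightarrow> l \<in> N4 \<Longrightarrow> c' i l = d' i l"
    "\<And>i l. i \<in> N3 \<Longrightarrow> l \<in> N4 \<Longrightarrow> c'' i l = d'' i l"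
  shows "normal_form t c c' c'' x y z = normal_form u d d' d'' x y z"
  unfolding normal_form_def
  by (intro arg_cong2[of _ _ _ _ "(+)"] sum.cong refl arg_cong2[of _ _ _ _ "(*)"] assms)

lemma form_coefficients:
  assumes T: "inv_form T"
  shows "\<exists>c. \<forall>i\<in>N3. \<forall>y\<in>V. \<forall>z\<in>V. T (e i) y z = (\<Sum>l\<in>N4. c i l * \<omega> l y z)"
    and "\<exists>c. \<forall>i\<in>N3. \<forall>y\<in>V. \<forall>z\<in>V. T y (e i) z = (\<Sum>l\<in>N4. c i l * \<omega> l y z)"
    and "\<exists>c. \<forall>i\<in>N3. \<forall>y\<in>V. \<forall>z\<in>V. T y z (e i) = (\<Sum>l\<in>N4. c i l * \<omega> l y z)"
proof -
  have *: "\<exists>c. \<forall>i\<in>N3. \<forall>y\<in>V. \<forall>z\<in>V. S (e i) y z = (\<Sum>l\<in>N4. c i l * \<omega> l y z)"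
    if "inv_form S" for S
    by (rule bchoice) (intro ballI invariant_form_e[OF that])
  show "\<exists>c. \<forall>i\<in>N3. \<forall>y\<in>V. \<forall>z\<in>V. T (e i) y z = (\<Sum>l\<in>N4. c i l * \<omega> l y z)"
    by (rule *[OF T])
  show "\<exists>c. \<forall>i\<in>N3. \<forall>y\<in>V. \<forall>z\<in>V. T y (e i) z = (\<Sum>l\<in>N4. c i l * \<omega> l y z)"
    by (rule *[OF invariant_trilinear_permute(1)[OF T]])
  show "\<exists>c. \<forall>i\<in>N3. \<forall>y\<in>V. \<forall>z\<in>V. T y z (e i) = (\<Sum>l\<in>N4. c i l * \<omega> l y z)"
    by (rule *[OF invariant_trilinear_permute(2)[OF invariant_trilinear_permute(2)[OF T]]])
qed

lemma swap_23:
  assumes "alternating_23 T" "x \<in> m" "y \<in> m" "z \<in> m"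
  shows "T x y z = - T x z y"
proof -
  have T: "inv_form T" and a: "\<And>y. y \<in> m \<Longrightarrow> T x y y = 0"
    using assms by (auto simp: alternating_23_def)
  note lin = invariant_trilinear_linear[OF T]
  have yz: "y + z \<in> m" using assms m(1) subspace_add by blast
  have "T x (y + z) (y + z) = T x y y + T x y z + (T x z y + T x z z)"
    using linear_map_plus[OF lin(2)[OF assms(2) yz] assms(3,4)]
      linear_map_plus[OF lin(3)[OF assms(2,3)] assms(3,4)]
      linear_map_plus[OF lin(3)[OF assms(2,4)] assms(3,4)] by simp
  then show ?thesis using a[OF yz] a[OF assms(3)] a[OF assms(4)] by simp
qed

lemma swap_12:
  assumes "alternating_123 T" "x \<in> m" "y \<in> m" "z \<in> m"
  shows "T x y z = - T y x z"
proof -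
  have T: "inv_form T" and a: "\<And>y. y \<in> m \<Longrightarrow> T y y z = 0"
    using assms by (auto simp: alternating_123_def alternating_23_def)
  note lin = invariant_trilinear_linear[OF T]
  have xy: "x + y \<in> m" using assms m(1) subspace_add by blast
  have "T (x + y) (x + y) z = T x x z + T x y z + (T y x z + T y y z)"
    using linear_map_plus[OF lin(1)[OF xy assms(4)] assms(2,3)]
      linear_map_plus[OF lin(2)[OF assms(2,4)] assms(2,3)]
      linear_map_plus[OF lin(2)[OF assms(3,4)] assms(2,3)] by simp
  then show ?thesis using a[OF xy] a[OF assms(2)] a[OF assms(3)] by simp
qed

text \<open>
  On the diagonal only the inner product \<open>\<omega>\<^sub>0\<close> survives, and it is nonzero there because \<open>V\<close> is nonzero
  by the independence of the \<open>\<omega>\<^sub>l\<close>.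
\<close>

lemma coefficient_0_vanishes:
  assumes c: "\<And>y z. y \<in> V \<Longrightarrow> z \<in> V \<Longrightarrow> B y z = (\<Sum>l\<in>N4. c l * \<omega> l y z)"
    and B: "\<And>y. y \<in> V \<Longrightarrow> B y y = 0"
  shows "c 0 = 0"
proof (rule ccontr)
  assume c0: "c 0 \<noteq> 0"
  have "\<omega> 0 y y = 0" if "y \<in> V" for y
    using c[OF that that] B[OF that] \<omega>_alt[OF _ that] c0 by (simp add: sum_N4 del: One_nat_def)
  then have "y = 0" if "y \<in> V" for y using \<omega>0_pos[OF that] that by force
  then have "\<omega> l y z = 0" if "l \<in> N4" "y \<in> V" "z \<in> V" for l y z
    using linear_map_0[OF _ vector_space_mult \<omega>_linear(2)[OF that(1,2)]] V(1) that by auto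
  then have "(\<Sum>l\<in>N4. 1 * \<omega> l y z) = 0" if "y \<in> V" "z \<in> V" for y z
    using that by (intro sum.neutral) auto
  then show False using \<omega>_indep[of "\<lambda>_. 1" 0] by auto
qed

definition I1 :: "(nat \<times> nat \<times> nat + nat \<times> nat + nat \<times> nat + nat \<times> nat) set" where
  "I1 = (N3 \<times> N3 \<times> N3) <+> (N3 \<times> N4) <+> (N3 \<times> N4) <+> (N3 \<times> N4)"

definition basis1 where
  "basis1 s x y z = (case s of Inl (i, j, k) \<Rightarrow> co i x * co j y * co k z
    | Inr (Inl (i, l)) \<Rightarrow> co i x * \<omega> l (pr y) (pr z)
    | Inr (Inr (Inl (i, l))) \<Rightarrow> co i y * \<omega> l (pr x) (pr z)
    | Inr (Inr (Inr (i, l))) \<Rightarrow> co i z * \<omega> l (pr x) (pr y))"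

lemma sum_basis1:
  "(\<Sum>s\<in>I1. d s * basis1 s x y z) =
   normal_form (\<lambda>i j k. d (Inl (i, j, k))) (\<lambda>i l. d (Inr (Inl (i, l))))
     (\<lambda>i l. d (Inr (Inr (Inl (i, l))))) (\<lambda>i l. d (Inr (Inr (Inr (i, l))))) x y z"
  unfolding I1_def basis1_def normal_form_def
  by (simp only: sum.Plus sum.cartesian_product' finite_Plus finite_cartesian_product
    finite_insert finite.emptyI o_def sum.case prod.case add.assoc)

lemma form_basis1: "form_basis m inv_form I1 basis1"
  unfolding form_basis_def
proof (intro conjI ballI allI impI)
  show "finite I1" by (simp add: I1_def)
  show "inv_form (basis1 s)" if "s \<in> I1" for s
    using that invariant_co_co_co invariant_co_\<omega> invariant_co_\<omega>'
    unfolding I1_def Plus_def basis1_def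
    by (elim UnE imageE SigmaE) (simp_all only: sum.case prod.case)
  show "\<exists>d. \<forall>x\<in>m. \<forall>y\<in>m. \<forall>z\<in>m. T x y z = (\<Sum>s\<in>I1. d s * basis1 s x y z)" if T: "inv_form T" for T
  proof -
    from form_coefficients(1)[OF T] obtain c
      where c: "\<forall>i\<in>N3. \<forall>y\<in>V. \<forall>z\<in>V. T (e i) y z = (\<Sum>l\<in>N4. c i l * \<omega> l y z)" ..
    from form_coefficients(2)[OF T] obtain c'
      where c': "\<forall>i\<in>N3. \<forall>y\<in>V. \<forall>z\<in>V. T y (e i) z = (\<Sum>l\<in>N4. c' i l * \<omega> l y z)" ..
    from form_coefficients(3)[OF T] obtain c''
      where c'': "\<forall>i\<in>N3. \<forall>y\<in>V. \<forall>z\<in>V. T y z (e i) = (\<Sum>l\<in>N4. c'' i l * \<omega> l y z)" ..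
    let ?d = "\<lambda>s. case s of Inl (i, j, k) \<Rightarrow> T (e i) (e j) (e k) | Inr (Inl (i, l)) \<Rightarrow> c i l
      | Inr (Inr (Inl (i, l))) \<Rightarrow> c' i l | Inr (Inr (Inr (i, l))) \<Rightarrow> c'' i l"
    have "T x y z = (\<Sum>s\<in>I1. ?d s * basis1 s x y z)" if "x \<in> m" "y \<in> m" "z \<in> m" for x y z
      unfolding sum_basis1 sum.case prod.case
      by (rule invariant_form_expansion[OF T c[rule_format] c'[rule_format] c''[rule_format] that])
    then show ?thesis by (intro exI[of _ ?d] ballI)
  qed
  show "d s = 0" if zero: "\<forall>x\<in>m. \<forall>y\<in>m. \<forall>z\<in>m. (\<Sum>s\<in>I1. d s * basis1 s x y z) = 0" and s: "s \<in> I1" for d s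
  proof -
    note nz = normal_form_zero[OF zero[unfolded sum_basis1]]
    show ?thesis using s unfolding I1_def Plus_def
      by (elim UnE imageE SigmaE) (simp_all only: nz)
  qed
qed

lemma card_I1: "card I1 = 63"
  by (simp add: I1_def card_Plus card_cartesian_product)

definition P3 :: "(nat \<times> nat) set" where "P3 = {(1, 2), (1, 3), (2, 3)}"

definition I2 :: "(nat \<times> nat \<times> nat + nat \<times> nat + nat \<times> nat) set" where
  "I2 = (N3 \<times> P3) <+> (N3 \<times> N3) <+> (N3 \<times> N4)"

lemma I2_cases:
  assumes "s \<in> I2"
  obtains (1) i j k where "s = Inl (i, j, k)" "i \<in> N3" "j \<in> N3" "k \<in> N3" "j < k"
    | (2) i l where "s = Inr (Inl (i, l))" "i \<in> N3" "l \<in> N3"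
    | (3) i l where "s = Inr (Inr (i, l))" "i \<in> N3" "l \<in> N4"
  using assms unfolding I2_def
proof (elim PlusE SigmaE, goal_cases)
  case (1 _ i p)
  then have "fst p \<in> N3" "snd p \<in> N3" "fst p < snd p" by (auto simp: P3_def)
  with 1 show ?case using that(1)[of i "fst p" "snd p"] by simp
next
  case (2 _ _ i l)
  then show ?case using that(2)[of i l] by simp
next
  case (3 _ _ i l)
  then show ?case using that(3)[of i l] by simp
qed

definition basis2 where
  "basis2 s x y z = (case s of Inl (i, j, k) \<Rightarrow> co i x * co j y * co k z - co i x * co k y * co j z
    | Inr (Inl (i, l)) \<Rightarrow> co i x * \<omega> l (pr y) (pr z)
    | Inr (Inr (i, l)) \<Rightarrow> co i y * \<omega> l (pr x) (pr z) - co i z * \<omega> l (pr x) (pr y))"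

text \<open>
  The coefficients of a form that is a combination of \<open>basis2\<close>, as constants of a normal form: a
  table that is skew in the last two indices, and a table without the inner product \<open>\<omega>\<^sub>0\<close>.
\<close>

definition skew23 :: "(nat \<times> nat \<times> nat \<Rightarrow> real) \<Rightarrow> nat \<Rightarrow> nat \<Rightarrow> nat \<Rightarrow> real" where
  "skew23 d i j k = (if j < k then d (i, j, k) else if k < j then - d (i, k, j) else 0)"

definition no_0 :: "(nat \<times> nat \<Rightarrow> real) \<Rightarrow> nat \<Rightarrow> nat \<Rightarrow> real" where
  "no_0 d i l = (if l = 0 then 0 else d (i, l))"

lemma sum_basis2:
  "(\<Sum>s\<in>I2. d s * basis2 s x y z) =
   normal_form (skew23 (\<lambda>p. d (Inl p))) (no_0 (\<lambda>p. d (Inr (Inl p))))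
     (\<lambda>i l. d (Inr (Inr (i, l)))) (\<lambda>i l. - d (Inr (Inr (i, l)))) x y z"
proof -
  have P3: "sum f P3 = f (1, 2) + f (1, 3) + f (2, 3)" for f :: "nat \<times> nat \<Rightarrow> real"
    by (simp add: P3_def del: One_nat_def)
  have fin: "finite P3" by (simp add: P3_def)
  have 1: "(\<Sum>i\<in>N3. \<Sum>p\<in>P3. d (Inl (i, p)) * basis2 (Inl (i, p)) x y z) =
    (\<Sum>i\<in>N3. \<Sum>j\<in>N3. \<Sum>k\<in>N3. skew23 (\<lambda>p. d (Inl p)) i j k * (co i x * co j y * co k z))"
    by (simp add: sum_N3 P3 basis2_def skew23_def algebra_simps del: One_nat_def)
  have 2: "(\<Sum>i\<in>N3. \<Sum>l\<in>N3. d (Inr (Inl (i, l))) * basis2 (Inr (Inl (i, l))) x y z) =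
    (\<Sum>i\<in>N3. \<Sum>l\<in>N4. no_0 (\<lambda>p. d (Inr (Inl p))) i l * (co i x * \<omega> l (pr y) (pr z)))"
    by (simp add: sum_N3 sum_N4 basis2_def no_0_def algebra_simps del: One_nat_def)
  have 3: "(\<Sum>i\<in>N3. \<Sum>l\<in>N4. d (Inr (Inr (i, l))) * basis2 (Inr (Inr (i, l))) x y z) =
    (\<Sum>i\<in>N3. \<Sum>l\<in>N4. d (Inr (Inr (i, l))) * (co i y * \<omega> l (pr x) (pr z))) +
    (\<Sum>i\<in>N3. \<Sum>l\<in>N4. - d (Inr (Inr (i, l))) * (co i z * \<omega> l (pr x) (pr y)))"
    by (simp add: sum_N3 sum_N4 basis2_def algebra_simps del: One_nat_def)
  show ?thesis
    unfolding I2_def normal_form_def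
    by (simp only: sum.Plus sum.cartesian_product' finite_Plus finite_cartesian_product fin
      finite_insert finite.emptyI o_def 1 2 3 add.assoc)
qed

lemma form_basis2: "form_basis m alternating_23 I2 basis2"
  unfolding form_basis_def
proof (intro conjI ballI allI impI)
  show "finite I2" by (simp add: I2_def P3_def)
  show "alternating_23 (basis2 s)" if "s \<in> I2" for s
  proof -
    from that show ?thesis
    proof (cases rule: I2_cases)
      case (1 i j k)
      show ?thesis
        using invariant_trilinear_combination[OF invariant_co_co_co[OF 1(2,3,4)]
          invariant_co_co_co[OF 1(2,4,3)], of "- 1"]
        by (simp add: alternating_23_def basis2_def[abs_def] 1(1) del: One_nat_def)
    next
      case (2 i l)
      have "l \<in> N4" using 2 by blast
      from invariant_co_\<omega>[OF 2(2) this] show ?thesis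
        using \<omega>_alt[OF 2(3)] pr_in_V by (simp add: alternating_23_def basis2_def[abs_def] 2(1) del: One_nat_def)
    next
      case (3 i l)
      show ?thesis
        using invariant_trilinear_combination[OF invariant_co_\<omega>'(1)[OF 3(2,3)]
          invariant_co_\<omega>'(2)[OF 3(2,3)], of "- 1"]
        by (simp add: alternating_23_def basis2_def[abs_def] 3(1) del: One_nat_def)
    qed
  qed
  show "\<exists>d. \<forall>x\<in>m. \<forall>y\<in>m. \<forall>z\<in>m. T x y z = (\<Sum>s\<in>I2. d s * basis2 s x y z)"
    if alt: "alternating_23 T" for T
  proof -
    have T: "inv_form T" using alt by (simp add: alternating_23_def)
    have Vm: "y \<in> m" if "y \<in> V" for y using that V by auto
    from form_coefficients(1)[OF T] obtain c
      where "\<forall>i\<in>N3. \<forall>y\<in>V. \<forall>z\<in>V. T (e i) y z = (\<Sum>l\<in>N4. c i l * \<omega> l y z)" ..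
    note c = this[rule_format]
    from form_coefficients(2)[OF T] obtain c'
      where "\<forall>i\<in>N3. \<forall>y\<in>V. \<forall>z\<in>V. T y (e i) z = (\<Sum>l\<in>N4. c' i l * \<omega> l y z)" ..
    note c' = this[rule_format]
    have c'': "T y z (e i) = (\<Sum>l\<in>N4. - c' i l * \<omega> l y z)" if "i \<in> N3" "y \<in> V" "z \<in> V" for i y z
      using swap_23[OF alt Vm[OF that(2)] Vm[OF that(3)] e[OF that(1)]] c'[OF that]
      by (simp add: sum_negf del: One_nat_def)
    have c0: "c i 0 = 0" if "i \<in> N3" for i
      by (rule coefficient_0_vanishes[OF c[OF that]])
        (use alt Vm e[OF that] in \<open>auto simp: alternating_23_def\<close>)
    let ?d = "\<lambda>s. case s of Inl (i, j, k) \<Rightarrow> T (e i) (e j) (e k) | Inr (Inl (i, l)) \<Rightarrow> c i l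
      | Inr (Inr (i, l)) \<Rightarrow> c' i l"
    have "T x y z = (\<Sum>s\<in>I2. ?d s * basis2 s x y z)" if "x \<in> m" "y \<in> m" "z \<in> m" for x y z
    proof -
      have "T x y z = normal_form (\<lambda>i j k. T (e i) (e j) (e k)) c c' (\<lambda>i l. - c' i l) x y z"
        by (rule invariant_form_expansion[OF T c c' c'' that])
      also have "\<dots> = normal_form (skew23 (\<lambda>p. ?d (Inl p))) (no_0 (\<lambda>p. ?d (Inr (Inl p))))
         (\<lambda>i l. ?d (Inr (Inr (i, l)))) (\<lambda>i l. - ?d (Inr (Inr (i, l)))) x y z"
      proof (rule normal_form_cong)
        fix i j k assume ijk: "i \<in> N3" "j \<in> N3" "k \<in> N3"
        have "T (e i) (e j) (e j) = 0"
          using alt e[OF ijk(1)] e[OF ijk(2)] by (simp add: alternating_23_def)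
        moreover have "T (e i) (e j) (e k) = - T (e i) (e k) (e j)"
          by (rule swap_23[OF alt e[OF ijk(1)] e[OF ijk(2)] e[OF ijk(3)]])
        ultimately show "T (e i) (e j) (e k) = skew23 (\<lambda>p. ?d (Inl p)) i j k"
          using linorder_less_linear[of j k] by (auto simp: skew23_def)
      qed (use c0 in \<open>auto simp: no_0_def simp del: One_nat_def\<close>)
      also have "\<dots> = (\<Sum>s\<in>I2. ?d s * basis2 s x y z)" by (rule sum_basis2[symmetric])
      finally show ?thesis .
    qed
    then show ?thesis by (intro exI[of _ ?d] ballI)
  qed
  show "d s = 0" if zero: "\<forall>x\<in>m. \<forall>y\<in>m. \<forall>z\<in>m. (\<Sum>s\<in>I2. d s * basis2 s x y z) = 0" and s: "s \<in> I2" for d s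
  proof -
    note nz = normal_form_zero[OF zero[unfolded sum_basis2]]
    from s show ?thesis
    proof (cases rule: I2_cases)
      case (1 i j k)
      then show ?thesis using nz(1)[OF 1(2,3,4)] by (simp add: skew23_def)
    next
      case (2 i l)
      have l: "l \<in> N4" "l \<noteq> 0" using 2 by auto
      then show ?thesis using nz(2)[OF 2(2) l(1)] by (simp add: no_0_def 2(1) del: One_nat_def)
    next
      case (3 i l)
      then show ?thesis using nz(3)[OF 3(2,3)] by simp
    qed
  qed
qed

lemma card_I2: "card I2 = 30"
  by (simp add: I2_def P3_def card_Plus card_cartesian_product)

definition I3 :: "(unit + nat \<times> nat) set" where "I3 = {()} <+> (N3 \<times> N3)"

definition basis3 :: "unit + nat \<times> nat \<Rightarrow> 'g \<Rightarrow> 'g \<Rightarrow> 'g \<Rightarrow> real" where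
  "basis3 s x y z = (case s of
      Inl _ \<Rightarrow> co 1 x * co 2 y * co 3 z - co 1 x * co 3 y * co 2 z +
        (co 2 x * co 3 y * co 1 z - co 2 x * co 1 y * co 3 z) +
        (co 3 x * co 1 y * co 2 z - co 3 x * co 2 y * co 1 z)
    | Inr (i, l) \<Rightarrow> co i x * \<omega> l (pr y) (pr z) - co i y * \<omega> l (pr x) (pr z) + co i z * \<omega> l (pr x) (pr y))"

definition levi_civita :: "nat \<Rightarrow> nat \<Rightarrow> nat \<Rightarrow> real" where
  "levi_civita i j k = (if (i, j, k) \<in> {(1, 2, 3), (2, 3, 1), (3, 1, 2)} then 1
     else if (i, j, k) \<in> {(1, 3, 2), (2, 1, 3), (3, 2, 1)} then - 1 else 0)"

lemma sum_basis3:
  "(\<Sum>s\<in>I3. d s * basis3 s x y z) =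
   normal_form (\<lambda>i j k. d (Inl ()) * levi_civita i j k) (no_0 (\<lambda>p. d (Inr p)))
     (\<lambda>i l. - no_0 (\<lambda>p. d (Inr p)) i l) (no_0 (\<lambda>p. d (Inr p))) x y z"
proof -
  have 1: "d (Inl ()) * basis3 (Inl ()) x y z =
    (\<Sum>i\<in>N3. \<Sum>j\<in>N3. \<Sum>k\<in>N3. d (Inl ()) * levi_civita i j k * (co i x * co j y * co k z))"
    by (simp add: sum_N3 basis3_def levi_civita_def algebra_simps del: One_nat_def)
  have 2: "(\<Sum>i\<in>N3. \<Sum>l\<in>N3. d (Inr (i, l)) * basis3 (Inr (i, l)) x y z) =
    (\<Sum>i\<in>N3. \<Sum>l\<in>N4. no_0 (\<lambda>p. d (Inr p)) i l * (co i x * \<omega> l (pr y) (pr z))) +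
    (\<Sum>i\<in>N3. \<Sum>l\<in>N4. - no_0 (\<lambda>p. d (Inr p)) i l * (co i y * \<omega> l (pr x) (pr z))) +
    (\<Sum>i\<in>N3. \<Sum>l\<in>N4. no_0 (\<lambda>p. d (Inr p)) i l * (co i z * \<omega> l (pr x) (pr y)))"
    by (simp add: sum_N3 sum_N4 basis3_def no_0_def algebra_simps del: One_nat_def)
  have "(\<Sum>s\<in>I3. d s * basis3 s x y z) = d (Inl ()) * basis3 (Inl ()) x y z +
      (\<Sum>i\<in>N3. \<Sum>l\<in>N3. d (Inr (i, l)) * basis3 (Inr (i, l)) x y z)"
    unfolding I3_def
    by (simp only: sum.Plus sum.cartesian_product' finite_Plus finite_cartesian_product
      finite_insert finite.emptyI o_def sum.insert sum.empty empty_iff add_0_right not_False_eq_True)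
  then show ?thesis
    unfolding normal_form_def 1 2 by (simp only: add.assoc)
qed

lemma form_basis3: "form_basis m alternating_123 I3 basis3"
  unfolding form_basis_def
proof (intro conjI ballI allI impI)
  show "finite I3" by (simp add: I3_def)
  show "alternating_123 (basis3 s)" if s: "s \<in> I3" for s
  proof (cases s)
    case (Inl u)
    note comb = invariant_trilinear_combination
    have "inv_form (\<lambda>x y z. co i x * co j y * co k z + (- 1) * (co i x * co k y * co j z))"
      if "i \<in> N3" "j \<in> N3" "k \<in> N3" for i j k
      by (rule comb[OF invariant_co_co_co[OF that] invariant_co_co_co[OF that(1,3,2)]])
    then have i: "inv_form (\<lambda>x y z. co i x * co j y * co k z - co i x * co k y * co j z)"
      if "i \<in> N3" "j \<in> N3" "k \<in> N3" for i j k
      using that by (simp del: One_nat_def insert_iff)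
    have "inv_form (basis3 s)"
      using comb[OF comb[OF i[of 1 2 3] i[of 2 3 1], of 1] i[of 3 1 2], of 1]
      by (simp add: basis3_def[abs_def] Inl del: One_nat_def)
    then show ?thesis
      by (simp add: alternating_123_def alternating_23_def basis3_def[abs_def] Inl algebra_simps del: One_nat_def)
  next
    case (Inr p)
    then obtain i l where il: "s = Inr (i, l)" "i \<in> N3" "l \<in> N3" using s by (auto simp: I3_def)
    have l: "l \<in> N4" using il by blast
    have "inv_form (basis3 s)"
      using invariant_trilinear_combination[OF invariant_trilinear_combination[OF
        invariant_co_\<omega>[OF il(2) l] invariant_co_\<omega>'(1)[OF il(2) l], of "- 1"]
        invariant_co_\<omega>'(2)[OF il(2) l], of 1]
      by (simp add: basis3_def[abs_def] il(1) del: One_nat_def)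
    then show ?thesis
      using \<omega>_alt[OF il(3)] pr_in_V
      by (simp add: alternating_123_def alternating_23_def basis3_def[abs_def] il(1) del: One_nat_def)
  qed
  show "\<exists>d. \<forall>x\<in>m. \<forall>y\<in>m. \<forall>z\<in>m. T x y z = (\<Sum>s\<in>I3. d s * basis3 s x y z)"
    if alt3: "alternating_123 T" for T
  proof -
    have alt: "alternating_23 T" using alt3 by (simp add: alternating_123_def)
    have T: "inv_form T" using alt by (simp add: alternating_23_def)
    have Vm: "y \<in> m" if "y \<in> V" for y using that V by auto
    from form_coefficients(1)[OF T] obtain c
      where "\<forall>i\<in>N3. \<forall>y\<in>V. \<forall>z\<in>V. T (e i) y z = (\<Sum>l\<in>N4. c i l * \<omega> l y z)" ..
    note c = this[rule_format]
    have c': "T y (e i) z = (\<Sum>l\<in>N4. - c i l * \<omega> l y z)" if "i \<in> N3" "y \<in> V" "z \<in> V" for i y z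
      using swap_12[OF alt3 Vm[OF that(2)] e[OF that(1)] Vm[OF that(3)]] c[OF that]
      by (simp add: sum_negf del: One_nat_def)
    have c'': "T y z (e i) = (\<Sum>l\<in>N4. c i l * \<omega> l y z)" if "i \<in> N3" "y \<in> V" "z \<in> V" for i y z
      using swap_23[OF alt Vm[OF that(2)] Vm[OF that(3)] e[OF that(1)]] c'[OF that]
      by (simp add: sum_negf del: One_nat_def)
    have c0: "c i 0 = 0" if "i \<in> N3" for i
      by (rule coefficient_0_vanishes[OF c[OF that]])
        (use alt Vm e[OF that] in \<open>auto simp: alternating_23_def\<close>)
    let ?t = "T (e 1) (e 2) (e 3)"
    have em: "e 1 \<in> m" "e 2 \<in> m" "e 3 \<in> m" using e by auto
    have t: "T (e i) (e j) (e k) = ?t * levi_civita i j k" if ijk: "i \<in> N3" "j \<in> N3" "k \<in> N3" for i j k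
    proof -
      have 23: "T (e i) (e j) (e j) = 0" and 12: "T (e i) (e i) (e j) = 0"
        if "i \<in> N3" "j \<in> N3" for i j
        using alt3 e[OF that(1)] e[OF that(2)] by (auto simp: alternating_123_def alternating_23_def)
      have 13: "T (e i) (e j) (e i) = 0" if "i \<in> N3" "j \<in> N3" for i j
        using swap_23[OF alt e[OF that(1)] e[OF that(2)] e[OF that(1)]] 12[OF that] by simp
      have perms: "T (e 1) (e 3) (e 2) = - ?t" "T (e 2) (e 1) (e 3) = - ?t"
        "T (e 2) (e 3) (e 1) = ?t" "T (e 3) (e 1) (e 2) = ?t" "T (e 3) (e 2) (e 1) = - ?t"
        using swap_23[OF alt em(1,3,2)] swap_12[OF alt3 em(2,1,3)] swap_23[OF alt em(2,3,1)]
          swap_12[OF alt3 em(3,1,2)] swap_23[OF alt em(3,2,1)] by auto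
      show ?thesis
        using ijk
        by (elim insertE emptyE; simp add: levi_civita_def perms 23 12 13 del: One_nat_def)
    qed
    let ?d = "\<lambda>s :: unit + nat \<times> nat. case s of Inl _ \<Rightarrow> ?t | Inr (i, l) \<Rightarrow> c i l"
    have "T x y z = (\<Sum>s\<in>I3. ?d s * basis3 s x y z)" if "x \<in> m" "y \<in> m" "z \<in> m" for x y z
    proof -
      have "T x y z = normal_form (\<lambda>i j k. T (e i) (e j) (e k)) c (\<lambda>i l. - c i l) c x y z"
        by (rule invariant_form_expansion[OF T c c' c'' that])
      also have "\<dots> = normal_form (\<lambda>i j k. ?d (Inl ()) * levi_civita i j k) (no_0 (\<lambda>p. ?d (Inr p)))
         (\<lambda>i l. - no_0 (\<lambda>p. ?d (Inr p)) i l) (no_0 (\<lambda>p. ?d (Inr p))) x y z"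
      proof (rule normal_form_cong)
        fix i j k assume "i \<in> N3" "j \<in> N3" "k \<in> N3"
        from t[OF this] show "T (e i) (e j) (e k) = ?d (Inl ()) * levi_civita i j k"
          by (simp only: sum.case)
      qed (use c0 in \<open>auto simp: no_0_def simp del: One_nat_def\<close>)
      also have "\<dots> = (\<Sum>s\<in>I3. ?d s * basis3 s x y z)" by (rule sum_basis3[symmetric])
      finally show ?thesis .
    qed
    then show ?thesis by (intro exI[of _ ?d] ballI)
  qed
  show "d s = 0" if zero: "\<forall>x\<in>m. \<forall>y\<in>m. \<forall>z\<in>m. (\<Sum>s\<in>I3. d s * basis3 s x y z) = 0" and s: "s \<in> I3" for d s
  proof -
    note nz = normal_form_zero[OF zero[unfolded sum_basis3]]
    show ?thesis
    proof (cases s)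
      case (Inl u)
      then show ?thesis using nz(1)[of 1 2 3] by (simp add: levi_civita_def)
    next
      case (Inr p)
      then obtain i l where il: "s = Inr (i, l)" "i \<in> N3" "l \<in> N3" using s by (auto simp: I3_def)
      have l: "l \<in> N4" "l \<noteq> 0" using il by auto
      then show ?thesis using nz(2)[OF il(2) l(1)] by (simp add: no_0_def il(1) del: One_nat_def)
    qed
  qed
qed

lemma card_I3: "card I3 = 10"
  by (simp add: I3_def card_Plus card_cartesian_product)

end

section \<open>Homomorphisms as trilinear forms\<close>

lemma subspace_hom_space:
  fixes scU :: "'k::field \<Rightarrow> 'u::ab_group_add \<Rightarrow> 'u" and scV :: "'k \<Rightarrow> 'v::ab_group_add \<Rightarrow> 'v"
  assumes V: "vspace scV V" and act: "\<And>x. x \<in> L \<Longrightarrow> linear_map scV V scV UNIV (actV x)"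
  shows "module.subspace (fun_scale scV) (hom_space L scU U actU scV V actV)"
proof -
  have vV: "vector_space scV" and sV: "module.subspace scV V" using V by (auto simp: vspace_def)
  interpret V: vector_space scV by (rule vV)
  interpret F: vector_space "fun_scale scV :: 'k \<Rightarrow> ('u \<Rightarrow> 'v) \<Rightarrow> _" by (rule vector_space_fun_scale[OF vV])
  have act0: "actV x 0 = 0" if "x \<in> L" for x
    by (rule linear_map_0[OF V vV act[OF that]])
  show ?thesis
    unfolding F.subspace_def
  proof (intro conjI ballI allI)
    show "0 \<in> hom_space L scU U actU scV V actV"
      using V.subspace_0[OF sV] act0 by (simp add: hom_space_def linear_map_def)
  next
    fix f g assume fg: "f \<in> hom_space L scU U actU scV V actV" "g \<in> hom_space L scU U actU scV V actV"
    have V': "f x \<in> V" "g x \<in> V" if "x \<in> U" for x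
      using fg that by (auto simp: hom_space_def linear_map_def)
    have "actV x (f u + g u) = actV x (f u) + actV x (g u)" if "x \<in> L" "u \<in> U" for x u
      by (rule linear_map_plus[OF act[OF that(1)] V'[OF that(2)]])
    then show "f + g \<in> hom_space L scU U actU scV V actV"
      using fg V.subspace_add[OF sV]
      by (simp add: hom_space_def linear_map_def V.scale_right_distrib)
  next
    fix c f assume f: "f \<in> hom_space L scU U actU scV V actV"
    have V': "f x \<in> V" if "x \<in> U" for x using f that by (auto simp: hom_space_def linear_map_def)
    have "actV x (scV c (f u)) = scV c (actV x (f u))" if "x \<in> L" "u \<in> U" for x u
      by (rule linear_map_scale[OF act[OF that(1)] V'[OF that(2)]])
    then show "fun_scale scV c f \<in> hom_space L scU U actU scV V actV"
      using f V.subspace_scale[OF sV]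
      by (simp add: hom_space_def linear_map_def fun_scale_def V.scale_right_distrib mult.commute)
  qed
qed

text \<open>
  The three counts differ only in the evaluation \<open>ev\<close> that makes a form of a homomorphism, and in the
  symmetry \<open>K\<close> of the forms.
\<close>

lemma dim_eq_card_form_basis:
  fixes sc :: "real \<Rightarrow> 'v::ab_group_add \<Rightarrow> 'v"
  assumes fb: "form_basis m K I B"
    and sc: "vector_space sc" and S: "module.subspace sc S"
    and lin: "\<And>x y z. x \<in> m \<Longrightarrow> y \<in> m \<Longrightarrow> z \<in> m \<Longrightarrow> linear_map sc S (*) UNIV (ev x y z)"
    and sep: "\<And>F. F \<in> S \<Longrightarrow> (\<And>x y z. x \<in> m \<Longrightarrow> y \<in> m \<Longrightarrow> z \<in> m \<Longrightarrow> ev x y z F = 0) \<Longrightarrow> F = 0"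
    and ex: "\<And>T. K T \<Longrightarrow> \<exists>F\<in>S. \<forall>x\<in>m. \<forall>y\<in>m. \<forall>z\<in>m. ev x y z F = T x y z"
    and form: "\<And>F. F \<in> S \<Longrightarrow> K (\<lambda>x y z. ev x y z F)"
  shows "vector_space.dim sc S = card I"
proof (rule dim_eq_card_by_evaluation[where P = "m \<times> m \<times> m" and ev = "\<lambda>(x, y, z). ev x y z"
      and T = "\<lambda>i (x, y, z). B i x y z", OF sc S])
  show "finite I" using fb by (simp add: form_basis_def)
  show "linear_map sc S (*) UNIV ((\<lambda>(x, y, z). ev x y z) p)" if "p \<in> m \<times> m \<times> m" for p
    using that lin by auto
  show "F = 0" if "F \<in> S" "\<And>p. p \<in> m \<times> m \<times> m \<Longrightarrow> (\<lambda>(x, y, z). ev x y z) p F = 0" for F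
    using sep[OF that(1)] that(2) by fastforce
  show "\<exists>F\<in>S. \<forall>p\<in>m \<times> m \<times> m. (\<lambda>(x, y, z). ev x y z) p F = (\<lambda>i (x, y, z). B i x y z) i p"
    if "i \<in> I" for i
    using ex[of "B i"] fb that by (simp add: form_basis_def)
  show "\<exists>d. \<forall>p\<in>m \<times> m \<times> m. (\<lambda>(x, y, z). ev x y z) p F = (\<Sum>i\<in>I. d i * (\<lambda>i (x, y, z). B i x y z) i p)"
    if "F \<in> S" for F
    using form[OF that] fb by (simp add: form_basis_def)
  show "d i = 0" if "\<And>p. p \<in> m \<times> m \<times> m \<Longrightarrow> (\<Sum>i\<in>I. d i * (\<lambda>i (x, y, z). B i x y z) i p) = 0" "i \<in> I" for d i
  proof -
    have "\<forall>x\<in>m. \<forall>y\<in>m. \<forall>z\<in>m. (\<Sum>i\<in>I. d i * B i x y z) = 0"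
    proof (intro ballI)
      fix x y z assume "x \<in> m" "y \<in> m" "z \<in> m"
      then show "(\<Sum>i\<in>I. d i * B i x y z) = 0" using that(1)[of "(x, y, z)"] by simp
    qed
    then show ?thesis using fb that(2) unfolding form_basis_def by blast
  qed
qed

lemma dual_action_add: "dual_action P D (T + T') = dual_action P D T + dual_action P D T'"
  and dual_action_scale: "dual_action P D (dual_scale c T) = dual_scale c (dual_action P D T)"
  by (auto simp: dual_action_def fun_scale_def fun_eq_iff)

lemma dual_action_linear: "linear_map dual_scale X dual_scale UNIV (dual_action P D)"
  by (simp only: linear_map_def dual_action_add dual_action_scale) simp

lemma vector_space_dual: "vector_space (dual_scale :: 'k::field \<Rightarrow> (('x \<Rightarrow> 'k) \<Rightarrow> 'k) \<Rightarrow> _)"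
  by (rule vector_space_fun_scale) simp

lemma vspace_dual: "vspace (dual_scale :: 'k::field \<Rightarrow> (('x \<Rightarrow> 'k) \<Rightarrow> 'k) \<Rightarrow> _) UNIV"
proof -
  interpret D: vector_space "dual_scale :: 'k \<Rightarrow> (('x \<Rightarrow> 'k) \<Rightarrow> 'k) \<Rightarrow> _" by (rule vector_space_dual)
  show ?thesis by (simp add: vspace_def vector_space_dual)
qed

context isotropy_module
begin

text \<open>
  An invariant inner product on all of \<open>m\<close>; the choice on the trivial part is arbitrary.
\<close>

definition ip :: "'g \<Rightarrow> 'g \<Rightarrow> real" where
  "ip x y = (\<Sum>i\<in>N3. co i x * co i y) + \<omega> 0 (pr x) (pr y)"

lemma ip_sym: "x \<in> m \<Longrightarrow> y \<in> m \<Longrightarrow> ip x y = ip y x"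
  using \<omega>0_sym pr_in_V by (simp add: ip_def mult.commute)

lemma ip_linear:
  assumes x: "x \<in> m"
  shows "linear_map scaleR m (*) UNIV (ip x)"
proof -
  have "linear_map scaleR m (*) UNIV (\<lambda>y. \<omega> 0 (pr x) (pr y))"
    by (rule linear_map_compose[OF pr \<omega>_linear(2)[OF _ pr_in_V[OF x]]]) simp
  then show ?thesis
    using co[of 1] co[of 2] co[of 3]
    by (simp add: linear_map_def ip_def sum_N3 algebra_simps del: One_nat_def)
qed

lemma ip_linear':
  assumes y: "y \<in> m"
  shows "linear_map scaleR m (*) UNIV (\<lambda>x. ip x y)"
  using ip_linear[OF y] ip_sym[OF _ y] m(1)
  by (simp add: linear_map_def subspace_add subspace_scale)

lemma ip_pos:
  assumes x: "x \<in> m" "x \<noteq> 0"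
  shows "ip x x > 0"
proof (cases "pr x = 0")
  case False
  have "\<omega> 0 (pr x) (pr x) > 0" by (rule \<omega>0_pos[OF pr_in_V[OF x(1)] False])
  moreover have "(\<Sum>i\<in>N3. co i x * co i x) \<ge> 0" by (intro sum_nonneg) simp
  ultimately show ?thesis unfolding ip_def by linarith
next
  case True
  have "\<exists>i\<in>N3. co i x \<noteq> 0"
  proof (rule ccontr)
    assume "\<not> ?thesis"
    then have "(\<Sum>i\<in>N3. co i x *\<^sub>R e i) = 0" by (intro sum.neutral) simp
    then show False using decomp[OF x(1)] True x(2) by simp
  qed
  then obtain i where i: "i \<in> N3" "co i x \<noteq> 0" by blast
  have "(\<Sum>i\<in>N3. co i x * co i x) > 0"
    by (rule sum_pos2[of _ i]) (use i in \<open>auto simp: not_sum_squares_lt_zero zero_less_mult_iff\<close>)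
  moreover have "\<omega> 0 (pr x) (pr x) = 0"
    using linear_map_0[OF _ vector_space_mult \<omega>_linear(1)[OF _ pr_in_V[OF x(1)]], of 0] V(1) True by simp
  ultimately show ?thesis unfolding ip_def by linarith
qed

lemma ip_invariant:
  assumes "a \<in> h" "x \<in> m" "y \<in> m"
  shows "ip (br a x) y + ip x (br a y) = 0"
proof -
  have 0: "0 \<in> N4" by simp
  have "\<omega> 0 (br a (pr x)) (pr y) + \<omega> 0 (pr x) (br a (pr y)) = 0"
    using \<omega>[OF 0] assms pr_in_V by (simp add: invariant_bilinear_def)
  then show ?thesis using assms by (simp add: ip_def co_br pr_br)
qed

definition frame :: "'g set" where
  "frame = (SOME E. finite E \<and> E \<subseteq> m \<and> (\<forall>x\<in>m. x = (\<Sum>u\<in>E. ip x u *\<^sub>R u)))"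

lemma frame: "finite frame" "frame \<subseteq> m" "x \<in> m \<Longrightarrow> x = (\<Sum>u\<in>frame. ip x u *\<^sub>R u)"
proof -
  have "\<exists>E. finite E \<and> E \<subseteq> m \<and> (\<forall>x\<in>m. x = (\<Sum>u\<in>E. ip x u *\<^sub>R u))"
    by (rule parseval_frame_exists[OF m(2) ip_sym ip_linear ip_pos])
  from someI_ex[OF this, folded frame_def]
  show "finite frame" "frame \<subseteq> m" "x \<in> m \<Longrightarrow> x = (\<Sum>u\<in>frame. ip x u *\<^sub>R u)" by blast+
qed

lemma frame_in: "u \<in> frame \<Longrightarrow> u \<in> m"
  using frame(2) by auto

lemma linear_frame:
  assumes f: "linear_map scaleR m (*) UNIV f" and x: "x \<in> m"
  shows "f x = (\<Sum>u\<in>frame. ip x u * f u)"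
proof -
  have "f x = f (\<Sum>u\<in>frame. ip x u *\<^sub>R u)" using frame(3)[OF x] by simp
  also have "\<dots> = (\<Sum>u\<in>frame. ip x u * f u)"
    by (rule linear_map_sum[OF _ vector_space_mult f]) (use m frame_in in auto)
  finally show ?thesis .
qed

lemma ip_separates: "x \<in> m \<Longrightarrow> (\<And>y. y \<in> m \<Longrightarrow> ip x y = 0) \<Longrightarrow> x = 0"
  using ip_pos[of x] by force

subsection \<open>Bilinear maps\<close>

text \<open>
  A homomorphism \<open>F\<close> from \<open>m \<otimes> m\<close> to \<open>m\<close> is the trilinear form \<open>(x, y, z) \<mapsto> \<langle>F (x \<otimes> y), z\<rangle>\<close>.  Invariance of the
  inner product makes equivariance of \<open>F\<close> the same as invariance of the form.
\<close>

abbreviation "TP \<equiv> tensor_product scaleR m scaleR m"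
abbreviation "pt \<equiv> pure_tensor scaleR m scaleR m"
abbreviation "TA a \<equiv> tensor_action scaleR m scaleR m (br a) (br a)"
abbreviation "Hom_TP \<equiv> hom_space h dual_scale TP TA scaleR m br"

lemma vm: "vspace scaleR m"
  using m by simp

lemma pt_in: "x \<in> m \<Longrightarrow> y \<in> m \<Longrightarrow> pt x y \<in> TP"
  using linear_map_mem[OF pure_tensor_linear_right[OF vm vm]] by blast

lemma TA_pt: "a \<in> h \<Longrightarrow> x \<in> m \<Longrightarrow> y \<in> m \<Longrightarrow> TA a (pt x y) = pt (br a x) y + pt x (br a y)"
  by (rule tensor_action_pure[OF br_lin br_lin])

lemma linear_map_TA: "linear_map dual_scale X dual_scale UNIV (TA a)"
  unfolding tensor_action_def by (rule dual_action_linear)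

lemma TA_step:
  assumes "a \<in> h" "x \<in> m" "y \<in> m"
  shows "TA a (dual_scale c (pt x y) + u) = dual_scale c (pt (br a x) y + pt x (br a y)) + TA a u"
proof -
  have "TA a (dual_scale c w + u) = dual_scale c (TA a w) + TA a u" for w
    unfolding tensor_action_def dual_action_add dual_action_scale ..
  then show ?thesis by (simp only: TA_pt[OF assms])
qed

lemma TP_induct [consumes 1, case_names zero step]:
  assumes "u \<in> TP" "Q 0"
    "\<And>c x y u. x \<in> m \<Longrightarrow> y \<in> m \<Longrightarrow> u \<in> TP \<Longrightarrow> Q u \<Longrightarrow> Q (dual_scale c (pt x y) + u)"
  shows "Q u"
proof -
  interpret D: vector_space "dual_scale :: real \<Rightarrow> (('g \<times> 'g \<Rightarrow> real) \<Rightarrow> real) \<Rightarrow> _"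
    by (rule vector_space_dual)
  have "u \<in> TP \<and> Q u"
    using assms(1) unfolding tensor_product_def
  proof (induction rule: D.span_induct_alt)
    case base
    show ?case using assms(2) D.span_zero by blast
  next
    case (step c x y)
    then obtain v w where x: "x = pt v w" "v \<in> m" "w \<in> m" by blast
    have "dual_scale c x + y \<in> D.span {pt v w | v w. v \<in> m \<and> w \<in> m}"
      by (rule D.span_add[OF D.span_scale[OF D.span_base[OF step(1)]] conjunct1[OF step(2)]])
    moreover have "Q (dual_scale c x + y)"
      using assms(3)[OF x(2,3)] step(2) unfolding x(1) tensor_product_def by blast
    ultimately show ?case by blast
  qed
  then show ?thesis ..
qed

lemma TP_subspace: "module.subspace dual_scale TP"
proof -
  interpret D: vector_space "dual_scale :: real \<Rightarrow> (('g \<times> 'g \<Rightarrow> real) \<Rightarrow> real) \<Rightarrow> _"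
    by (rule vector_space_dual)
  show ?thesis unfolding tensor_product_def by (rule D.subspace_span)
qed

lemma vspace_TP: "vspace dual_scale TP"
  using TP_subspace vector_space_dual by (simp add: vspace_def)

lemma TA_in:
  assumes a: "a \<in> h" and u: "u \<in> TP"
  shows "TA a u \<in> TP"
  using u
proof (induction rule: TP_induct)
  interpret D: vector_space "dual_scale :: real \<Rightarrow> (('g \<times> 'g \<Rightarrow> real) \<Rightarrow> real) \<Rightarrow> _"
    by (rule vector_space_dual)
  case zero
  have "TA a 0 = 0" by (rule linear_map_0[OF vspace_TP vector_space_dual linear_map_TA])
  then show ?case using D.subspace_0[OF TP_subspace] by (simp only:)
next
  interpret D: vector_space "dual_scale :: real \<Rightarrow> (('g \<times> 'g \<Rightarrow> real) \<Rightarrow> real) \<Rightarrow> _"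
    by (rule vector_space_dual)
  case (step c x y u)
  have "pt (br a x) y + pt x (br a y) \<in> TP"
    by (rule D.subspace_add[OF TP_subspace]) (use step a in \<open>auto intro!: pt_in br_in_m\<close>)
  then show ?case
    unfolding TA_step[OF a step(1,2)]
    by (rule D.subspace_add[OF TP_subspace D.subspace_scale[OF TP_subspace] step.IH])
qed

lemma Hom_TP_form:
  assumes F: "F \<in> Hom_TP"
  shows "inv_form (\<lambda>x y z. ip (F (pt x y)) z)"
proof -
  have Flin: "linear_map dual_scale TP scaleR m F"
    and Fact: "\<And>a u. a \<in> h \<Longrightarrow> u \<in> TP \<Longrightarrow> F (TA a u) = br a (F u)"
    using F by (auto simp: hom_space_def)
  have 1: "linear_map scaleR m (*) UNIV (\<lambda>z. ip (F (pt z x)) y)"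
    "linear_map scaleR m (*) UNIV (\<lambda>z. ip (F (pt x z)) y)"
    "linear_map scaleR m (*) UNIV (\<lambda>z. ip (F (pt x y)) z)" if "x \<in> m" "y \<in> m" for x y
    using linear_map_compose[OF linear_map_compose[OF pure_tensor_linear_left[OF vm vm that(1)] Flin] ip_linear'[OF that(2)]]
      linear_map_compose[OF linear_map_compose[OF pure_tensor_linear_right[OF vm vm that(1)] Flin] ip_linear'[OF that(2)]]
      ip_linear[OF linear_map_mem[OF Flin pt_in[OF that]]] by auto
  have "ip (F (pt (br a x) y)) z + ip (F (pt x (br a y))) z + ip (F (pt x y)) (br a z) = 0"
    if "a \<in> h" "x \<in> m" "y \<in> m" "z \<in> m" for a x y z
  proof -
    have in_T: "pt (br a x) y \<in> TP" "pt x (br a y) \<in> TP"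
      using that by (auto intro!: pt_in br_in_m)
    have "br a (F (pt x y)) = F (pt (br a x) y) + F (pt x (br a y))"
      using Fact[OF that(1) pt_in[OF that(2,3)]] TA_pt[OF that(1,2,3)]
        linear_map_plus[OF Flin in_T] by simp
    then have "ip (F (pt (br a x) y)) z + ip (F (pt x (br a y))) z = ip (br a (F (pt x y))) z"
      using linear_map_plus[OF ip_linear'[OF that(4)] linear_map_mem[OF Flin in_T(1)] linear_map_mem[OF Flin in_T(2)]]
      by simp
    then show ?thesis
      using ip_invariant[OF that(1) linear_map_mem[OF Flin pt_in[OF that(2,3)]] that(4)] by simp
  qed
  with 1 show ?thesis by (auto simp: invariant_trilinear_def trilinear_on_def)
qed

text \<open>
  The bilinear map with a given form is \<open>b x y = \<Sum>u. T x y u \<cdot> u\<close>, summed over a Parseval frame; it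
  factors through the tensor product.
\<close>

lemma Hom_TP_exists:
  assumes T: "inv_form T"
  shows "\<exists>F\<in>Hom_TP. \<forall>x\<in>m. \<forall>y\<in>m. \<forall>z\<in>m. ip (F (pt x y)) z = T x y z"
proof -
  note lin = invariant_trilinear_linear[OF T]
  define b where "b x y = (\<Sum>u\<in>frame. T x y u *\<^sub>R u)" for x y
  have b_in: "b x y \<in> m" for x y
    unfolding b_def using m(1) frame_in by (intro subspace_sum subspace_scale) auto
  have ipb: "ip (b x y) z = T x y z" if "x \<in> m" "y \<in> m" "z \<in> m" for x y z
  proof -
    have "ip z (b x y) = (\<Sum>u\<in>frame. T x y u * ip z u)"
      unfolding b_def by (rule linear_map_sum[OF vm vector_space_mult ip_linear[OF that(3)]]) (rule frame_in)
    also have "\<dots> = T x y z" using linear_frame[OF lin(3)[OF that(1,2)] that(3)] by (simp add: mult.commute)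
    finally show ?thesis using ip_sym[OF b_in that(3)] by simp
  qed
  have "bilinear_map scaleR m scaleR m scaleR UNIV b"
    using lin(1)[OF _ frame_in] lin(2)[OF _ frame_in]
    by (auto simp: bilinear_map_def linear_map_def b_def scaleR_left_distrib sum.distrib scaleR_sum_right)
  from tensor_product_universal[OF real_vector.vector_space_axioms this]
  obtain f where f: "linear_map dual_scale UNIV scaleR UNIV f" and fb: "\<And>x y. f (pt x y) = b x y"
    by blast
  have fadd: "f (u + v) = f u + f v" and fsc: "f (dual_scale c u) = c *\<^sub>R f u" for u v c
    using linear_map_plus[OF f] linear_map_scale[OF f] by auto
  have f0: "f 0 = 0" by (rule linear_map_0[OF vspace_dual real_vector.vector_space_axioms f])
  have f_in: "f u \<in> m" if "u \<in> TP" for u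
    using that
  proof (induction rule: TP_induct)
    case zero
    show ?case using f0 m(1) by (simp only: subspace_0)
  next
    case (step c x y u)
    then show ?case unfolding fadd fsc fb using b_in m(1) by (intro subspace_add subspace_scale) auto
  qed
  have f_act: "f (TA a u) = br a (f u)" if a: "a \<in> h" and u: "u \<in> TP" for a u
    using u
  proof (induction rule: TP_induct)
    case zero
    have "TA a 0 = 0" by (rule linear_map_0[OF vspace_TP vector_space_dual linear_map_TA])
    moreover have "br a 0 = 0" by (rule linear_map_0[OF vm real_vector.vector_space_axioms br_lin[OF a]])
    ultimately show ?case by (simp only: f0)
  next
    case (step c x y u)
    have *: "b (br a x) y + b x (br a y) = br a (b x y)"
    proof -
      have in_m: "br a x \<in> m" "br a y \<in> m" "br a (b x y) \<in> m" "b (br a x) y + b x (br a y) \<in> m"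
        using step a b_in m(1) by (auto intro!: br_in_m subspace_add)
      have "b (br a x) y + b x (br a y) - br a (b x y) = 0"
      proof (rule ip_separates)
        show d: "b (br a x) y + b x (br a y) - br a (b x y) \<in> m"
          using in_m m(1) subspace_diff by blast
        fix z assume z: "z \<in> m"
        have "ip (b (br a x) y + b x (br a y)) z = T (br a x) y z + T x (br a y) z"
          using linear_map_plus[OF ip_linear'[OF z] b_in b_in] ipb in_m step z by simp
        moreover have "ip (br a (b x y)) z = - T x y (br a z)"
          using ip_invariant[OF a b_in z, of x y] ipb[OF step(1,2) br_in_m[OF a z]] by simp
        moreover have "T (br a x) y z + T x (br a y) z + T x y (br a z) = 0"
          using T a step z unfolding invariant_trilinear_def by blast
        moreover have "ip (b (br a x) y + b x (br a y)) z =
            ip (b (br a x) y + b x (br a y) - br a (b x y)) z + ip (br a (b x y)) z"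
          using linear_map_plus[OF ip_linear'[OF z] d in_m(3)] by simp
        ultimately show "ip (b (br a x) y + b x (br a y) - br a (b x y)) z = 0" by simp
      qed
      then show ?thesis by simp
    qed
    have "f (TA a (dual_scale c (pt x y) + u)) = c *\<^sub>R br a (b x y) + br a (f u)"
      by (simp only: TA_step[OF a step(1,2)] fadd fsc fb * step.IH)
    also have "\<dots> = br a (c *\<^sub>R b x y + f u)"
      unfolding linear_map_plus[OF br_lin[OF a] subspace_scale[OF m(1) b_in] f_in[OF step(3)]]
        linear_map_scale[OF br_lin[OF a] b_in] ..
    finally show ?case by (simp only: fadd fsc fb)
  qed
  \<comment> \<open>elements of the space of homomorphisms vanish outside the carrier\<close>
  define F where "F u = (if u \<in> TP then f u else 0)" for u
  have "F \<in> Hom_TP"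
    unfolding hom_space_def linear_map_def
  proof (safe; unfold F_def)
    interpret D: vector_space "dual_scale :: real \<Rightarrow> (('g \<times> 'g \<Rightarrow> real) \<Rightarrow> real) \<Rightarrow> _"
      by (rule vector_space_dual)
    fix u v c assume "u \<in> TP"
    show "(if u \<in> TP then f u else 0) \<in> m" using \<open>u \<in> TP\<close> f_in by simp
    show "(if u + v \<in> TP then f (u + v) else 0) = (if u \<in> TP then f u else 0) + (if v \<in> TP then f v else 0)"
      if "v \<in> TP" using D.subspace_add[OF TP_subspace \<open>u \<in> TP\<close> that] \<open>u \<in> TP\<close> that fadd by (simp only: if_True)
    show "(if dual_scale c u \<in> TP then f (dual_scale c u) else 0) = c *\<^sub>R (if u \<in> TP then f u else 0)"
      using D.subspace_scale[OF TP_subspace \<open>u \<in> TP\<close>] \<open>u \<in> TP\<close> fsc by (simp only: if_True)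
    show "(if TA a u \<in> TP then f (TA a u) else 0) = br a (if u \<in> TP then f u else 0)" if "a \<in> h" for a
      using TA_in[OF that \<open>u \<in> TP\<close>] \<open>u \<in> TP\<close> f_act[OF that] by (simp only: if_True)
  qed auto
  moreover have "ip (F (pt x y)) z = T x y z" if "x \<in> m" "y \<in> m" "z \<in> m" for x y z
    using ipb[OF that] pt_in[OF that(1,2)] by (simp only: F_def fb if_True)
  ultimately show ?thesis by blast
qed

lemma dim_Hom_TP: "hom_dim h dual_scale TP TA scaleR m br = 63"
  unfolding hom_dim_def
proof (subst dim_eq_card_form_basis[OF form_basis1, where ev = "\<lambda>x y z F. ip (F (pt x y)) z"])
  show "vector_space (fun_scale scaleR :: real \<Rightarrow> ('z \<Rightarrow> 'g) \<Rightarrow> _)"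
    by (rule vector_space_fun_scale[OF real_vector.vector_space_axioms])
  show "module.subspace (fun_scale scaleR) Hom_TP"
    by (rule subspace_hom_space[OF vm]) (use br_lin in \<open>auto simp: linear_map_def\<close>)
  show "linear_map (fun_scale scaleR) Hom_TP (*) UNIV (\<lambda>F. ip (F (pt x y)) z)"
    if "x \<in> m" "y \<in> m" "z \<in> m" for x y z
  proof -
    have "F (pt x y) \<in> m" if "F \<in> Hom_TP" for F
    proof (rule linear_map_mem[OF _ pt_in[OF \<open>x \<in> m\<close> \<open>y \<in> m\<close>]])
      show "linear_map dual_scale TP scaleR m F" using that by (simp add: hom_space_def)
    qed
    then show ?thesis
      using linear_map_plus[OF ip_linear'[OF \<open>z \<in> m\<close>]] linear_map_scale[OF ip_linear'[OF \<open>z \<in> m\<close>]]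
      by (simp add: linear_map_def fun_scale_def)
  qed
  show "F = 0" if F: "F \<in> Hom_TP" and zero: "\<And>x y z. x \<in> m \<Longrightarrow> y \<in> m \<Longrightarrow> z \<in> m \<Longrightarrow> ip (F (pt x y)) z = 0" for F
  proof
    have Flin: "linear_map dual_scale TP scaleR m F" and F0: "\<And>u. u \<notin> TP \<Longrightarrow> F u = 0"
      using F by (auto simp: hom_space_def)
    have pt0: "F (pt x y) = 0" if "x \<in> m" "y \<in> m" for x y
      by (rule ip_separates[OF linear_map_mem[OF Flin pt_in[OF that]] zero[OF that]])
    fix u
    have "F u = 0" if "u \<in> TP"
      using that
    proof (induction rule: TP_induct)
      case zero
      show ?case by (rule linear_map_0[OF vspace_TP real_vector.vector_space_axioms Flin])
    next
      interpret D: vector_space "dual_scale :: real \<Rightarrow> (('g \<times> 'g \<Rightarrow> real) \<Rightarrow> real) \<Rightarrow> _"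
        by (rule vector_space_dual)
      case (step c x y u)
      have "pt x y \<in> TP" by (rule pt_in[OF step(1,2)])
      from linear_map_plus[OF Flin D.subspace_scale[OF TP_subspace this] step(3)]
        linear_map_scale[OF Flin this] pt0[OF step(1,2)] step.IH
      show ?case by (simp only: scaleR_zero_right add_0_right)
    qed
    then show "F u = 0 u" using F0[of u] by auto
  qed
  show "\<exists>F\<in>Hom_TP. \<forall>x\<in>m. \<forall>y\<in>m. \<forall>z\<in>m. ip (F (pt x y)) z = T x y z" if "inv_form T" for T
    by (rule Hom_TP_exists[OF that])
  show "inv_form (\<lambda>x y z. ip (F (pt x y)) z)" if "F \<in> Hom_TP" for F
    by (rule Hom_TP_form[OF that])
  show "card I1 = 63" by (rule card_I1)
qed

end

subsection \<open>Exterior powers\<close>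

lemma exterior_power_induct [consumes 1, case_names zero step]:
  fixes sc :: "'a::field \<Rightarrow> 'b::ab_group_add \<Rightarrow> 'b"
  assumes "u \<in> exterior_power sc V k" "Q 0"
    "\<And>c xs u. set xs \<subseteq> V \<Longrightarrow> length xs = k \<Longrightarrow> u \<in> exterior_power sc V k \<Longrightarrow> Q u \<Longrightarrow>
      Q (dual_scale c (wedge sc V k xs) + u)"
  shows "Q u"
proof -
  interpret D: vector_space "dual_scale :: 'a \<Rightarrow> (('b list \<Rightarrow> 'a) \<Rightarrow> 'a) \<Rightarrow> _"
    by (rule vector_space_dual)
  have "u \<in> exterior_power sc V k \<and> Q u"
    using assms(1) unfolding exterior_power_def
  proof (induction rule: D.span_induct_alt)
    case base
    show ?case using assms(2) D.span_zero by blast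
  next
    case (step c x y)
    then obtain xs where x: "x = wedge sc V k xs" "set xs \<subseteq> V" "length xs = k" by blast
    have "dual_scale c x + y \<in> D.span {wedge sc V k xs | xs. set xs \<subseteq> V \<and> length xs = k}"
      by (rule D.span_add[OF D.span_scale[OF D.span_base[OF step(1)]] conjunct1[OF step(2)]])
    moreover have "Q (dual_scale c x + y)"
      using assms(3)[OF x(2,3)] step(2) unfolding x(1) exterior_power_def by blast
    ultimately show ?case by blast
  qed
  then show ?thesis ..
qed

lemma exterior_power_subspace:
  fixes sc :: "'a::field \<Rightarrow> 'b::ab_group_add \<Rightarrow> 'b"
  shows "module.subspace dual_scale (exterior_power sc V k)"
proof -
  interpret D: vector_space "dual_scale :: 'a \<Rightarrow> (('b list \<Rightarrow> 'a) \<Rightarrow> 'a) \<Rightarrow> _"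
    by (rule vector_space_dual)
  show ?thesis unfolding exterior_power_def by (rule D.subspace_span)
qed

lemma vspace_exterior_power: "vspace dual_scale (exterior_power sc V k)"
  unfolding vspace_def by (intro conjI vector_space_dual exterior_power_subspace)

lemma wedge_in_exterior_power:
  fixes sc :: "'a::field \<Rightarrow> 'b::ab_group_add \<Rightarrow> 'b"
  shows "set xs \<subseteq> V \<Longrightarrow> length xs = k \<Longrightarrow> wedge sc V k xs \<in> exterior_power sc V k"
proof -
  interpret D: vector_space "dual_scale :: 'a \<Rightarrow> (('b list \<Rightarrow> 'a) \<Rightarrow> 'a) \<Rightarrow> _"
    by (rule vector_space_dual)
  show "set xs \<subseteq> V \<Longrightarrow> length xs = k \<Longrightarrow> ?thesis"
    unfolding exterior_power_def by (rule D.span_base) blast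
qed

lemma alternating_forms_slot:
  assumes "\<beta> \<in> alternating_forms sc V k" "set xs \<subseteq> V" "length xs = k" "i < k"
  shows "linear_map sc V (*) UNIV (\<lambda>v. \<beta> (xs[i := v]))"
  using assms unfolding alternating_forms_def by blast

lemma alternating_forms_repeat:
  assumes "\<beta> \<in> alternating_forms sc V k" "set xs \<subseteq> V" "length xs = k"
    "i < k" "j < k" "i \<noteq> j" "xs ! i = xs ! j"
  shows "\<beta> xs = 0"
  using assms unfolding alternating_forms_def by blast

lemma exterior_power_outside:
  assumes "\<beta> \<notin> alternating_forms sc V k" "u \<in> exterior_power sc V k"
  shows "u \<beta> = 0"
  using assms(2)
  by (induction rule: exterior_power_induct) (use assms(1) in \<open>auto simp: fun_scale_def wedge_def evaluation_def\<close>)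

text \<open>
  An element of the exterior power is linear as a functional of the form, and only sees the values
  of the form on \<open>V\<close>.
\<close>

lemma exterior_power_linear:
  assumes u: "u \<in> exterior_power sc V k"
    and \<beta>: "\<beta> \<in> alternating_forms sc V k" and \<gamma>: "\<And>j. j \<in> J \<Longrightarrow> \<gamma> j \<in> alternating_forms sc V k"
    and eq: "\<And>xs. set xs \<subseteq> V \<Longrightarrow> length xs = k \<Longrightarrow> \<beta> xs = (\<Sum>j\<in>J. r j * \<gamma> j xs)"
  shows "u \<beta> = (\<Sum>j\<in>J. r j * u (\<gamma> j))"
  using u
proof (induction rule: exterior_power_induct)
  case zero
  then show ?case by simp
next
  case (step c xs u)
  have "wedge sc V k xs \<beta> = (\<Sum>j\<in>J. r j * wedge sc V k xs (\<gamma> j))"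
    using eq[OF step(1,2)] \<beta> \<gamma> by (simp add: wedge_def evaluation_def cong: sum.cong)
  then show ?case
    using step.IH by (simp add: fun_scale_def sum_distrib_left distrib_left sum.distrib mult.left_commute)
qed

lemma exterior_action_linear: "linear_map dual_scale X dual_scale UNIV (exterior_action sc V k f)"
  unfolding exterior_action_def by (rule dual_action_linear)

lemma set_list_update: "set xs \<subseteq> V \<Longrightarrow> v \<in> V \<Longrightarrow> set (xs[i := v]) \<subseteq> V"
  using set_update_subset_insert[of xs i v] by auto

lemma exterior_action_in:
  fixes sc :: "'a::field \<Rightarrow> 'b::ab_group_add \<Rightarrow> 'b"
  assumes V: "vspace sc V" and f: "linear_map sc V sc V f" and u: "u \<in> exterior_power sc V k"
  shows "exterior_action sc V k f u \<in> exterior_power sc V k"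
  using u
proof (induction rule: exterior_power_induct)
  interpret D: vector_space "dual_scale :: 'a \<Rightarrow> (('b list \<Rightarrow> 'a) \<Rightarrow> 'a) \<Rightarrow> _"
    by (rule vector_space_dual)
  case zero
  have "exterior_action sc V k f 0 = 0"
    by (rule linear_map_0[OF vspace_exterior_power vector_space_dual exterior_action_linear])
  then show ?case using D.subspace_0[OF exterior_power_subspace] by (simp only:)
next
  interpret D: vector_space "dual_scale :: 'a \<Rightarrow> (('b list \<Rightarrow> 'a) \<Rightarrow> 'a) \<Rightarrow> _"
    by (rule vector_space_dual)
  case (step c xs u)
  have "exterior_action sc V k f (dual_scale c (wedge sc V k xs) + u) =
      dual_scale c (exterior_action sc V k f (wedge sc V k xs)) + exterior_action sc V k f u"
    unfolding exterior_action_def dual_action_add dual_action_scale ..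
  moreover have "exterior_action sc V k f (wedge sc V k xs) \<in> exterior_power sc V k"
    unfolding exterior_action_wedge[OF V f step(1,2)]
  proof (rule D.subspace_sum[OF exterior_power_subspace])
    fix i assume "i \<in> {..<k}"
    then have "xs ! i \<in> V" using step(1,2) nth_mem by blast
    then have "f (xs ! i) \<in> V" by (rule linear_map_mem[OF f])
    then show "wedge sc V k (xs[i := f (xs ! i)]) \<in> exterior_power sc V k"
      using step(1,2) by (intro wedge_in_exterior_power set_list_update) auto
  qed
  ultimately show ?case
    using D.subspace_add[OF exterior_power_subspace D.subspace_scale[OF exterior_power_subspace] step.IH]
    by (simp only:)
qed

context isotropy_module
begin

abbreviation "Ext k \<equiv> exterior_power scaleR m k"
abbreviation "EA k a \<equiv> exterior_action scaleR m k (br a)"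
abbreviation "Alt k \<equiv> alternating_forms scaleR m k"
abbreviation "Hom_Ext2 \<equiv> hom_space h scaleR m br dual_scale (Ext 2) (EA 2)"
abbreviation "Hom_Ext3 \<equiv> hom_space h dual_scale (Ext 3) (EA 3) (*) (UNIV :: real set) (\<lambda>x c. 0)"

text \<open>The alternating form that pairs a bivector with \<open>y \<wedge> z\<close> by the inner product.\<close>

definition wedge_form :: "'g \<Rightarrow> 'g \<Rightarrow> 'g list \<Rightarrow> real" where
  "wedge_form y z xs = ip (xs ! 0) y * ip (xs ! 1) z - ip (xs ! 0) z * ip (xs ! 1) y"

lemma wedge_form_alternating:
  assumes yz: "y \<in> m" "z \<in> m"
  shows "wedge_form y z \<in> Alt 2"
proof -
  have "linear_map scaleR m (*) UNIV (\<lambda>v. wedge_form y z (xs[i := v]))"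
    if "length xs = 2" "i < 2" for xs i
  proof -
    have "i = 0 \<or> i = 1" using that by auto
    then show ?thesis
      using ip_linear'[OF yz(1)] ip_linear'[OF yz(2)] that
      by (auto simp: wedge_form_def linear_map_def algebra_simps)
  qed
  moreover have "wedge_form y z xs = 0"
    if "i < 2" "j < 2" "i \<noteq> j" "xs ! i = xs ! j" for xs i j
  proof -
    have "(i = 0 \<and> j = 1) \<or> (i = 1 \<and> j = 0)" using that by auto
    then show ?thesis using that by (auto simp: wedge_form_def)
  qed
  ultimately show ?thesis unfolding alternating_forms_def by blast
qed

lemma list_2:
  assumes "set xs \<subseteq> m" "length xs = 2"
  obtains u v where "xs = [u, v]" "u \<in> m" "v \<in> m"
  using assms by (auto simp: numeral_2_eq_2 length_Suc_conv)

lemma Ext2_wedge_form_linear: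
  assumes u: "u \<in> Ext 2" and z: "z \<in> m"
  shows "linear_map scaleR m (*) UNIV (\<lambda>y. u (wedge_form y z))"
    and "linear_map scaleR m (*) UNIV (\<lambda>y. u (wedge_form z y))"
proof -
  have sub: "x + y \<in> m" "r *\<^sub>R x \<in> m" if "x \<in> m" "y \<in> m" for x y r
    using that m(1) by (auto intro: subspace_add subspace_scale)
  have ipp: "ip x (y + y') = ip x y + ip x y'" and ips: "ip x (r *\<^sub>R y) = r * ip x y"
    if "x \<in> m" "y \<in> m" "y' \<in> m" for x y y' r
    using linear_map_plus[OF ip_linear] linear_map_scale[OF ip_linear] that by auto
  have skew: "u (wedge_form y z) = - u (wedge_form z y)" if y: "y \<in> m" for y
  proof -
    have "u (wedge_form y z) = (\<Sum>j\<in>{()}. - 1 * u (wedge_form z y))"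
      by (rule exterior_power_linear[OF u, where \<gamma> = "\<lambda>_. wedge_form z y" and r = "\<lambda>_. - 1"])
        (use y z in \<open>auto intro: wedge_form_alternating simp: wedge_form_def\<close>)
    then show ?thesis by simp
  qed
  have add: "u (wedge_form (y + y') z) = u (wedge_form y z) + u (wedge_form y' z)"
    if y: "y \<in> m" "y' \<in> m" for y y'
  proof -
    have "u (wedge_form (y + y') z) = (\<Sum>j\<in>(UNIV :: bool set). 1 * u (wedge_form (if j then y else y') z))"
    proof (rule exterior_power_linear[OF u])
      show "wedge_form (y + y') z \<in> Alt 2" by (rule wedge_form_alternating[OF sub(1)[OF y] z])
      show "wedge_form (if j then y else y') z \<in> Alt 2" for j
        using y z by (simp add: wedge_form_alternating)
      fix xs assume "set xs \<subseteq> m" "length xs = 2"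
      then obtain v w where "xs = [v, w]" "v \<in> m" "w \<in> m" by (rule list_2)
      then show "wedge_form (y + y') z xs = (\<Sum>j\<in>(UNIV :: bool set). 1 * wedge_form (if j then y else y') z xs)"
        using y z by (simp add: wedge_form_def ipp UNIV_bool algebra_simps)
    qed
    then show ?thesis by (simp add: UNIV_bool)
  qed
  have scale: "u (wedge_form (r *\<^sub>R y) z) = r * u (wedge_form y z)" if y: "y \<in> m" for y r
  proof -
    have "u (wedge_form (r *\<^sub>R y) z) = (\<Sum>j\<in>{()}. r * u (wedge_form y z))"
    proof (rule exterior_power_linear[OF u])
      show "wedge_form (r *\<^sub>R y) z \<in> Alt 2" by (rule wedge_form_alternating[OF sub(2)[OF y y] z])
      show "wedge_form y z \<in> Alt 2" by (rule wedge_form_alternating[OF y z])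
      fix xs assume "set xs \<subseteq> m" "length xs = 2"
      then obtain v w where "xs = [v, w]" "v \<in> m" "w \<in> m" by (rule list_2)
      then show "wedge_form (r *\<^sub>R y) z xs = (\<Sum>j\<in>{()}. r * wedge_form y z xs)"
        using y z by (simp add: wedge_form_def ips algebra_simps)
    qed
    then show ?thesis by simp
  qed
  show 1: "linear_map scaleR m (*) UNIV (\<lambda>y. u (wedge_form y z))"
    using add scale by (simp add: linear_map_def)
  show "linear_map scaleR m (*) UNIV (\<lambda>y. u (wedge_form z y))"
    using linear_map_plus[OF 1] linear_map_scale[OF 1] skew sub unfolding linear_map_def
    by (auto simp: algebra_simps)
qed

lemma Ext2_diagonal:
  assumes u: "u \<in> Ext 2" and z: "z \<in> m"
  shows "u (wedge_form z z) = 0"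
proof -
  have "u (wedge_form z z) = (\<Sum>j\<in>({} :: unit set). 0 * u (wedge_form z z))"
    by (rule exterior_power_linear[OF u wedge_form_alternating[OF z z]]) (auto simp: wedge_form_def)
  then show ?thesis by simp
qed

text \<open>
  An alternating form \<open>\<beta>\<close> is the combination of the forms of pairs of frame vectors \<open>a\<close>, \<open>b\<close>
  with coefficients \<open>\<beta> [a, b] / 2\<close>, so the values at these determine a bivector.
\<close>

lemma Ext2_separates:
  assumes u: "u \<in> Ext 2" and zero: "\<And>y z. y \<in> m \<Longrightarrow> z \<in> m \<Longrightarrow> u (wedge_form y z) = 0"
  shows "u = 0"
proof
  fix \<beta>
  show "u \<beta> = 0 \<beta>"
  proof (cases "\<beta> \<in> Alt 2")
    case False
    then show ?thesis using exterior_power_outside[OF _ u] by simp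
  next
    case True
    have "u \<beta> = (\<Sum>p\<in>frame \<times> frame. (\<beta> [fst p, snd p] / 2) * u (wedge_form (fst p) (snd p)))"
    proof (rule exterior_power_linear[OF u True])
      show "wedge_form (fst p) (snd p) \<in> Alt 2" if "p \<in> frame \<times> frame" for p
        using that frame_in by (auto intro: wedge_form_alternating)
      fix xs assume "set xs \<subseteq> m" "length xs = 2"
      then obtain v w where vw: "xs = [v, w]" "v \<in> m" "w \<in> m" by (rule list_2)
      have lin1: "linear_map scaleR m (*) UNIV (\<lambda>x. \<beta> [x, y])" if "y \<in> m" for y
      proof -
        have "linear_map scaleR m (*) UNIV (\<lambda>x. \<beta> ([y, y][0 := x]))"
          by (rule alternating_forms_slot[OF True]) (use that in auto)
        then show ?thesis by simp
      qed
      have lin2: "linear_map scaleR m (*) UNIV (\<lambda>x. \<beta> [y, x])" if "y \<in> m" for y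
      proof -
        have "linear_map scaleR m (*) UNIV (\<lambda>x. \<beta> ([y, y][1 := x]))"
          by (rule alternating_forms_slot[OF True]) (use that in auto)
        then show ?thesis by simp
      qed
      have expand: "\<beta> [v, w] = (\<Sum>a\<in>frame. \<Sum>b\<in>frame. \<beta> [a, b] * (ip v a * ip w b))"
        if vw: "v \<in> m" "w \<in> m" for v w
      proof -
        have "\<beta> [v, w] = (\<Sum>a\<in>frame. ip v a * \<beta> [a, w])"
          by (rule linear_frame[OF lin1[OF vw(2)] vw(1)])
        also have "\<dots> = (\<Sum>a\<in>frame. ip v a * (\<Sum>b\<in>frame. ip w b * \<beta> [a, b]))"
          using linear_frame[OF lin2[OF frame_in] vw(2)] by simp
        finally show ?thesis by (simp add: sum_distrib_left algebra_simps)
      qed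
      have skew: "\<beta> [w, v] = - \<beta> [v, w]"
        using alternating_forms_skew[OF True vm, of "[v, v]" 0 1 w v] vw by simp
      have "(\<Sum>p\<in>frame \<times> frame. (\<beta> [fst p, snd p] / 2) * wedge_form (fst p) (snd p) xs) =
        (\<Sum>a\<in>frame. \<Sum>b\<in>frame. (\<beta> [a, b] * (ip v a * ip w b)) / 2 - (\<beta> [a, b] * (ip w a * ip v b)) / 2)"
        unfolding sum.cartesian_product'
        by (intro sum.cong refl) (simp add: wedge_form_def vw(1) algebra_simps)
      also have "\<dots> = \<beta> [v, w] / 2 - \<beta> [w, v] / 2"
        unfolding expand[OF vw(2,3)] expand[OF vw(3,2)] by (simp add: sum_subtractf sum_divide_distrib)
      also have "\<dots> = \<beta> xs" using skew vw(1) by simp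
      finally show "\<beta> xs = (\<Sum>p\<in>frame \<times> frame. (\<beta> [fst p, snd p] / 2) * wedge_form (fst p) (snd p) xs)" ..
    qed
    also have "\<dots> = 0" using zero frame_in by (intro sum.neutral) auto
    finally show ?thesis by simp
  qed
qed

text \<open>
  The action on bivectors is the transpose of the one on forms, and the inner product is invariant, so
  the action moves to the vectors \<open>y\<close> and \<open>z\<close> with a sign.
\<close>

lemma EA_wedge_form:
  assumes a: "a \<in> h" and u: "u \<in> Ext 2" and yz: "y \<in> m" "z \<in> m"
  shows "EA 2 a u (wedge_form y z) = - u (wedge_form (br a y) z) - u (wedge_form y (br a z))"
proof -
  let ?D = "\<lambda>xs. \<Sum>i<2. wedge_form y z (xs[i := br a (xs ! i)])"
  have D: "?D \<in> Alt 2"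
    by (rule alternating_forms_derivation[OF vm br_lin[OF a] wedge_form_alternating[OF yz]])
  have b: "br a y \<in> m" "br a z \<in> m" using a yz by (auto intro: br_in_m)
  have "EA 2 a u (wedge_form y z) = u ?D"
    using wedge_form_alternating[OF yz] by (simp add: exterior_action_def dual_action_def)
  also have "u ?D = (\<Sum>j\<in>(UNIV :: bool set). - 1 * u (if j then wedge_form (br a y) z else wedge_form y (br a z)))"
  proof (rule exterior_power_linear[OF u D])
    show "(if j then wedge_form (br a y) z else wedge_form y (br a z)) \<in> Alt 2" for j
      using b yz by (simp add: wedge_form_alternating)
    fix xs assume "set xs \<subseteq> m" "length xs = 2"
    then obtain v w where vw: "xs = [v, w]" "v \<in> m" "w \<in> m" by (rule list_2)
    have "ip (br a v) y = - ip v (br a y)" "ip (br a v) z = - ip v (br a z)"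
      "ip (br a w) y = - ip w (br a y)" "ip (br a w) z = - ip w (br a z)"
      using ip_invariant[OF a] vw(2,3) yz by (auto simp: add_eq_0_iff2)
    then show "?D xs = (\<Sum>j\<in>(UNIV :: bool set). - 1 *
        (if j then wedge_form (br a y) z else wedge_form y (br a z)) xs)"
      by (simp add: vw(1) wedge_form_def UNIV_bool numeral_2_eq_2 algebra_simps)
  qed
  finally show ?thesis by (simp add: UNIV_bool)
qed

lemma Hom_Ext2_form:
  assumes F: "F \<in> Hom_Ext2"
  shows "alternating_23 (\<lambda>x y z. F x (wedge_form y z))"
proof -
  have Flin: "linear_map scaleR m dual_scale (Ext 2) F"
    and Fact: "\<And>a x. a \<in> h \<Longrightarrow> x \<in> m \<Longrightarrow> F (br a x) = EA 2 a (F x)"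
    using F by (auto simp: hom_space_def)
  have Fin: "F x \<in> Ext 2" if "x \<in> m" for x by (rule linear_map_mem[OF Flin that])
  have "linear_map scaleR m (*) UNIV (\<lambda>x. F x \<beta>)" for \<beta>
    using linear_map_plus[OF Flin] linear_map_scale[OF Flin]
    by (simp add: linear_map_def fun_scale_def)
  moreover have "F (br a x) (wedge_form y z) + F x (wedge_form (br a y) z) + F x (wedge_form y (br a z)) = 0"
    if "a \<in> h" "x \<in> m" "y \<in> m" "z \<in> m" for a x y z
    unfolding Fact[OF that(1,2)] EA_wedge_form[OF that(1) Fin[OF that(2)] that(3,4)] by simp
  ultimately show ?thesis
    using Ext2_wedge_form_linear[OF Fin] Ext2_diagonal[OF Fin]
    by (auto simp: alternating_23_def invariant_trilinear_def trilinear_on_def)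
qed

text \<open>
  The bivector \<open>f x\<close> is assembled from the values \<open>T x a b\<close> at vectors of the frame.  The factor \<open>1 / 2\<close> is
  there because \<open>(a, b)\<close> and \<open>(b, a)\<close> contribute equally.
\<close>

lemma Hom_Ext2_exists:
  assumes T: "alternating_23 T"
  shows "\<exists>F\<in>Hom_Ext2. \<forall>x\<in>m. \<forall>y\<in>m. \<forall>z\<in>m. F x (wedge_form y z) = T x y z"
proof -
  interpret D: vector_space "dual_scale :: real \<Rightarrow> (('g list \<Rightarrow> real) \<Rightarrow> real) \<Rightarrow> _"
    by (rule vector_space_dual)
  have inv: "inv_form T" using T by (simp add: alternating_23_def)
  note lin = invariant_trilinear_linear[OF inv]
  define f where "f x = (\<Sum>a\<in>frame. \<Sum>b\<in>frame. dual_scale (T x a b / 2) (wedge scaleR m 2 [a, b]))" for x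
  have f_in: "f x \<in> Ext 2" for x
    unfolding f_def using frame_in
    by (intro D.subspace_sum[OF exterior_power_subspace] D.subspace_scale[OF exterior_power_subspace]
        wedge_in_exterior_power) auto
  have fs: "f x \<beta> = (\<Sum>a\<in>frame. \<Sum>b\<in>frame. T x a b / 2 * wedge scaleR m 2 [a, b] \<beta>)" for x \<beta>
  proof -
    have s: "(\<Sum>a\<in>A. G a) \<beta> = (\<Sum>a\<in>A. G a \<beta>)" for A and G :: "'g \<Rightarrow> ('g list \<Rightarrow> real) \<Rightarrow> real"
      by (induction A rule: infinite_finite_induct) auto
    show ?thesis unfolding f_def s by (simp add: fun_scale_def)
  qed
  have fT: "f x (wedge_form y z) = T x y z" if xyz: "x \<in> m" "y \<in> m" "z \<in> m" for x y z
  proof -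
    have expand: "T x v w = (\<Sum>a\<in>frame. \<Sum>b\<in>frame. T x a b * (ip v a * ip w b))"
      if vw: "v \<in> m" "w \<in> m" for v w
    proof -
      have "T x v w = (\<Sum>a\<in>frame. ip v a * T x a w)"
        by (rule linear_frame[OF lin(2)[OF xyz(1) vw(2)] vw(1)])
      also have "\<dots> = (\<Sum>a\<in>frame. ip v a * (\<Sum>b\<in>frame. ip w b * T x a b))"
        using linear_frame[OF lin(3)[OF xyz(1) frame_in] vw(2)] by simp
      finally show ?thesis by (simp add: sum_distrib_left algebra_simps)
    qed
    have "f x (wedge_form y z) =
      (\<Sum>a\<in>frame. \<Sum>b\<in>frame. (T x a b * (ip y a * ip z b)) / 2 - (T x a b * (ip z a * ip y b)) / 2)"
      unfolding fs
    proof (intro sum.cong refl)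
      fix a b assume ab: "a \<in> frame" "b \<in> frame"
      have "ip a y = ip y a" "ip a z = ip z a" "ip b y = ip y b" "ip b z = ip z b"
        using ip_sym frame_in ab xyz by auto
      then show "T x a b / 2 * wedge scaleR m 2 [a, b] (wedge_form y z) =
          (T x a b * (ip y a * ip z b)) / 2 - (T x a b * (ip z a * ip y b)) / 2"
        using wedge_form_alternating[OF xyz(2,3)]
        by (simp add: wedge_def evaluation_def wedge_form_def algebra_simps)
    qed
    also have "\<dots> = T x y z / 2 - T x z y / 2"
      unfolding expand[OF xyz(2,3)] expand[OF xyz(3,2)] by (simp add: sum_subtractf sum_divide_distrib)
    also have "\<dots> = T x y z" using swap_23[OF T xyz] by simp
    finally show ?thesis .
  qed
  define F where "F x = (if x \<in> m then f x else 0)" for x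
  have Fadd: "f (x + y) = f x + f y" if "x \<in> m" "y \<in> m" for x y
    using linear_map_plus[OF lin(1)[OF frame_in frame_in] that]
    by (intro ext) (simp add: fs add_divide_distrib distrib_right sum.distrib)
  have Fscale: "f (c *\<^sub>R x) = dual_scale c (f x)" if "x \<in> m" for x c
    using linear_map_scale[OF lin(1)[OF frame_in frame_in] that]
    by (intro ext) (simp add: fs fun_scale_def sum_distrib_left mult.assoc)
  have Fact: "f (br a x) = EA 2 a (f x)" if a: "a \<in> h" and x: "x \<in> m" for a x
  proof -
    have "f (br a x) - EA 2 a (f x) = 0"
    proof (rule Ext2_separates)
      show "f (br a x) - EA 2 a (f x) \<in> Ext 2"
        by (rule D.subspace_diff[OF exterior_power_subspace f_in exterior_action_in[OF vm br_lin[OF a] f_in]])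
      fix y z assume yz: "y \<in> m" "z \<in> m"
      have "T (br a x) y z + T x (br a y) z + T x y (br a z) = 0"
        using inv a x yz unfolding invariant_trilinear_def by blast
      then show "(f (br a x) - EA 2 a (f x)) (wedge_form y z) = 0"
        using EA_wedge_form[OF a f_in yz] fT a x yz br_in_m by simp
    qed
    then show ?thesis by simp
  qed
  have "F \<in> Hom_Ext2"
    unfolding hom_space_def linear_map_def mem_Collect_eq
    using f_in Fadd Fscale Fact br_in_m m(1) by (simp add: F_def subspace_add subspace_scale)
  moreover have "F x (wedge_form y z) = T x y z" if "x \<in> m" "y \<in> m" "z \<in> m" for x y z
    using fT[OF that] that(1) by (simp add: F_def)
  ultimately show ?thesis by blast
qed

lemma dim_Hom_Ext2: "hom_dim h scaleR m br dual_scale (Ext 2) (EA 2) = 30"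
  unfolding hom_dim_def
proof (subst dim_eq_card_form_basis[OF form_basis2, where ev = "\<lambda>x y z F. F x (wedge_form y z)"])
  show "vector_space (fun_scale dual_scale :: real \<Rightarrow> ('g \<Rightarrow> ('g list \<Rightarrow> real) \<Rightarrow> real) \<Rightarrow> _)"
    by (rule vector_space_fun_scale[OF vector_space_dual])
  show "module.subspace (fun_scale dual_scale) Hom_Ext2"
    by (rule subspace_hom_space[OF vspace_exterior_power exterior_action_linear])
  show "linear_map (fun_scale dual_scale) Hom_Ext2 (*) UNIV (\<lambda>F. F x (wedge_form y z))" for x y z
    by (simp add: linear_map_def fun_scale_def)
  show "F = 0" if F: "F \<in> Hom_Ext2"
    and zero: "\<And>x y z. x \<in> m \<Longrightarrow> y \<in> m \<Longrightarrow> z \<in> m \<Longrightarrow> F x (wedge_form y z) = 0" for F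
  proof
    fix x
    have Flin: "linear_map scaleR m dual_scale (Ext 2) F" and F0: "x \<notin> m \<Longrightarrow> F x = 0"
      using F by (auto simp: hom_space_def)
    have "F x = 0" if "x \<in> m"
      by (rule Ext2_separates[OF linear_map_mem[OF Flin that] zero[OF that]])
    with F0 have "F x = 0" by blast
    then show "F x = 0 x" by simp
  qed
  show "\<exists>F\<in>Hom_Ext2. \<forall>x\<in>m. \<forall>y\<in>m. \<forall>z\<in>m. F x (wedge_form y z) = T x y z" if "alternating_23 T" for T
    by (rule Hom_Ext2_exists[OF that])
  show "alternating_23 (\<lambda>x y z. F x (wedge_form y z))" if "F \<in> Hom_Ext2" for F
    by (rule Hom_Ext2_form[OF that])
  show "card I2 = 30" by (rule card_I2)
qed

subsection \<open>Alternating trilinear forms\<close>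

abbreviation "wd x y z \<equiv> wedge scaleR m 3 [x, y, z]"

lemma wd_linear:
  assumes xy: "x \<in> m" "y \<in> m"
  shows "linear_map scaleR m dual_scale (Ext 3) (\<lambda>z. wd z x y)"
    "linear_map scaleR m dual_scale (Ext 3) (\<lambda>z. wd x z y)"
    "linear_map scaleR m dual_scale (Ext 3) (\<lambda>z. wd x y z)"
    and wd_diagonal: "wd x y y = 0" "wd x x y = 0"
proof -
  have \<beta>: "linear_map scaleR m (*) UNIV (\<lambda>v. \<beta> ([a, b, c][i := v]))"
    if "\<beta> \<in> Alt 3" "a \<in> m" "b \<in> m" "c \<in> m" "i < 3" for \<beta> a b c i
    by (rule alternating_forms_slot[OF that(1)]) (use that in auto)
  have in_Ext: "wd a b c \<in> Ext 3" if "a \<in> m" "b \<in> m" "c \<in> m" for a b c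
    using that by (intro wedge_in_exterior_power) auto
  show "linear_map scaleR m dual_scale (Ext 3) (\<lambda>z. wd z x y)"
    using \<beta>[OF _ xy(1) xy, of _ 0] in_Ext xy
    by (auto simp: linear_map_def wedge_def evaluation_def fun_scale_def fun_eq_iff)
  show "linear_map scaleR m dual_scale (Ext 3) (\<lambda>z. wd x z y)"
    using \<beta>[OF _ xy(1) xy(1) xy(2), of _ 1] in_Ext xy
    by (auto simp: linear_map_def wedge_def evaluation_def fun_scale_def fun_eq_iff)
  show "linear_map scaleR m dual_scale (Ext 3) (\<lambda>z. wd x y z)"
    using \<beta>[OF _ xy xy(2), of _ 2] in_Ext xy
    by (auto simp: linear_map_def wedge_def evaluation_def fun_scale_def fun_eq_iff)
  have \<beta>0: "\<beta> [a, b, c] = 0"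
    if "\<beta> \<in> Alt 3" "a \<in> m" "b \<in> m" "c \<in> m" "i < 3" "j < 3" "i \<noteq> j" "[a, b, c] ! i = [a, b, c] ! j"
    for \<beta> a b c i j
    by (rule alternating_forms_repeat[OF that(1) _ _ that(5-8)]) (use that in auto)
  show "wd x y y = 0"
    using \<beta>0[OF _ xy xy(2), of _ 1 2] by (auto simp: wedge_def evaluation_def fun_eq_iff)
  show "wd x x y = 0"
    using \<beta>0[OF _ xy(1) xy, of _ 0 1] by (auto simp: wedge_def evaluation_def fun_eq_iff)
qed

lemma EA_wd:
  assumes "a \<in> h" "x \<in> m" "y \<in> m" "z \<in> m"
  shows "EA 3 a (wd x y z) = wd (br a x) y z + wd x (br a y) z + wd x y (br a z)"
proof -
  have "EA 3 a (wd x y z) = (\<Sum>i<3. wedge scaleR m 3 ([x, y, z][i := br a ([x, y, z] ! i)]))"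
    by (rule exterior_action_wedge[OF vm br_lin[OF assms(1)]]) (use assms in auto)
  then show ?thesis by (simp add: numeral_3_eq_3)
qed

lemma list_3:
  assumes "set xs \<subseteq> m" "length xs = 3"
  obtains u v w where "xs = [u, v, w]" "u \<in> m" "v \<in> m" "w \<in> m"
  using assms by (auto simp: numeral_3_eq_3 length_Suc_conv)

lemma Hom_Ext3_form:
  assumes F: "F \<in> Hom_Ext3"
  shows "alternating_123 (\<lambda>x y z. F (wd x y z))"
proof -
  have Flin: "linear_map dual_scale (Ext 3) (*) UNIV F"
    and Fact: "\<And>a u. a \<in> h \<Longrightarrow> u \<in> Ext 3 \<Longrightarrow> F (EA 3 a u) = 0"
    using F by (auto simp: hom_space_def)
  interpret D: vector_space "dual_scale :: real \<Rightarrow> (('g list \<Rightarrow> real) \<Rightarrow> real) \<Rightarrow> _"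
    by (rule vector_space_dual)
  have F0: "F 0 = 0" by (rule linear_map_0[OF vspace_exterior_power vector_space_mult Flin])
  have "F (wd (br a x) y z) + F (wd x (br a y) z) + F (wd x y (br a z)) = 0"
    if "a \<in> h" "x \<in> m" "y \<in> m" "z \<in> m" for a x y z
  proof -
    have w: "wd (br a x) y z \<in> Ext 3" "wd x (br a y) z \<in> Ext 3" "wd x y (br a z) \<in> Ext 3" "wd x y z \<in> Ext 3"
      using that br_in_m by (auto intro!: wedge_in_exterior_power)
    have "F (EA 3 a (wd x y z)) = F (wd (br a x) y z) + F (wd x (br a y) z) + F (wd x y (br a z))"
      unfolding EA_wd[OF that]
        linear_map_plus[OF Flin D.subspace_add[OF exterior_power_subspace w(1,2)] w(3)]
        linear_map_plus[OF Flin w(1,2)] ..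
    then show ?thesis using Fact[OF that(1) w(4)] by simp
  qed
  then show ?thesis
    using linear_map_compose[OF wd_linear(1) Flin] linear_map_compose[OF wd_linear(2) Flin]
      linear_map_compose[OF wd_linear(3) Flin] wd_diagonal F0
    unfolding alternating_123_def alternating_23_def invariant_trilinear_def trilinear_on_def
    by (intro conjI ballI) (simp_all only:)
qed

text \<open>
  An alternating form factors through the exterior power by the universal property, and the extension is
  invariant since it is so on decomposable vectors.
\<close>

lemma Hom_Ext3_exists:
  assumes T: "alternating_123 T"
  shows "\<exists>F\<in>Hom_Ext3. \<forall>x\<in>m. \<forall>y\<in>m. \<forall>z\<in>m. F (wd x y z) = T x y z"
proof -
  interpret D: vector_space "dual_scale :: real \<Rightarrow> (('g list \<Rightarrow> real) \<Rightarrow> real) \<Rightarrow> _"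
    by (rule vector_space_dual)
  have alt: "alternating_23 T" using T by (simp add: alternating_123_def)
  have inv: "inv_form T" using alt by (simp add: alternating_23_def)
  note lin = invariant_trilinear_linear[OF inv]
  have d23: "T x y y = 0" and d12: "T x x y = 0" if "x \<in> m" "y \<in> m" for x y
    using T alt that by (auto simp: alternating_123_def alternating_23_def)
  have d13: "T x y x = 0" if "x \<in> m" "y \<in> m" for x y
    using swap_23[OF alt that(1,2,1)] d12[OF that] by simp
  define b where "b xs = T (xs ! 0) (xs ! 1) (xs ! 2)" for xs
  have "\<exists>f. linear_map dual_scale UNIV (*) UNIV f \<and> (\<forall>xs. f (wedge scaleR m 3 xs) = b xs)"
  proof (rule exterior_power_universal[OF vector_space_mult])
    fix xs :: "'g list" and i :: nat assume xs: "set xs \<subseteq> m" "length xs = 3" "i < 3"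
    obtain u v w where uvw: "xs = [u, v, w]" "u \<in> m" "v \<in> m" "w \<in> m" using list_3[OF xs(1,2)] .
    have "i = 0 \<or> i = 1 \<or> i = 2" using xs(3) by auto
    then show "linear_map scaleR m (*) UNIV (\<lambda>v. b (xs[i := v]))"
      using lin(1)[OF uvw(3,4)] lin(2)[OF uvw(2,4)] lin(3)[OF uvw(2,3)]
      by (auto simp: b_def uvw(1) numeral_2_eq_2)
  next
    fix xs :: "'g list" and i j :: nat
    assume xs: "set xs \<subseteq> m" "length xs = 3" "i < 3" "j < 3" "i \<noteq> j" "xs ! i = xs ! j"
    obtain u v w where uvw: "xs = [u, v, w]" "u \<in> m" "v \<in> m" "w \<in> m" using list_3[OF xs(1,2)] .
    have "(i = 0 \<or> i = 1 \<or> i = 2) \<and> (j = 0 \<or> j = 1 \<or> j = 2)" using xs(3,4) by auto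
    then have "u = v \<or> u = w \<or> v = w" using xs(5,6) by (auto simp: uvw(1) numeral_2_eq_2)
    then show "b xs = 0" using d12 d13 d23 uvw(2-4) by (auto simp: b_def uvw(1) numeral_2_eq_2)
  qed
  then obtain f where f: "linear_map dual_scale UNIV (*) UNIV f"
    and fb: "\<And>xs. f (wedge scaleR m 3 xs) = b xs" by blast
  have fw: "f (wd x y z) = T x y z" for x y z by (simp add: fb b_def numeral_2_eq_2)
  have fadd: "f (u + v) = f u + f v" and fsc: "f (dual_scale c u) = c * f u" for u v c
    using linear_map_plus[OF f] linear_map_scale[OF f] by auto
  have f0: "f 0 = 0" by (rule linear_map_0[OF vspace_dual vector_space_mult f])
  have f_act: "f (EA 3 a u) = 0" if a: "a \<in> h" and u: "u \<in> Ext 3" for a u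
    using u
  proof (induction rule: exterior_power_induct)
    case zero
    have "EA 3 a 0 = 0"
      by (rule linear_map_0[OF vspace_exterior_power vector_space_dual exterior_action_linear])
    then show ?case using f0 by (simp only:)
  next
    case (step c xs u)
    obtain x y z where xyz: "xs = [x, y, z]" "x \<in> m" "y \<in> m" "z \<in> m" using list_3[OF step(1,2)] .
    have "EA 3 a (dual_scale c (wd x y z) + u) = dual_scale c (EA 3 a (wd x y z)) + EA 3 a u"
      unfolding exterior_action_def dual_action_add dual_action_scale ..
    then have "f (EA 3 a (dual_scale c (wd x y z) + u)) =
        c * (T (br a x) y z + T x (br a y) z + T x y (br a z)) + f (EA 3 a u)"
      by (simp only: EA_wd[OF a xyz(2-4)] fadd fsc fw)
    moreover have "T (br a x) y z + T x (br a y) z + T x y (br a z) = 0"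
      using inv a xyz unfolding invariant_trilinear_def by blast
    ultimately show ?case using step.IH by (simp only: xyz(1) mult_zero_right add_0_right)
  qed
  define F where "F u = (if u \<in> Ext 3 then f u else 0)" for u
  have "F \<in> Hom_Ext3"
    unfolding hom_space_def linear_map_def mem_Collect_eq
  proof (intro conjI ballI allI impI)
    show "F (u + v) = F u + F v" if "u \<in> Ext 3" "v \<in> Ext 3" for u v
      using D.subspace_add[OF exterior_power_subspace that] that by (simp only: F_def if_True fadd)
    show "F (dual_scale c u) = c * F u" if "u \<in> Ext 3" for c u
      using D.subspace_scale[OF exterior_power_subspace that] that by (simp only: F_def if_True fsc)
    show "F (EA 3 a u) = 0" if "a \<in> h" "u \<in> Ext 3" for a u
      using f_act[OF that] by (simp only: F_def if_cancel)
    show "F u = 0" if "u \<notin> Ext 3" for u using that by (simp only: F_def if_False)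
  qed simp
  moreover have "F (wd x y z) = T x y z" if "x \<in> m" "y \<in> m" "z \<in> m" for x y z
  proof -
    have "wd x y z \<in> Ext 3" using that by (intro wedge_in_exterior_power) auto
    then show ?thesis by (simp only: F_def if_True fw)
  qed
  ultimately show ?thesis by blast
qed

lemma dim_Hom_Ext3: "hom_dim h dual_scale (Ext 3) (EA 3) (*) (UNIV :: real set) (\<lambda>x c. 0) = 10"
  unfolding hom_dim_def
proof (subst dim_eq_card_form_basis[OF form_basis3, where ev = "\<lambda>x y z F. F (wd x y z)"])
  show "vector_space (fun_scale (*) :: real \<Rightarrow> ((('g list \<Rightarrow> real) \<Rightarrow> real) \<Rightarrow> real) \<Rightarrow> _)"
    by (rule vector_space_fun_scale[OF vector_space_mult])
  show "module.subspace (fun_scale (*)) Hom_Ext3"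
    by (rule subspace_hom_space)
      (auto simp: linear_map_def vspace_def vector_space_over_itself.subspace_UNIV)
  show "linear_map (fun_scale (*)) Hom_Ext3 (*) UNIV (\<lambda>F. F (wd x y z))" for x y z
    by (simp add: linear_map_def fun_scale_def)
  show "F = 0" if F: "F \<in> Hom_Ext3"
    and zero: "\<And>x y z. x \<in> m \<Longrightarrow> y \<in> m \<Longrightarrow> z \<in> m \<Longrightarrow> F (wd x y z) = 0" for F
  proof
    have Flin: "linear_map dual_scale (Ext 3) (*) UNIV F" and F0: "\<And>u. u \<notin> Ext 3 \<Longrightarrow> F u = 0"
      using F by (auto simp: hom_space_def)
    fix u
    have "F u = 0" if "u \<in> Ext 3"
      using that
    proof (induction rule: exterior_power_induct)
      case zero
      show ?case by (rule linear_map_0[OF vspace_exterior_power vector_space_mult Flin])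
    next
      interpret D: vector_space "dual_scale :: real \<Rightarrow> (('g list \<Rightarrow> real) \<Rightarrow> real) \<Rightarrow> _"
        by (rule vector_space_dual)
      case (step c xs u)
      obtain x y z where xyz: "xs = [x, y, z]" "x \<in> m" "y \<in> m" "z \<in> m" using list_3[OF step(1,2)] .
      have w: "wedge scaleR m 3 xs \<in> Ext 3" by (rule wedge_in_exterior_power[OF step(1,2)])
      have "F (wedge scaleR m 3 xs) = 0" using zero[OF xyz(2-4)] by (simp only: xyz(1))
      then show ?case
        using linear_map_plus[OF Flin D.subspace_scale[OF exterior_power_subspace w] step(3)]
          linear_map_scale[OF Flin w] step.IH by (simp only: mult_zero_right add_0_right)
    qed
    then have "F u = 0" using F0 by blast
    then show "F u = 0 u" by simp
  qed
  show "\<exists>F\<in>Hom_Ext3. \<forall>x\<in>m. \<forall>y\<in>m. \<forall>z\<in>m. F (wd x y z) = T x y z" if "alternating_123 T" for T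
    by (rule Hom_Ext3_exists[OF that])
  show "alternating_123 (\<lambda>x y z. F (wd x y z))" if "F \<in> Hom_Ext3" for F
    by (rule Hom_Ext3_form[OF that])
  show "card I3 = 10" by (rule card_I3)
qed

end

section \<open>The Killing form\<close>

lemma
  assumes L: "lie_algebra sc L br" and xy: "x \<in> L" "y \<in> L"
  shows lie_bracket_in: "br x y \<in> L"
    and lie_bracket_linear: "linear_map sc L sc L (br x)" "linear_map sc L sc L (\<lambda>z. br z x)"
    and lie_bracket_skew: "br x y = - br y x"
proof -
  have vs: "vector_space sc" and sL: "module.subspace sc L"
    and lin1: "\<And>x. x \<in> L \<Longrightarrow> linear_map sc L sc L (br x)"
    and lin2: "\<And>x. x \<in> L \<Longrightarrow> linear_map sc L sc L (\<lambda>z. br z x)"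
    and xx: "\<And>x. x \<in> L \<Longrightarrow> br x x = 0"
    using L by (auto simp: lie_algebra_def vspace_def bilinear_map_def)
  interpret vector_space sc by (rule vs)
  show "br x y \<in> L" by (rule linear_map_mem[OF lin1[OF xy(1)] xy(2)])
  show "linear_map sc L sc L (br x)" "linear_map sc L sc L (\<lambda>z. br z x)"
    using lin1 lin2 xy by auto
  have s: "x + y \<in> L" by (rule subspace_add[OF sL xy])
  have "br (x + y) (x + y) = br x x + br x y + (br y x + br y y)"
    using linear_map_plus[OF lin2[OF s] xy] linear_map_plus[OF lin1[OF xy(1)] xy]
      linear_map_plus[OF lin1[OF xy(2)] xy] by simp
  then show "br x y = - br y x" using xx s xy by (simp add: eq_neg_iff_add_eq_0)
qed

lemma lie_bracket_jacobi:
  assumes L: "lie_algebra sc L br" and xyz: "x \<in> L" "y \<in> L" "z \<in> L"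
  shows "br (br x y) z = br x (br y z) - br y (br x z)"
proof -
  have vs: "vspace sc L" using L by (simp add: lie_algebra_def)
  then have v: "vector_space sc" by (simp add: vspace_def)
  interpret vector_space sc by (rule v)
  have "br x (br y z) + br y (br z x) + br z (br x y) = 0"
    using L xyz by (simp add: lie_algebra_def)
  moreover have "br z (br x y) = - br (br x y) z"
    by (rule lie_bracket_skew[OF L xyz(3) lie_bracket_in[OF L xyz(1,2)]])
  moreover have "br y (br z x) = - br y (br x z)"
  proof -
    have "br y (sc (- 1) (br x z)) = sc (- 1) (br y (br x z))"
      by (rule linear_map_scale[OF lie_bracket_linear(1)[OF L xyz(2,2)] lie_bracket_in[OF L xyz(1,3)]])
    then show ?thesis using lie_bracket_skew[OF L xyz(3,1)] by simp
  qed
  ultimately show ?thesis by (simp add: algebra_simps eq_neg_iff_add_eq_0)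
qed

lemma killing_form_sym:
  assumes L: "lie_algebra sc L br" and fin: "findim sc L" and xy: "x \<in> L" "y \<in> L"
  shows "killing_form sc L br x y = killing_form sc L br y x"
proof -
  have v: "vector_space sc" using L by (simp add: lie_algebra_def vspace_def)
  show ?thesis
    unfolding killing_form_def
    by (rule endo_trace_commute[OF v fin lie_bracket_linear(1)[OF L xy(1,1)] lie_bracket_linear(1)[OF L xy(2,2)]])
qed

lemma killing_form_linear:
  assumes L: "lie_algebra sc L br" and fin: "findim sc L" and x: "x \<in> L"
  shows "linear_map sc L (*) UNIV (killing_form sc L br x)"
proof -
  have v: "vector_space sc" using L by (simp add: lie_algebra_def vspace_def)
  note in_L = lie_bracket_in[OF L]
  note lin = lie_bracket_linear[OF L]
  have "killing_form sc L br x (y + z) = killing_form sc L br x y + killing_form sc L br x z"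
    if "y \<in> L" "z \<in> L" for y z
  proof -
    have "br x (br (y + z) w) = br x (br y w) + br x (br z w)" if w: "w \<in> L" for w
      unfolding linear_map_plus[OF lin(2)[OF w w] \<open>y \<in> L\<close> \<open>z \<in> L\<close>]
      by (rule linear_map_plus[OF lin(1)[OF x x] in_L[OF \<open>y \<in> L\<close> w] in_L[OF \<open>z \<in> L\<close> w]])
    then have "killing_form sc L br x (y + z) = endo_trace sc L (\<lambda>w. br x (br y w) + br x (br z w))"
      unfolding killing_form_def by (rule endo_trace_cong[OF v fin])
    also have "\<dots> = killing_form sc L br x y + killing_form sc L br x z"
      unfolding killing_form_def by (rule endo_trace_add[OF v fin]) (intro in_L x that; assumption)+
    finally show ?thesis .
  qed
  moreover have "killing_form sc L br x (sc c y) = c * killing_form sc L br x y" if "y \<in> L" for c y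
  proof -
    have "br x (br (sc c y) w) = sc c (br x (br y w))" if w: "w \<in> L" for w
      unfolding linear_map_scale[OF lin(2)[OF w w] \<open>y \<in> L\<close>]
      by (rule linear_map_scale[OF lin(1)[OF x x] in_L[OF \<open>y \<in> L\<close> w]])
    then have "killing_form sc L br x (sc c y) = endo_trace sc L (\<lambda>w. sc c (br x (br y w)))"
      unfolding killing_form_def by (rule endo_trace_cong[OF v fin])
    also have "\<dots> = c * killing_form sc L br x y"
      unfolding killing_form_def by (rule endo_trace_scale[OF v fin]) (intro in_L x that; assumption)
    finally show ?thesis .
  qed
  ultimately show ?thesis by (simp add: linear_map_def)
qed

lemma killing_form_linear':
  assumes L: "lie_algebra sc L br" and fin: "findim sc L" and x: "x \<in> L"
  shows "linear_map sc L (*) UNIV (\<lambda>y. killing_form sc L br y x)"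
proof -
  have v: "vector_space sc" and sL: "module.subspace sc L" using L by (auto simp: lie_algebra_def vspace_def)
  interpret vector_space sc by (rule v)
  show ?thesis
    using killing_form_linear[OF assms] killing_form_sym[OF L fin _ x] subspace_add[OF sL] subspace_scale[OF sL]
    by (simp add: linear_map_def)
qed

text \<open>
  With \<open>X = ad x\<close>, \<open>Y = ad y\<close>, \<open>Z = ad z\<close> the sum is the trace of \<open>[Z, X] Y + X [Z, Y] = [Z, X Y]\<close>.
\<close>

lemma killing_form_invariant:
  assumes L: "lie_algebra sc L br" and fin: "findim sc L" and xyz: "x \<in> L" "y \<in> L" "z \<in> L"
  shows "killing_form sc L br (br z x) y + killing_form sc L br x (br z y) = 0"
proof -
  have v: "vector_space sc" and sL: "module.subspace sc L" using L by (auto simp: lie_algebra_def vspace_def)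
  interpret vector_space sc by (rule v)
  note in_L = lie_bracket_in[OF L]
  note lin = lie_bracket_linear[OF L]
  let ?tr = "endo_trace sc L"
  have diff: "?tr (\<lambda>w. f w - g w) = ?tr f - ?tr g" if "\<And>w. w \<in> L \<Longrightarrow> f w \<in> L" "\<And>w. w \<in> L \<Longrightarrow> g w \<in> L" for f g
    using endo_trace_add[OF v fin, of "\<lambda>w. f w - g w" g] that subspace_diff[OF sL] by simp
  have "killing_form sc L br (br z x) y = ?tr (\<lambda>w. br z (br x (br y w)) - br x (br z (br y w)))"
    unfolding killing_form_def
    by (rule endo_trace_cong[OF v fin]) (rule lie_bracket_jacobi[OF L xyz(3,1) in_L[OF xyz(2)]])
  also have "\<dots> = ?tr (\<lambda>w. br z (br x (br y w))) - ?tr (\<lambda>w. br x (br z (br y w)))"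
    by (rule diff) (intro in_L xyz; assumption)+
  finally have 1: "killing_form sc L br (br z x) y = \<dots>" .
  have "br x (br (br z y) w) = br x (br z (br y w)) - br x (br y (br z w))" if w: "w \<in> L" for w
  proof -
    have a: "br z (br y w) \<in> L" "br y (br z w) \<in> L" using w xyz by (auto intro: in_L)
    have "br x (br z (br y w) - br y (br z w) + br y (br z w)) =
        br x (br z (br y w) - br y (br z w)) + br x (br y (br z w))"
      by (rule linear_map_plus[OF lin(1)[OF xyz(1,1)] subspace_diff[OF sL a] a(2)])
    then show ?thesis using lie_bracket_jacobi[OF L xyz(3,2) w] by simp
  qed
  then have "killing_form sc L br x (br z y) = ?tr (\<lambda>w. br x (br z (br y w)) - br x (br y (br z w)))"
    unfolding killing_form_def by (rule endo_trace_cong[OF v fin])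
  also have "\<dots> = ?tr (\<lambda>w. br x (br z (br y w))) - ?tr (\<lambda>w. br x (br y (br z w)))"
    by (rule diff) (intro in_L xyz; assumption)+
  finally have 2: "killing_form sc L br x (br z y) = \<dots>" .
  have "?tr (\<lambda>w. br z (br x (br y w))) = ?tr (\<lambda>w. br x (br y (br z w)))"
    using endo_trace_commute[OF v fin lin(1)[OF xyz(3,3)]
      linear_map_compose[OF lin(1)[OF xyz(2,2)] lin(1)[OF xyz(1,1)]]] by simp
  then show ?thesis using 1 2 by simp
qed

section \<open>The algebra \<open>sp(1)\<close>\<close>

definition sp1_matrix :: "real \<Rightarrow> real \<Rightarrow> real \<Rightarrow> complex^(1 + 1)^(1 + 1)" where
  "sp1_matrix a b c = (\<chi> i j. case (i, j) of
     (Inl _, Inl _) \<Rightarrow> Complex 0 a | (Inl _, Inr _) \<Rightarrow> Complex b c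
   | (Inr _, Inl _) \<Rightarrow> Complex (- b) c | (Inr _, Inr _) \<Rightarrow> Complex 0 (- a))"

lemma forall_1_plus_1: "(\<forall>i :: 1 + 1. Q i) \<longleftrightarrow> Q (Inl 1) \<and> Q (Inr 1)"
proof
  assume "Q (Inl 1) \<and> Q (Inr 1)"
  then show "\<forall>i. Q i" by (metis num1_eq_iff sum.exhaust)
qed simp

lemma sum_1_plus_1: "(\<Sum>i\<in>(UNIV :: (1 + 1) set). f i) = f (Inl 1) + f (Inr 1)"
proof -
  have U: "(UNIV :: (1 + 1) set) = {Inl 1, Inr 1}"
    using forall_1_plus_1[of "\<lambda>i. i \<in> {Inl 1, Inr 1}"] by auto
  show ?thesis unfolding U by simp
qed

lemma sp1_algebra: "(sp_algebra :: (complex^(1 + 1)^(1 + 1)) set) = {sp1_matrix a b c | a b c. True}"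
proof -
  have "A \<in> sp_algebra \<longleftrightarrow> (\<exists>a b c. A = sp1_matrix a b c)" for A :: "complex^(1 + 1)^(1 + 1)"
  proof
    assume A: "A \<in> sp_algebra"
    then have 1: "cnj (A $ j $ i) = - A $ i $ j" for i j
      by (simp add: sp_algebra_def adjoint_matrix_def vec_eq_iff)
    have "(transpose A ** symplectic_J + symplectic_J ** A) $ Inl 1 $ Inr 1 = 0"
      using A by (simp add: sp_algebra_def)
    then have 2: "A $ Inl 1 $ Inl 1 + A $ Inr 1 $ Inr 1 = 0"
      by (simp add: matrix_matrix_mult_def transpose_def symplectic_J_def sum_1_plus_1)
    have "A = sp1_matrix (Im (A $ Inl 1 $ Inl 1)) (Re (A $ Inl 1 $ Inr 1)) (Im (A $ Inl 1 $ Inr 1))"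
      using 2 1[of "Inl 1" "Inl 1"] 1[of "Inl 1" "Inr 1"] 1[of "Inr 1" "Inl 1"]
      by (auto simp: vec_eq_iff forall_1_plus_1 sp1_matrix_def complex_eq_iff)
    then show "\<exists>a b c. A = sp1_matrix a b c" by blast
  next
    assume "\<exists>a b c. A = sp1_matrix a b c"
    then show "A \<in> sp_algebra"
      by (auto simp: sp_algebra_def adjoint_matrix_def vec_eq_iff forall_1_plus_1 sp1_matrix_def
          matrix_matrix_mult_def transpose_def symplectic_J_def sum_1_plus_1 complex_eq_iff)
  qed
  then show ?thesis by auto
qed

lemma sp1_coordinates:
  fixes L :: "'g::real_vector set"
  assumes iso: "isomorphic_to_matrices L br (sp_algebra :: (complex^(1 + 1)^(1 + 1)) set)"
    and L: "subspace L"
  obtains e :: "nat \<Rightarrow> 'g" and \<xi> :: "nat \<Rightarrow> 'g \<Rightarrow> real" where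
    "\<And>i. i \<in> {1, 2, 3} \<Longrightarrow> e i \<in> L"
    "\<And>i. linear_map scaleR L (*) UNIV (\<xi> i)"
    "\<And>x. x \<in> L \<Longrightarrow> x = (\<Sum>i\<in>{1, 2, 3}. \<xi> i x *\<^sub>R e i)"
    "\<And>i j. i \<in> {1, 2, 3} \<Longrightarrow> j \<in> {1, 2, 3} \<Longrightarrow> \<xi> i (e j) = (if i = j then 1 else 0)"
proof -
  obtain f where f: "linear_map scaleR L scaleR (sp_algebra :: (complex^(1 + 1)^(1 + 1)) set) f"
    and bij: "bij_betw f L (sp_algebra :: (complex^(1 + 1)^(1 + 1)) set)"
    using iso by (auto simp: isomorphic_to_matrices_def lie_isomorphism_def)
  define X :: "nat \<Rightarrow> complex^(1 + 1)^(1 + 1)" where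
    "X i = (if i = 1 then sp1_matrix 1 0 0 else if i = 2 then sp1_matrix 0 1 0 else sp1_matrix 0 0 1)" for i
  define \<eta> :: "nat \<Rightarrow> complex^(1 + 1)^(1 + 1) \<Rightarrow> real" where
    "\<eta> i A = (if i = 1 then Im (A $ Inl 1 $ Inl 1)
      else if i = 2 then Re (A $ Inl 1 $ Inr 1) else Im (A $ Inl 1 $ Inr 1))" for i A
  have X_in: "X i \<in> sp_algebra" for i
    unfolding X_def sp1_algebra by auto
  define e where "e i = inv_into L f (X i)" for i
  have e_in: "e i \<in> L" and fe: "f (e i) = X i" for i
    using bij X_in[of i] by (auto simp: e_def bij_betw_def inv_into_into f_inv_into_f)
  have \<eta>_lin: "linear_map scaleR UNIV (*) UNIV (\<eta> i)" for i
    by (simp add: linear_map_def \<eta>_def)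
  have lin: "linear_map scaleR L (*) UNIV (\<lambda>x. \<eta> i (f x))" for i
    using f \<eta>_lin[of i] by (simp add: linear_map_def)
  have expand: "x = (\<Sum>i\<in>{1, 2, 3}. \<eta> i (f x) *\<^sub>R e i)" if x: "x \<in> L" for x
  proof -
    have fx: "f x \<in> sp_algebra" by (rule linear_map_mem[OF f x])
    then obtain a b c where abc: "f x = sp1_matrix a b c" unfolding sp1_algebra by auto
    have "f (\<Sum>i\<in>{1, 2, 3}. \<eta> i (f x) *\<^sub>R e i) = (\<Sum>i\<in>{1, 2, 3}. \<eta> i (f x) *\<^sub>R f (e i))"
      by (rule linear_map_sum[OF _ real_vector.vector_space_axioms f]) (use L e_in in auto)
    also have "\<dots> = f x"
      unfolding abc fe
      by (simp add: X_def \<eta>_def sp1_matrix_def vec_eq_iff forall_1_plus_1 complex_eq_iff)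
    finally have "f (\<Sum>i\<in>{1, 2, 3}. \<eta> i (f x) *\<^sub>R e i) = f x" .
    moreover have "(\<Sum>i\<in>{1, 2, 3}. \<eta> i (f x) *\<^sub>R e i) \<in> L"
      using L e_in by (intro subspace_sum subspace_scale)
    ultimately show ?thesis using bij x by (metis bij_betw_def inj_onD)
  qed
  have \<delta>: "\<eta> i (f (e j)) = (if i = j then 1 else 0)" if "i \<in> {1, 2, 3}" "j \<in> {1, 2, 3}" for i j
    using that unfolding fe by (auto simp: \<eta>_def X_def sp1_matrix_def)
  show thesis by (rule that[OF e_in lin expand \<delta>])
qed

section \<open>Invariant bilinear forms from the Killing form\<close>

text \<open>
  A nondegenerate invariant form turns invariant bilinear forms into equivariant endomorphisms.
  So if the endomorphisms of \<open>V\<close> are spanned by the identity and by \<open>ad e\<^sub>1, ad e\<^sub>2, ad e\<^sub>3\<close>,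
  the invariant bilinear forms are spanned by the Killing form, which is symmetric, and by its
  twists by the \<open>ad e\<^sub>i\<close>, which are alternating since \<open>ad e\<^sub>i\<close> is skew.
\<close>

locale killing_pairing =
  fixes g h V :: "'g::real_vector set" and br :: "'g \<Rightarrow> 'g \<Rightarrow> 'g" and e :: "nat \<Rightarrow> 'g"
  assumes L: "lie_algebra scaleR g br" and fin: "findim scaleR g"
    and neg: "\<And>x. x \<in> g \<Longrightarrow> x \<noteq> 0 \<Longrightarrow> killing_form scaleR g br x x < 0"
    and V: "subspace V" "V \<subseteq> g"
    and h: "h \<subseteq> g" "\<And>a x. a \<in> h \<Longrightarrow> x \<in> V \<Longrightarrow> br a x \<in> V"
    and e: "\<And>l. l \<in> N3 \<Longrightarrow> e l \<in> g" "\<And>l x. l \<in> N3 \<Longrightarrow> x \<in> V \<Longrightarrow> br (e l) x \<in> V"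
    and he: "\<And>a l. a \<in> h \<Longrightarrow> l \<in> N3 \<Longrightarrow> br a (e l) = 0"
    and endo_span: "\<And>f. linear_map scaleR V scaleR V f \<Longrightarrow>
      (\<And>a x. a \<in> h \<Longrightarrow> x \<in> V \<Longrightarrow> f (br a x) = br a (f x)) \<Longrightarrow>
      \<exists>r. \<forall>x\<in>V. f x = r 0 *\<^sub>R x + (\<Sum>l\<in>N3. r l *\<^sub>R br (e l) x)"
    and endo_indep: "\<And>r l. (\<And>x. x \<in> V \<Longrightarrow> r 0 *\<^sub>R x + (\<Sum>l\<in>N3. r l *\<^sub>R br (e l) x) = 0) \<Longrightarrow>
      l \<in> N4 \<Longrightarrow> r l = 0"
begin

definition K where "K = killing_form scaleR g br"

definition \<omega> :: "nat \<Rightarrow> 'g \<Rightarrow> 'g \<Rightarrow> real" where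
  "\<omega> l x y = (if l = 0 then - K x y else K (br (e l) x) y)"

lemmas K_sym = killing_form_sym[OF L fin, folded K_def]
lemmas K_inv = killing_form_invariant[OF L fin, folded K_def]

lemma in_g: "x \<in> V \<Longrightarrow> x \<in> g"
  using V(2) by auto

lemma h_in_g: "a \<in> h \<Longrightarrow> a \<in> g"
  using h(1) by auto

lemma K_linear:
  assumes "x \<in> g"
  shows "linear_map scaleR V (*) UNIV (K x)" "linear_map scaleR V (*) UNIV (\<lambda>y. K y x)"
  using killing_form_linear[OF L fin assms] killing_form_linear'[OF L fin assms] V(2)
  by (auto simp: K_def linear_map_def subset_eq)

lemma K_nondegenerate:
  assumes "x \<in> V" "\<And>y. y \<in> V \<Longrightarrow> K x y = 0"
  shows "x = 0"
  using neg[OF in_g[OF assms(1)]] assms by (force simp: K_def)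

lemma ad_e_commutes:
  assumes "l \<in> N3" "a \<in> h" "x \<in> V"
  shows "br (e l) (br a x) = br a (br (e l) x)"
proof -
  have "br (br a (e l)) x = br a (br (e l) x) - br (e l) (br a x)"
    by (rule lie_bracket_jacobi[OF L h_in_g[OF assms(2)] e(1)[OF assms(1)] in_g[OF assms(3)]])
  moreover have "br 0 x = 0"
    using linear_map_0[OF _ real_vector.vector_space_axioms lie_bracket_linear(2)[OF L in_g in_g]]
      assms(3) L by (simp add: lie_algebra_def)
  ultimately show ?thesis using he[OF assms(2,1)] by simp
qed

lemma ad_e_linear: "l \<in> N3 \<Longrightarrow> linear_map scaleR V scaleR V (br (e l))"
  using lie_bracket_linear(1)[OF L e(1) e(1)] e(2) V(2) by (auto simp: linear_map_def subset_eq)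

lemma \<omega>_invariant:
  assumes l: "l \<in> N4"
  shows "invariant_bilinear h br V (\<omega> l)"
proof (cases "l = 0")
  case True
  have "\<omega> l (br a x) y + \<omega> l x (br a y) = 0" if "a \<in> h" "x \<in> V" "y \<in> V" for a x y
    using K_inv[OF in_g[OF that(2)] in_g[OF that(3)] h_in_g[OF that(1)]]
    unfolding \<omega>_def if_P[OF True] by linarith
  then show ?thesis
    using K_linear[OF in_g]
    by (auto simp: invariant_bilinear_def bilinear_on_def \<omega>_def True linear_map_def)
next
  case False
  then have l3: "l \<in> N3" using l by auto
  have "\<omega> l (br a x) y + \<omega> l x (br a y) = 0" if "a \<in> h" "x \<in> V" "y \<in> V" for a x y
    using K_inv[OF in_g[OF e(2)[OF l3 that(2)]] in_g[OF that(3)] h_in_g[OF that(1)]]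
      ad_e_commutes[OF l3 that(1,2)] False by (simp add: \<omega>_def)
  moreover have "linear_map scaleR V (*) UNIV (\<lambda>y. K (br (e l) y) x)" if "x \<in> V" for x
    by (rule linear_map_compose[OF ad_e_linear[OF l3] K_linear(2)[OF in_g[OF that]]])
  moreover have "linear_map scaleR V (*) UNIV (K (br (e l) x))" if "x \<in> V" for x
    by (rule K_linear(1)[OF in_g[OF e(2)[OF l3 that]]])
  ultimately show ?thesis
    using False by (auto simp: invariant_bilinear_def bilinear_on_def \<omega>_def)
qed

lemma \<omega>_alternating:
  assumes l: "l \<in> N3" and x: "x \<in> V"
  shows "\<omega> l x x = 0"
proof -
  have "K (br (e l) x) x + K x (br (e l) x) = 0" by (rule K_inv[OF in_g[OF x] in_g[OF x] e(1)[OF l]])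
  moreover have "K (br (e l) x) x = K x (br (e l) x)" by (rule K_sym[OF in_g[OF e(2)[OF l x]] in_g[OF x]])
  ultimately show ?thesis using l by (auto simp: \<omega>_def)
qed

text \<open>
  A combination of the \<open>\<omega>\<^sub>l\<close> is the Killing form composed with an endomorphism from the commutant; the
  sign at \<open>0\<close> comes from \<open>\<omega>\<^sub>0 = - K\<close>, which is positive.
\<close>

lemma sum_\<omega>:
  assumes x: "x \<in> V" and y: "y \<in> V"
  shows "(\<Sum>l\<in>N4. r l * \<omega> l x y) = K (- r 0 *\<^sub>R x + (\<Sum>l\<in>N3. r l *\<^sub>R br (e l) x)) y"
proof -
  have a: "- r 0 *\<^sub>R x \<in> V" by (rule subspace_scale[OF V(1) x])
  have b: "(\<Sum>l\<in>N3. r l *\<^sub>R br (e l) x) \<in> V"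
    by (rule subspace_sum[OF V(1)]) (rule subspace_scale[OF V(1) e(2)[OF _ x]])
  have "K (- r 0 *\<^sub>R x + (\<Sum>l\<in>N3. r l *\<^sub>R br (e l) x)) y =
      - r 0 * K x y + (\<Sum>l\<in>N3. r l * K (br (e l) x) y)"
    unfolding linear_map_plus[OF K_linear(2)[OF in_g[OF y]] a b]
      linear_map_scale[OF K_linear(2)[OF in_g[OF y]] x]
    by (subst linear_map_sum[OF _ vector_space_mult K_linear(2)[OF in_g[OF y]]])
      (use V(1) e(2)[OF _ x] in auto)
  then show ?thesis by (simp add: \<omega>_def)
qed

lemma \<omega>_independent:
  assumes zero: "\<And>x y. x \<in> V \<Longrightarrow> y \<in> V \<Longrightarrow> (\<Sum>l\<in>N4. r l * \<omega> l x y) = 0" and l: "l \<in> N4"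
  shows "r l = 0"
proof -
  let ?s = "\<lambda>l. if l = 0 then - r l else r l"
  have "?s 0 *\<^sub>R x + (\<Sum>l\<in>N3. ?s l *\<^sub>R br (e l) x) = 0" if x: "x \<in> V" for x
  proof (rule K_nondegenerate)
    show "?s 0 *\<^sub>R x + (\<Sum>l\<in>N3. ?s l *\<^sub>R br (e l) x) \<in> V"
      by (intro subspace_add[OF V(1)] subspace_sum[OF V(1)] subspace_scale[OF V(1)] x e(2))
    show "K (?s 0 *\<^sub>R x + (\<Sum>l\<in>N3. ?s l *\<^sub>R br (e l) x)) y = 0" if "y \<in> V" for y
      using zero[OF x that] sum_\<omega>[OF x that, of r] by simp
  qed
  from endo_indep[of ?s, OF this l] show ?thesis by (simp split: if_splits)
qed

lemma \<omega>_spans: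
  assumes B: "invariant_bilinear h br V B"
  shows "\<exists>r. \<forall>x\<in>V. \<forall>y\<in>V. B x y = (\<Sum>l\<in>N4. r l * \<omega> l x y)"
proof -
  have B_lin: "linear_map scaleR V (*) UNIV (\<lambda>y. B y x)" "linear_map scaleR V (*) UNIV (B x)"
    if "x \<in> V" for x
    using B that by (auto simp: invariant_bilinear_def bilinear_on_def)
  have fin_V: "findim scaleR V"
    using findim_subspace[OF real_vector.vector_space_axioms fin] V by (auto simp: subspace_raw_def)
  have "\<exists>E. finite E \<and> E \<subseteq> V \<and> (\<forall>x\<in>V. x = (\<Sum>u\<in>E. (- K x u) *\<^sub>R u))"
  proof (rule parseval_frame_exists[OF fin_V])
    show "- K x y = - K y x" if "x \<in> V" "y \<in> V" for x y using K_sym that in_g by simp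
    show "linear_map scaleR V (*) UNIV (\<lambda>y. - K x y)" if "x \<in> V" for x
      using K_linear(1)[OF in_g[OF that]] by (simp add: linear_map_def)
    show "- K x x > 0" if "x \<in> V" "x \<noteq> 0" for x using neg[OF in_g[OF that(1)] that(2)] by (simp add: K_def)
  qed
  then obtain E where E: "finite E" "E \<subseteq> V" "\<And>x. x \<in> V \<Longrightarrow> x = (\<Sum>u\<in>E. (- K x u) *\<^sub>R u)"
    by blast
  have EV: "u \<in> V" if "u \<in> E" for u using E(2) that by auto
  \<comment> \<open>the endomorphism that represents \<open>B\<close> with respect to \<open>- K\<close>\<close>
  define A where "A x = (\<Sum>u\<in>E. B x u *\<^sub>R u)" for x
  have A_in: "A x \<in> V" for x
    unfolding A_def by (intro subspace_sum[OF V(1)] subspace_scale[OF V(1)] EV)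
  have KA: "K (A x) y = - B x y" if x: "x \<in> V" and y: "y \<in> V" for x y
  proof -
    have "K (A x) y = (\<Sum>u\<in>E. B x u * K u y)"
      unfolding A_def
      by (rule linear_map_sum[OF _ vector_space_mult K_linear(2)[OF in_g[OF y]]]) (use V(1) EV in auto)
    also have "\<dots> = - (\<Sum>u\<in>E. (- K y u) * B x u)"
      using K_sym[OF in_g[OF EV] in_g[OF y]] by (simp add: sum_negf mult.commute)
    also have "(\<Sum>u\<in>E. (- K y u) * B x u) = B x (\<Sum>u\<in>E. (- K y u) *\<^sub>R u)"
      by (rule linear_map_sum[OF _ vector_space_mult B_lin(2)[OF x], symmetric]) (use V(1) EV in auto)
    also have "(\<Sum>u\<in>E. (- K y u) *\<^sub>R u) = y" using E(3)[OF y] by simp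
    finally show ?thesis .
  qed
  have A_lin: "linear_map scaleR V scaleR V A"
    using A_in linear_map_plus[OF B_lin(1)[OF EV]] linear_map_scale[OF B_lin(1)[OF EV]]
    by (simp add: linear_map_def A_def scaleR_left_distrib sum.distrib scaleR_sum_right)
  have "A (br a x) = br a (A x)" if a: "a \<in> h" and x: "x \<in> V" for a x
  proof -
    have in1: "A (br a x) \<in> V" "br a (A x) \<in> V" using A_in h(2)[OF a A_in] by auto
    have "A (br a x) - br a (A x) = 0"
    proof (rule K_nondegenerate)
      show d: "A (br a x) - br a (A x) \<in> V" by (rule subspace_diff[OF V(1) in1])
      fix y assume y: "y \<in> V"
      have "B (br a x) y + B x (br a y) = 0" using B a x y by (simp add: invariant_bilinear_def)
      moreover have "K (br a (A x)) y + K (A x) (br a y) = 0"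
        by (rule K_inv[OF in_g[OF A_in] in_g[OF y] h_in_g[OF a]])
      moreover have "K (A (br a x) - br a (A x) + br a (A x)) y =
          K (A (br a x) - br a (A x)) y + K (br a (A x)) y"
        by (rule linear_map_plus[OF K_linear(2)[OF in_g[OF y]] d in1(2)])
      ultimately show "K (A (br a x) - br a (A x)) y = 0"
        using KA[OF h(2)[OF a x] y] KA[OF x h(2)[OF a y]] by simp
    qed
    then show ?thesis by simp
  qed
  then obtain r where r: "\<And>x. x \<in> V \<Longrightarrow> A x = r 0 *\<^sub>R x + (\<Sum>l\<in>N3. r l *\<^sub>R br (e l) x)"
    using endo_span[OF A_lin] by blast
  let ?r = "\<lambda>l. if l = 0 then r l else - r l"
  have "B x y = (\<Sum>l\<in>N4. ?r l * \<omega> l x y)" if x: "x \<in> V" and y: "y \<in> V" for x y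
  proof -
    have "- ?r 0 *\<^sub>R x + (\<Sum>l\<in>N3. ?r l *\<^sub>R br (e l) x) = (- 1) *\<^sub>R A x"
      by (simp add: r[OF x])
    then have "(\<Sum>l\<in>N4. ?r l * \<omega> l x y) = K ((- 1) *\<^sub>R A x) y"
      using sum_\<omega>[OF x y, of ?r] by (simp only:)
    also have "\<dots> = B x y"
      unfolding linear_map_scale[OF K_linear(2)[OF in_g[OF y]] A_in] KA[OF x y] by simp
    finally show ?thesis ..
  qed
  then show ?thesis by (intro exI[of _ ?r] ballI)
qed

end

section \<open>The isotropy module of the homogeneous space\<close>

lemma direct_sum_projection:
  fixes Q U :: "'g::real_vector set"
  assumes Q: "subspace Q" and U: "subspace U" and QU: "Q \<inter> U = {0}"
  obtains p where "linear_map scaleR (set_plus_of Q U) scaleR U p"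
    "\<And>x. x \<in> Q \<Longrightarrow> p x = 0" "\<And>x. x \<in> U \<Longrightarrow> p x = x"
    "\<And>x. x \<in> set_plus_of Q U \<Longrightarrow> x - p x \<in> Q"
proof -
  define p where "p x = (THE u. u \<in> U \<and> x - u \<in> Q)" for x
  have uniq: "u = u'" if "u \<in> U" "x - u \<in> Q" "u' \<in> U" "x - u' \<in> Q" for x u u'
  proof -
    have "u - u' \<in> U" by (rule subspace_diff[OF U that(1,3)])
    moreover have "u - u' \<in> Q" using subspace_diff[OF Q that(4,2)] by simp
    ultimately have "u - u' \<in> Q \<inter> U" by blast
    then show ?thesis unfolding QU by simp
  qed
  have p: "p x = u" if u: "u \<in> U" "x - u \<in> Q" for x u
    unfolding p_def
  proof (rule the_equality)
    show "u' = u" if "u' \<in> U \<and> x - u' \<in> Q" for u'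
      using uniq[OF _ _ u] that by blast
  qed (use u in blast)
  have ex: "\<exists>u\<in>U. x - u \<in> Q" if "x \<in> set_plus_of Q U" for x
    using that unfolding set_plus_of_def by force
  have p': "p x \<in> U" "x - p x \<in> Q" if "x \<in> set_plus_of Q U" for x
    using ex[OF that] p by auto
  have "p (x + y) = p x + p y" if "x \<in> set_plus_of Q U" "y \<in> set_plus_of Q U" for x y
  proof (rule p)
    show "p x + p y \<in> U" by (rule subspace_add[OF U p'(1)[OF that(1)] p'(1)[OF that(2)]])
    have "(x - p x) + (y - p y) \<in> Q" by (rule subspace_add[OF Q p'(2)[OF that(1)] p'(2)[OF that(2)]])
    then show "x + y - (p x + p y) \<in> Q" by (simp add: algebra_simps)
  qed
  moreover have "p (c *\<^sub>R x) = c *\<^sub>R p x" if "x \<in> set_plus_of Q U" for x c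
  proof (rule p)
    show "c *\<^sub>R p x \<in> U" by (rule subspace_scale[OF U p'(1)[OF that]])
    have "c *\<^sub>R (x - p x) \<in> Q" by (rule subspace_scale[OF Q p'(2)[OF that]])
    then show "c *\<^sub>R x - c *\<^sub>R p x \<in> Q" by (simp add: algebra_simps)
  qed
  ultimately have lin: "linear_map scaleR (set_plus_of Q U) scaleR U p"
    using p'(1) by (simp add: linear_map_def)
  have "p x = 0" if "x \<in> Q" for x using that U by (intro p) (auto simp: subspace_0)
  moreover have "p x = x" if "x \<in> U" for x using that Q by (intro p) (auto simp: subspace_0)
  ultimately show thesis using that[OF lin] p'(2) by blast
qed

lemma subspace_set_plus_of:
  assumes "subspace Q" "subspace U"
  shows "subspace (set_plus_of Q U)"
  using subspace_sums[OF assms] by (simp add: set_plus_of_def)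

lemma set_plus_of_upper:
  assumes "subspace Q" "subspace U"
  shows "Q \<subseteq> set_plus_of Q U" "U \<subseteq> set_plus_of Q U"
proof -
  have "x = x + 0" "x = 0 + x" for x :: 'a by auto
  then show "Q \<subseteq> set_plus_of Q U" "U \<subseteq> set_plus_of Q U"
    using subspace_0[OF assms(1)] subspace_0[OF assms(2)] unfolding set_plus_of_def by blast+
qed

lemma sp1_plus_coordinates:
  fixes q U :: "'g::real_vector set"
  assumes iso: "isomorphic_to_matrices q br (sp_algebra :: (complex^(1 + 1)^(1 + 1)) set)"
    and q: "subspace q" and U: "subspace U" and qU: "q \<inter> U = {0}"
  obtains e :: "nat \<Rightarrow> 'g" and co :: "nat \<Rightarrow> 'g \<Rightarrow> real" and p where
    "\<And>i. i \<in> N3 \<Longrightarrow> e i \<in> q"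
    "\<And>i. linear_map scaleR (set_plus_of q U) (*) UNIV (co i)"
    "linear_map scaleR (set_plus_of q U) scaleR U p"
    "\<And>x. x \<in> set_plus_of q U \<Longrightarrow> x = (\<Sum>i\<in>N3. co i x *\<^sub>R e i) + p x"
    "\<And>i j. i \<in> N3 \<Longrightarrow> j \<in> N3 \<Longrightarrow> co i (e j) = (if i = j then 1 else 0)"
    "\<And>x. x \<in> q \<Longrightarrow> p x = 0" "\<And>i v. v \<in> U \<Longrightarrow> co i v = 0" "\<And>v. v \<in> U \<Longrightarrow> p v = v"
proof -
  let ?m = "set_plus_of q U"
  obtain e :: "nat \<Rightarrow> 'g" and \<xi> where e: "\<And>i. i \<in> N3 \<Longrightarrow> e i \<in> q"
    and \<xi>: "\<And>i. linear_map scaleR q (*) UNIV (\<xi> i)"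
    and \<xi>_expand: "\<And>x. x \<in> q \<Longrightarrow> x = (\<Sum>i\<in>N3. \<xi> i x *\<^sub>R e i)"
    and \<xi>_e: "\<And>i j. i \<in> N3 \<Longrightarrow> j \<in> N3 \<Longrightarrow> \<xi> i (e j) = (if i = j then 1 else (0::real))"
    by (rule sp1_coordinates[OF iso q]) (rule that; assumption)
  obtain p where p: "linear_map scaleR ?m scaleR U p" and p_q: "\<And>x. x \<in> q \<Longrightarrow> p x = 0"
    and p_U: "\<And>x. x \<in> U \<Longrightarrow> p x = x" and p_diff: "\<And>x. x \<in> ?m \<Longrightarrow> x - p x \<in> q"
    by (rule direct_sum_projection[OF q U qU]) (rule that; assumption)
  define co where "co i x = \<xi> i (x - p x)" for i x
  have \<xi>0: "\<xi> i 0 = 0" for i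
    by (rule linear_map_0[OF _ vector_space_mult \<xi>]) (simp add: q)
  have co: "linear_map scaleR ?m (*) UNIV (co i)" for i
  proof -
    have "co i (x + y) = co i x + co i y" if "x \<in> ?m" "y \<in> ?m" for x y
    proof -
      have eq: "x + y - p (x + y) = (x - p x) + (y - p y)"
        using linear_map_plus[OF p that] by simp
      show ?thesis
        unfolding co_def eq by (rule linear_map_plus[OF \<xi> p_diff[OF that(1)] p_diff[OF that(2)]])
    qed
    moreover have "co i (r *\<^sub>R x) = r * co i x" if "x \<in> ?m" for x r
    proof -
      have eq: "r *\<^sub>R x - p (r *\<^sub>R x) = r *\<^sub>R (x - p x)"
        using linear_map_scale[OF p that] by (simp add: scaleR_diff_right)
      show ?thesis unfolding co_def eq by (rule linear_map_scale[OF \<xi> p_diff[OF that]])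
    qed
    ultimately show ?thesis by (simp add: linear_map_def)
  qed
  show thesis
  proof (rule that[of e co p, OF e co p])
    show "x = (\<Sum>i\<in>N3. co i x *\<^sub>R e i) + p x" if "x \<in> ?m" for x
      using \<xi>_expand[OF p_diff[OF that]] by (simp add: co_def algebra_simps)
    show "co i (e j) = (if i = j then 1 else 0)" if "i \<in> N3" "j \<in> N3" for i j
      using \<xi>_e[OF that] p_q[OF e[OF that(2)]] by (simp add: co_def)
    show "co i v = 0" if "v \<in> U" for i v using p_U[OF that] \<xi>0 by (simp add: co_def)
  qed (use p_q p_U in auto)
qed

theorem lemma4p12:
  fixes s :: nat
    and g g\<^sub>0 g\<^sub>1 q h m :: "'g::real_vector set"
    and br :: "'g \<Rightarrow> 'g \<Rightarrow> 'g"
    and scW :: "complex \<Rightarrow> 'w::ab_group_add \<Rightarrow> 'w"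
    and W :: "'w set"
    and act :: "'g \<times> 'g \<Rightarrow> 'w \<Rightarrow> 'w"
  assumes "s \<in> {1..5}"
    and "compact_simple (g_type s) g br"
    and "lie_subalgebra scaleR g br h"
    and "is_isotropy_algebra s h br"
    and "Z2_graded g br g\<^sub>0 g\<^sub>1"
    and "sum_of_ideals g\<^sub>0 br q h"
    and "isomorphic_to_matrices q br (sp_algebra :: (complex^(1 + 1)^(1 + 1)) set)"
    and "highest_weight_module (h_type s) (W_weight s) cscale (complexification h) (cbracket br)
           scW W act"
    and "odd_part_iso br q h g\<^sub>1 scW W act"
    and "m = set_plus_of q g\<^sub>1"
  shows "hom_dim h
           dual_scale (tensor_product scaleR m scaleR m)
             (\<lambda>x. tensor_action scaleR m scaleR m (br x) (br x))
           scaleR m br = 63 \<and>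
         hom_dim h
           scaleR m br
           dual_scale (exterior_power scaleR m 2) (\<lambda>x. exterior_action scaleR m 2 (br x)) = 30 \<and>
         hom_dim h
           dual_scale (exterior_power scaleR m 3) (\<lambda>x. exterior_action scaleR m 3 (br x))
           (*) (UNIV :: real set) (\<lambda>x c. 0) = 10"
proof -
  have L: "lie_algebra scaleR g br" and fin: "findim scaleR g"
    and neg: "\<And>x. x \<in> g \<Longrightarrow> x \<noteq> 0 \<Longrightarrow> killing_form scaleR g br x x < 0"
    using assms(2) by (auto simp: compact_simple_def simple_lie_algebra_def)
  have g: "subspace g" using L by (simp add: lie_algebra_def)
  have sub: "subspace g\<^sub>0" "subspace g\<^sub>1" and gs: "g = set_plus_of g\<^sub>0 g\<^sub>1" and g01: "g\<^sub>0 \<inter> g\<^sub>1 = {0}"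
    and br01: "\<And>x y. x \<in> g\<^sub>0 \<Longrightarrow> y \<in> g\<^sub>1 \<Longrightarrow> br x y \<in> g\<^sub>1"
    using assms(5) by (auto simp: Z2_graded_def direct_sum_def)
  have q: "subspace q" "q \<subseteq> g\<^sub>0" "\<And>x y. x \<in> g\<^sub>0 \<Longrightarrow> y \<in> q \<Longrightarrow> br x y \<in> q"
    and h: "subspace h" "h \<subseteq> g\<^sub>0" "\<And>x y. x \<in> g\<^sub>0 \<Longrightarrow> y \<in> h \<Longrightarrow> br x y \<in> h"
    and qh: "q \<inter> h = {0}"
    using assms(6) by (auto simp: sum_of_ideals_def lie_ideal_def direct_sum_def subspace_raw_def)
  have g0g: "g\<^sub>0 \<subseteq> g" and g1g: "g\<^sub>1 \<subseteq> g"
    unfolding gs by (rule set_plus_of_upper[OF sub])+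
  have m: "m = set_plus_of q g\<^sub>1" by (rule assms(10))
  have qm: "q \<subseteq> m" and g1m: "g\<^sub>1 \<subseteq> m"
    unfolding m by (rule set_plus_of_upper[OF q(1) sub(2)])+
  have sm: "subspace m" unfolding m by (rule subspace_set_plus_of[OF q(1) sub(2)])
  have mg: "m \<subseteq> g"
    unfolding m set_plus_of_def using q(2) g0g g1g g by (auto intro: subspace_add)
  have qg1: "q \<inter> g\<^sub>1 = {0}" using g01 q sub by (auto simp: subspace_0)
  have findim_m: "findim scaleR m" and findim_g1: "findim scaleR g\<^sub>1"
    using findim_subspace[OF real_vector.vector_space_axioms fin] sm mg sub g1g
    by (auto simp: subspace_raw_def)
  \<comment> \<open>\<open>[h, q]\<close> lies in both ideals\<close>
  have hq: "br a x = 0" if "a \<in> h" "x \<in> q" for a x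
  proof -
    have ag: "a \<in> g\<^sub>0" "x \<in> g\<^sub>0" "a \<in> g" "x \<in> g" using that q(2) h(2) g0g by auto
    have "br a x \<in> q" by (rule q(3)[OF ag(1) that(2)])
    moreover have "br a x \<in> h"
      using h(3)[OF ag(2) that(1)] subspace_neg[OF h(1)] lie_bracket_skew[OF L ag(3,4)] by simp
    ultimately show ?thesis using qh by auto
  qed
  have ad: "linear_map scaleR g scaleR g (br x)" if "x \<in> g" for x
    by (rule lie_bracket_linear(1)[OF L that that])
  have ad1: "linear_map scaleR g\<^sub>1 scaleR g\<^sub>1 (br x)" if "x \<in> g\<^sub>0" for x
    using ad[of x] that g0g g1g br01[OF that] by (auto simp: linear_map_def subset_eq)
  have br0: "br 0 y = 0" if "y \<in> g" for y
    using linear_map_0[OF _ real_vector.vector_space_axioms lie_bracket_linear(2)[OF L that that]] g by simp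
  have hg0: "x \<in> g\<^sub>0" if "x \<in> h" for x using h(2) that by auto
  have qg0: "x \<in> g\<^sub>0" if "x \<in> q" for x using q(2) that by auto
  have irr: "irreducible_module cscale (h \<times> h) (cbracket br) scW W act"
    using assms(8) by (simp add: highest_weight_module_def)
  obtain S where S: "S \<subseteq> {1..dynkin_rank (h_type s)}"
    "\<And>j. j \<in> {1..dynkin_rank (h_type s)} \<Longrightarrow> even (\<Sum>i\<in>S. cartan_matrix (h_type s) j i)"
    "odd (\<Sum>i\<in>S. W_weight s i)"
    using W_weight_parity[OF assms(1)] by blast
  obtain c where c: "c \<in> h \<times> h" and span: "g\<^sub>1 \<times> g\<^sub>1 \<subseteq>
      module.span cscale {z \<in> g\<^sub>1 \<times> g\<^sub>1. \<exists>k::int. cbracket br c z = cscale (of_int (2 * k + 1)) z}"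
    using odd_part_spanned_by_odd_vectors[OF assms(9,8) S q(1) sub(2)] br01 hg0 qg0 by blast
  note endo = odd_part_endomorphisms[OF assms(9) irr findim_g1 q(1) sub(2) ad1[OF qg0] ad1[OF hg0]]
  have br0': "br 0 y = 0" if "y \<in> g\<^sub>1" for y using br0 that g1g by auto
  have e_g1: "br x y \<in> g\<^sub>1" if "x \<in> q" "y \<in> g\<^sub>1" for x y by (rule br01[OF qg0[OF that(1)] that(2)])
  have h_g1: "br a x \<in> g\<^sub>1" if "a \<in> h" "x \<in> g\<^sub>1" for a x by (rule br01[OF hg0[OF that(1)] that(2)])
  obtain e :: "nat \<Rightarrow> 'g" and co p where e: "\<And>i. i \<in> N3 \<Longrightarrow> e i \<in> q"
    and co: "\<And>i. linear_map scaleR m (*) UNIV (co i)"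
    and p: "linear_map scaleR m scaleR g\<^sub>1 p"
    and decomp: "\<And>x. x \<in> m \<Longrightarrow> x = (\<Sum>i\<in>N3. co i x *\<^sub>R e i) + p x"
    and co_e: "\<And>i j. i \<in> N3 \<Longrightarrow> j \<in> N3 \<Longrightarrow> co i (e j) = (if i = j then 1 else (0::real))"
    and p_q: "\<And>x. x \<in> q \<Longrightarrow> p x = 0" and co_g1: "\<And>i v. v \<in> g\<^sub>1 \<Longrightarrow> co i v = 0"
    and p_g1: "\<And>v. v \<in> g\<^sub>1 \<Longrightarrow> p v = v"
    by (rule sp1_plus_coordinates[OF assms(7) q(1) sub(2) qg1, folded m]) (rule that; assumption)
  have e_g: "e i \<in> g" if "i \<in> N3" for i using qg0[OF e[OF that]] g0g by auto
  have combine: "br (\<Sum>l\<in>N3. r l *\<^sub>R e l) x = (\<Sum>l\<in>N3. r l *\<^sub>R br (e l) x)" if "x \<in> g\<^sub>1" for r x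
  proof -
    have x: "x \<in> g" using that g1g by auto
    show ?thesis
      by (rule linear_map_sum[OF _ real_vector.vector_space_axioms lie_bracket_linear(2)[OF L x x]])
        (use g e_g in auto)
  qed
  have e_sum: "(\<Sum>l\<in>N3. r l *\<^sub>R e l) \<in> q" for r
    using e by (intro subspace_sum[OF q(1)] subspace_scale[OF q(1)])
  interpret K: killing_pairing g h g\<^sub>1 br e
  proof
    show "\<exists>r. \<forall>x\<in>g\<^sub>1. f x = r 0 *\<^sub>R x + (\<Sum>l\<in>N3. r l *\<^sub>R br (e l) x)"
      if f: "linear_map scaleR g\<^sub>1 scaleR g\<^sub>1 f"
        and comm: "\<And>a x. a \<in> h \<Longrightarrow> x \<in> g\<^sub>1 \<Longrightarrow> f (br a x) = br a (f x)" for f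
    proof -
      obtain r0 z where z: "z \<in> q" and fz: "\<And>y. y \<in> g\<^sub>1 \<Longrightarrow> f y = r0 *\<^sub>R y + br z y"
        using endo(1)[OF _ _ br0' f comm] by blast
      let ?r = "\<lambda>l. if l = 0 then r0 else co l z"
      have "(\<Sum>l\<in>N3. ?r l *\<^sub>R e l) = z" using decomp[of z] z qm p_q[OF z] by auto
      then have "f x = ?r 0 *\<^sub>R x + (\<Sum>l\<in>N3. ?r l *\<^sub>R br (e l) x)" if "x \<in> g\<^sub>1" for x
        unfolding fz[OF that] combine[OF that, symmetric] by (simp only: if_True refl)
      then show ?thesis by (intro exI[of _ ?r] ballI)
    qed
    show "r l = 0"
      if zero: "\<And>x. x \<in> g\<^sub>1 \<Longrightarrow> r 0 *\<^sub>R x + (\<Sum>l\<in>N3. r l *\<^sub>R br (e l) x) = 0" and l: "l \<in> N4" for r l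
    proof -
      let ?x = "\<Sum>l\<in>N3. r l *\<^sub>R e l"
      have "r 0 *\<^sub>R y + br ?x y = 0" if "y \<in> g\<^sub>1" for y
        using zero[OF that] unfolding combine[OF that] .
      then have r0: "r 0 = 0" and x0: "?x = 0" using endo(2)[OF _ _ br0' e_sum] by blast+
      have "r i = 0" if i: "i \<in> N3" for i
      proof -
        have "co i ?x = (\<Sum>l\<in>N3. r l * co i (e l))"
          by (rule linear_map_sum[OF _ vector_space_mult co]) (use sm e qm in auto)
        also have "\<dots> = r i" using i co_e[OF i] by auto
        finally show ?thesis
          unfolding x0 using linear_map_0[OF _ vector_space_mult co, of i] sm by simp
      qed
      with r0 l show ?thesis by auto
    qed
  qed (use L fin neg sub(2) g1g h_g1 e_g hg0 g0g e_g1 e hq in auto)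
  interpret isotropy_module h br m g\<^sub>1 e co p K.\<omega>
  proof
    show "linear_map scaleR m scaleR m (br a)" if a: "a \<in> h" for a
    proof -
      have "br a x \<in> m" if x: "x \<in> m" for x
      proof -
        obtain y z where yz: "x = y + z" "y \<in> q" "z \<in> g\<^sub>1"
          using x unfolding m set_plus_of_def by blast
        have "br a x = br a y + br a z"
          unfolding yz(1) using a yz hg0 qg0 g0g g1g by (intro linear_map_plus[OF ad]) auto
        then have "br a x \<in> g\<^sub>1" using hq[OF a yz(2)] h_g1[OF a yz(3)] by simp
        then show ?thesis using g1m by auto
      qed
      then show ?thesis
        using ad[of a] a hg0 g0g mg by (auto simp: linear_map_def subset_eq)
    qed
    show "f v = 0" if "linear_map scaleR g\<^sub>1 (*) UNIV f" "\<And>a v. a \<in> h \<Longrightarrow> v \<in> g\<^sub>1 \<Longrightarrow> f (br a v) = 0" "v \<in> g\<^sub>1"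
      for f v
      by (rule invariant_functional_vanishes[OF sub(2) c span that(1,2) h_g1 that(3)])
    show "T x y z = 0" if "invariant_trilinear h br g\<^sub>1 T" "x \<in> g\<^sub>1" "y \<in> g\<^sub>1" "z \<in> g\<^sub>1" for T x y z
      by (rule invariant_trilinear_vanishes[OF sub(2) c span that(1) h_g1 that(2-4)])
    show "\<exists>r. \<forall>x\<in>g\<^sub>1. \<forall>y\<in>g\<^sub>1. B x y = (\<Sum>l\<in>N4. r l * K.\<omega> l x y)"
      if "invariant_bilinear h br g\<^sub>1 B" for B by (rule K.\<omega>_spans[OF that])
    show "r l = 0" if "\<And>x y. x \<in> g\<^sub>1 \<Longrightarrow> y \<in> g\<^sub>1 \<Longrightarrow> (\<Sum>l\<in>N4. r l * K.\<omega> l x y) = 0" "l \<in> N4" for r l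
      by (rule K.\<omega>_independent[OF that])
    show "K.\<omega> 0 x y = K.\<omega> 0 y x" if "x \<in> g\<^sub>1" "y \<in> g\<^sub>1" for x y
      using K.K_sym[OF K.in_g[OF that(1)] K.in_g[OF that(2)]] by (simp add: K.\<omega>_def)
    show "K.\<omega> 0 x x > 0" if "x \<in> g\<^sub>1" "x \<noteq> 0" for x
      using neg[OF K.in_g[OF that(1)] that(2)] by (simp add: K.\<omega>_def K.K_def)
    show "e i \<in> m" if "i \<in> N3" for i using e[OF that] qm by auto
    show "p (e i) = 0" if "i \<in> N3" for i by (rule p_q[OF e[OF that]])
    show "br a (e i) = 0" if "a \<in> h" "i \<in> N3" for a i by (rule hq[OF that(1) e[OF that(2)]])
    show "co i (e j) = (if i = j then 1 else 0)" if "i \<in> N3" "j \<in> N3" for i j by (rule co_e[OF that])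
    show "x = (\<Sum>i\<in>N3. co i x *\<^sub>R e i) + p x" if "x \<in> m" for x by (rule decomp[OF that])
  qed (use sm findim_m sub(2) g1m co co_g1 p p_g1 h_g1 K.\<omega>_invariant K.\<omega>_alternating in blast)+
  show ?thesis using dim_Hom_TP dim_Hom_Ext2 dim_Hom_Ext3 by blast
qed

end
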